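(* Let $f:\Delta\to\mathbb{C}$ be the generator of a semigroup on $\Delta$ of dilation or hyperbolic type having the Denjoy--Wolff point $\tau\in\overline{\Delta}$, let $r\in\mathbb{N}$ ($r\ge1$), and let $Q:Y\to\mathbb{C}$ be a homogeneous polynomial of degree $r$. Denote $\mu:=f'(\tau)$. Then for each $\lambda\in\mathbb{C}$ with $\Re\lambda>0$, the mapping $\widehat f:\mathbb{B}\to\mathbb{C}\times Y$ defined by $$\widehat f(x,y):=\left(f(x)+Q(y),\ \frac1r\left(f'(x)+r\lambda-\frac{\mu-f'(x)}{f(x)}\,Q(y)\right)y\right)$$ is a semigroup generator on $\mathbb{B}$ whenever $$\sup_{\|y\|_Y=1}|Q(y)|\le\frac{r\,\Re\lambda}{4}.$$
   Context: $\Delta=\{z\in\mathbb{C}:|z|<1\}$. $(Y,\|\cdot\|_Y)$ is a complex Banach space, and $$\mathbb{B}:=\{(x,y)\in\mathbb{C}\times Y:\ |x|^2+\|y\|_Y^r<1\},$$ which is the open unit ball of $\mathbb{C}\times Y$ for the norm given by the Minkowski functional of $\mathbb{B}$. Homogeneous polynomials are continuous. For a domain $D$ in a complex Banach space $X$, a (one-parameter continuous) semigroup on $D$ is a family $\{F_t\}_{t\ge0}$ of holomorphic self-mappings of $D$ with $F_{t+s}=F_t\circ F_s$ for $t,s\ge0$ and $\lim_{t\to0^+}F_t(x)=x$ for all $x\in D$. It is generated if for each $x\in D$ the strong limit $$g(x):=\lim_{t\to0^+}\frac1t\bigl(x-F_t(x)\bigr)$$ exists; then $g:D\to X$ is called the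 (infinitesimal) generator of the semigroup. "Semigroup generator on $D$" means a mapping that is the generator of some semigroup on $D$. A semigroup on $\Delta$ with generator $f$ and Denjoy--Wolff point $\tau$ (the common attracting point of the $F_t$, $t>0$) is of dilation type if $\tau\in\Delta$, in which case $f(\tau)=0$ and $\Re f'(\tau)>0$; it is of hyperbolic type if $\tau\in\partial\Delta$ and the angular derivative $f'(\tau)=\angle\lim_{z\to\tau}\frac{f(z)}{z-\tau}$ is a positive real number. In the dilation case the function $\frac{\mu-f'(x)}{f(x)}$ has a removable singularity at $x=\tau$, and its value there is understood as its holomorphic extension. *)

theory Defs
  imports
    "HOL-Analysis.Analysis"
    "HOL-Complex_Analysis.Complex_Analysis"
    "HOL-Library.Extended_Real"
begin

class complex_normed_vector = real_normed_vector +
  fixes scaleC :: "complex \<Rightarrow> 'a \<Rightarrow> 'a" (infixr "*\<^sub>C" 75)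
  assumes scaleC_add_right: "a *\<^sub>C (x + y) = a *\<^sub>C x + a *\<^sub>C y"
    and scaleC_add_left: "(a + b) *\<^sub>C x = a *\<^sub>C x + b *\<^sub>C x"
    and scaleC_scaleC: "a *\<^sub>C b *\<^sub>C x = (a * b) *\<^sub>C x"
    and scaleR_scaleC: "scaleR t x = complex_of_real t *\<^sub>C x"
    and norm_scaleC: "norm (a *\<^sub>C x) = cmod a * norm x"

class complex_banach = complex_normed_vector + banach

instantiation complex :: complex_banach
begin

definition scaleC_complex_def: "a *\<^sub>C (z::complex) = a * z"

instance
  by standard (auto simp: scaleC_complex_def algebra_simps scaleR_conv_of_real norm_mult)

end

text \<open>The library norm on products is \<open>sqrt ((norm x)\<^sup>2 + (norm y)\<^sup>2)\<close>. Limits and complex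
  differentiability are the same for every equivalent norm, in particular for the Minkowski
  functional of the ball \<open>unit_domain\<close> below.\<close>

instantiation prod :: (complex_normed_vector, complex_normed_vector) complex_normed_vector
begin

definition scaleC_prod_def: "a *\<^sub>C p = (a *\<^sub>C fst p, a *\<^sub>C snd p)"

instance
proof
  fix a b :: complex and x y :: "'a \<times> 'b" and t :: real
  show "a *\<^sub>C (x + y) = a *\<^sub>C x + a *\<^sub>C y"
    by (simp add: scaleC_prod_def scaleC_add_right)
  show "(a + b) *\<^sub>C x = a *\<^sub>C x + b *\<^sub>C x"
    by (simp add: scaleC_prod_def scaleC_add_left)
  show "a *\<^sub>C b *\<^sub>C x = (a * b) *\<^sub>C x"
    by (simp add: scaleC_prod_def scaleC_scaleC)
  show "scaleR t x = complex_of_real t *\<^sub>C x"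
    by (simp add: scaleC_prod_def scaleR_prod_def scaleR_scaleC)
  have "sqrt ((cmod a * norm (fst x))\<^sup>2 + (cmod a * norm (snd x))\<^sup>2)
      = sqrt ((cmod a)\<^sup>2 * ((norm (fst x))\<^sup>2 + (norm (snd x))\<^sup>2))"
    by (simp add: power_mult_distrib distrib_left)
  then show "norm (a *\<^sub>C x) = cmod a * norm x"
    by (simp add: scaleC_prod_def norm_prod_def norm_scaleC real_sqrt_mult)
qed

end

instance prod :: (complex_banach, complex_banach) complex_banach ..

definition holomorphic_map_on ::
    "('a::complex_normed_vector \<Rightarrow> 'b::complex_normed_vector) \<Rightarrow> 'a set \<Rightarrow> bool" where
  "holomorphic_map_on h D \<longleftrightarrow>
     (\<forall>x\<in>D. \<exists>L. (h has_derivative L) (at x within D) \<and> (\<forall>c v. L (c *\<^sub>C v) = c *\<^sub>C L v))"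

lemma holomorphic_map_on_complex_iff:
  fixes h :: "complex \<Rightarrow> complex"
  shows "holomorphic_map_on h D \<longleftrightarrow> h holomorphic_on D"
proof -
  have "(\<exists>L. (h has_derivative L) (at x within D) \<and> (\<forall>c v. L (c * v) = c * L v)) \<longleftrightarrow>
        h field_differentiable (at x within D)" for x
  proof
    assume "\<exists>L. (h has_derivative L) (at x within D) \<and> (\<forall>c v. L (c * v) = c * L v)"
    then obtain L where L: "(h has_derivative L) (at x within D)"
      and "\<forall>c v. L (c * v) = c * L v" by blast
    then have "L v = L 1 * v" for v
      by (metis mult.commute mult.right_neutral)
    then have "L = (*) (L 1)"
      by blast
    with L show "h field_differentiable (at x within D)"
      by (metis field_differentiable_def has_field_derivative_def)
  next
    assume "h field_differentiable (at x within D)"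
    then obtain d where "(h has_derivative (*) d) (at x within D)"
      by (auto simp: field_differentiable_def has_field_derivative_def)
    moreover have "\<forall>c v. d * (c * v) = c * (d * v)"
      by simp
    ultimately show "\<exists>L. (h has_derivative L) (at x within D) \<and> (\<forall>c v. L (c * v) = c * L v)"
      by blast
  qed
  then show ?thesis
    by (simp add: holomorphic_map_on_def holomorphic_on_def scaleC_complex_def)
qed

definition continuous_semigroup_on ::
    "'a::complex_normed_vector set \<Rightarrow> (real \<Rightarrow> 'a \<Rightarrow> 'a) \<Rightarrow> bool" where
  "continuous_semigroup_on D F \<longleftrightarrow>
     (\<forall>t\<ge>0. holomorphic_map_on (F t) D \<and> F t ` D \<subseteq> D) \<and>
     (\<forall>t\<ge>0. \<forall>s\<ge>0. \<forall>x\<in>D. F (t + s) x = F t (F s x)) \<and>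
     (\<forall>x\<in>D. ((\<lambda>t. F t x) \<longlongrightarrow> x) (at_right 0))"

definition generator_of_on ::
    "('a::complex_normed_vector \<Rightarrow> 'a) \<Rightarrow> (real \<Rightarrow> 'a \<Rightarrow> 'a) \<Rightarrow> 'a set \<Rightarrow> bool" where
  "generator_of_on g F D \<longleftrightarrow>
     continuous_semigroup_on D F \<and>
     (\<forall>x\<in>D. ((\<lambda>t. (1 / t) *\<^sub>R (x - F t x)) \<longlongrightarrow> g x) (at_right 0))"

definition semigroup_generator_on ::
    "('a::complex_normed_vector \<Rightarrow> 'a) \<Rightarrow> 'a set \<Rightarrow> bool" where
  "semigroup_generator_on g D \<longleftrightarrow> (\<exists>F. generator_of_on g F D)"

definition denjoy_wolff_point :: "(real \<Rightarrow> complex \<Rightarrow> complex) \<Rightarrow> complex \<Rightarrow> bool" where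
  "denjoy_wolff_point F \<tau> \<longleftrightarrow>
     \<tau> \<in> cball 0 1 \<and> (\<forall>t>0. \<forall>z\<in>ball 0 1. (\<lambda>n. (F t ^^ n) z) \<longlonglongrightarrow> \<tau>)"

definition stolz_region :: "complex \<Rightarrow> real \<Rightarrow> complex set" where
  "stolz_region \<tau> k = {z \<in> ball 0 1. cmod (z - \<tau>) < k * (1 - cmod z)}"

text \<open>Angular derivative of a generator at a boundary null point: the nontangential limit of
  \<open>f z / (z - \<tau>)\<close> (the nontangential boundary value of \<open>f\<close> at \<open>\<tau>\<close> being \<open>0\<close>).\<close>

definition has_angular_derivative :: "(complex \<Rightarrow> complex) \<Rightarrow> complex \<Rightarrow> complex \<Rightarrow> bool" where
  "has_angular_derivative f \<tau> m \<longleftrightarrow>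
     (\<forall>k>1. ((\<lambda>z. f z / (z - \<tau>)) \<longlongrightarrow> m) (at \<tau> within stolz_region \<tau> k))"

definition dilation_type :: "(real \<Rightarrow> complex \<Rightarrow> complex) \<Rightarrow> complex \<Rightarrow> bool" where
  "dilation_type F \<tau> \<longleftrightarrow> denjoy_wolff_point F \<tau> \<and> \<tau> \<in> ball 0 1"

definition hyperbolic_type ::
    "(real \<Rightarrow> complex \<Rightarrow> complex) \<Rightarrow> (complex \<Rightarrow> complex) \<Rightarrow> complex \<Rightarrow> bool" where
  "hyperbolic_type F f \<tau> \<longleftrightarrow>
     denjoy_wolff_point F \<tau> \<and> \<tau> \<in> sphere 0 1 \<and>
     (\<exists>m>0. has_angular_derivative f \<tau> (complex_of_real m))"

text \<open>The relation \<open>f'(\<tau>) = \<mu>\<close> at the Denjoy--Wolff point, read as an ordinary derivative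
  inside the disk and as an angular derivative on the circle.\<close>

definition has_derivative_at_dw :: "(complex \<Rightarrow> complex) \<Rightarrow> complex \<Rightarrow> complex \<Rightarrow> bool" where
  "has_derivative_at_dw f \<tau> \<mu> \<longleftrightarrow>
     (if \<tau> \<in> ball 0 1 then (f has_field_derivative \<mu>) (at \<tau>) else has_angular_derivative f \<tau> \<mu>)"

text \<open>The first condition says that \<open>A\<close> is a map on \<open>m\<close>-tuples, a tuple being represented by a
  sequence of which only the entries with index below \<open>m\<close> matter.\<close>

definition bounded_multilinear ::
    "nat \<Rightarrow> ((nat \<Rightarrow> 'a::complex_normed_vector) \<Rightarrow> 'b::complex_normed_vector) \<Rightarrow> bool" where
  "bounded_multilinear m A \<longleftrightarrow>
     (\<forall>v w. (\<forall>i<m. v i = w i) \<longrightarrow> A v = A w) \<and>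
     (\<forall>v. \<forall>i<m. \<forall>x y. A (v(i := x + y)) = A (v(i := x)) + A (v(i := y))) \<and>
     (\<forall>v. \<forall>i<m. \<forall>c x. A (v(i := c *\<^sub>C x)) = c *\<^sub>C A (v(i := x))) \<and>
     (\<exists>K. \<forall>v. norm (A v) \<le> K * (\<Prod>i<m. norm (v i)))"

definition homogeneous_polynomial ::
    "nat \<Rightarrow> ('a::complex_normed_vector \<Rightarrow> 'b::complex_normed_vector) \<Rightarrow> bool" where
  "homogeneous_polynomial m P \<longleftrightarrow> (\<exists>A. bounded_multilinear m A \<and> (\<forall>y. P y = A (\<lambda>_. y)))"

definition unit_domain :: "nat \<Rightarrow> (complex \<times> 'y::complex_normed_vector) set" where
  "unit_domain r = {(x, y). (cmod x)\<^sup>2 + norm y ^ r < 1}"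

text \<open>\<open>remove_sings\<close> supplies the value at the removable singularity \<open>x = \<tau>\<close> of the quotient
  \<open>(\<mu> - f' x) / f x\<close> when \<open>\<tau>\<close> lies in the disk; it changes nothing at the points where the quotient
  is analytic.\<close>

definition extended_generator ::
    "(complex \<Rightarrow> complex) \<Rightarrow> complex \<Rightarrow> nat \<Rightarrow> complex \<Rightarrow> ('y::complex_normed_vector \<Rightarrow> complex)
       \<Rightarrow> complex \<times> 'y \<Rightarrow> complex \<times> 'y" where
  "extended_generator f \<mu> r lam Q = (\<lambda>(x, y).
     (f x + Q y,
      (1 / of_nat r * (deriv f x + of_nat r * lam
          - remove_sings (\<lambda>z. (\<mu> - deriv f z) / f z) x * Q y)) *\<^sub>C y))"

end

theory Submission
  imports Defs
begin

text \<open>A Koenigs function \<open>h\<close> of the given semigroup satisfies \<open>deriv h z * f z = \<mu> * h z\<close>, so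
  \<open>h (F t z) = exp (- \<mu> * t) * h z\<close> and \<open>(\<mu> - f') / f = h'' / h'\<close>. In the variables \<open>h x\<close> and
  \<open>h' x * Q y\<close> the system generated by the extended vector field becomes linear and can be solved
  explicitly; what has to be shown is that the solution stays in the range of \<open>h\<close> and in the ball. Both
  follow from Koebe's theorem in its infinitesimal form
  \<open>cmod ((1 - (cmod x)\<^sup>2) * h'' x / h' x - 2 * cnj x) \<le> 4\<close>, which says that the conformal radius of the range of
  \<open>h\<close> is a Lipschitz function with constant 4; here the bound on \<open>Q\<close> enters.

  This inequality and the univalence of \<open>h\<close> are derived from the Berkson--Porta representation
  \<open>f z = (z - \<tau>) * (1 - cnj \<tau> * z) * P z\<close> with \<open>Re (P z) \<ge> 0\<close>: the former from the Herglotz formula for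
  \<open>P\<close>, the latter from the criterion of Noshiro and Warschawski in a logarithmic coordinate. The
  boundary case is obtained by moving \<open>\<tau>\<close> radially into the disc.\<close>

subsection \<open>The Schwarz--Pick lemma\<close>

text \<open>For \<open>cmod x < 1\<close>, membership of \<open>(x, y)\<close> in the ball says that
  \<open>a = cmod (deriv h x) * norm y ^ r\<close> is smaller than the conformal radius at
  \<open>h x\<close>. Up to the factor \<open>exp (- \<mu> * t)\<close>, the linear flow displaces
  \<open>h x\<close> by at most \<open>a * (1 - q) / 4\<close> and replaces \<open>a\<close> by
  \<open>a * q\<close>, where \<open>q = exp (- r * Re lam * t)\<close>. The Lipschitz constant 4
  turns the displacement into a loss of at most \<open>a * (1 - q)\<close>, so a radius above
  \<open>a * q\<close> is left: the constant \<open>r * Re lam / 4\<close> balances the loss of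
  radius against the decay of \<open>norm y\<close>. The remaining factor is the action of
  \<open>F t\<close>, which by Schwarz-Pick shrinks the radius no faster than
  \<open>exp (- Re \<mu> * t)\<close>. The obstacle is regularity. The generator is only a pointwise
  one-sided limit of difference quotients, so its holomorphy has to come out of the Berkson-Porta
  representation. At a boundary point \<open>\<tau>\<close> there is only a nontangential limit,
  hence no local expansion to start from; univalence is therefore obtained from inequalities that
  survive a limit.\<close>

lemma one_minus_cnj_mult_nonzero:
  assumes "cmod a \<le> 1" "cmod z < 1"
  shows "1 - cnj a * z \<noteq> 0"
proof
  assume "1 - cnj a * z = 0"
  then have "cmod (cnj a * z) = 1"
    by (metis eq_iff_diff_eq_0 norm_one)
  moreover have "cmod a * cmod z \<le> 1 * cmod z"
    using assms by (intro mult_right_mono) auto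
  ultimately show False
    using assms by (simp add: norm_mult)
qed

lemma disc_identity:
  "(cmod (1 - cnj a * z))\<^sup>2 - (cmod (z - a))\<^sup>2 = (1 - (cmod a)\<^sup>2) * (1 - (cmod z)\<^sup>2)"
  unfolding cmod_power2 by (simp add: power2_eq_square algebra_simps)

lemma has_field_derivative_Moebius_function:
  assumes "1 - cnj w * z \<noteq> 0"
  shows "(Moebius_function 0 w has_field_derivative
           complex_of_real (1 - (cmod w)\<^sup>2) / (1 - cnj w * z)\<^sup>2) (at z)"
proof -
  have "((\<lambda>z. (z - w) / (1 - cnj w * z)) has_field_derivative
      ((1 - cnj w * z) - (z - w) * (- cnj w)) / ((1 - cnj w * z) * (1 - cnj w * z))) (at z)"
    using assms by (auto intro!: derivative_eq_intros)
  moreover have "(1 - cnj w * z) - (z - w) * (- cnj w) = complex_of_real (1 - (cmod w)\<^sup>2)"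
    unfolding of_real_diff complex_norm_square by (simp add: algebra_simps)
  moreover have "Moebius_function 0 w = (\<lambda>z. (z - w) / (1 - cnj w * z))"
    by (simp add: Moebius_function_simple fun_eq_iff)
  ultimately show ?thesis
    by (simp only: power2_eq_square)
qed

lemma Schwarz_Pick:
  assumes hol: "F holomorphic_on ball 0 1" and F: "\<And>z. cmod z < 1 \<Longrightarrow> cmod (F z) < 1"
    and a: "cmod a < 1"
  shows Schwarz_Pick_Moebius: "\<And>z. cmod z < 1 \<Longrightarrow>
          cmod (Moebius_function 0 (F a) (F z)) \<le> cmod (Moebius_function 0 a z)"
    and Schwarz_Pick_deriv: "cmod (deriv F a) * (1 - (cmod a)\<^sup>2) \<le> 1 - (cmod (F a))\<^sup>2"
proof -
  define g where "g = Moebius_function 0 (F a) \<circ> (F \<circ> Moebius_function 0 (- a))"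
  have g_lt: "cmod (g z) < 1" if "cmod z < 1" for z
  proof -
    have "cmod (Moebius_function 0 (- a) z) < 1"
      by (rule Moebius_function_norm_lt_1) (use that a in auto)
    then show ?thesis
      unfolding g_def o_def by (intro Moebius_function_norm_lt_1[OF F[OF a] F])
  qed
  have g_hol: "g holomorphic_on ball 0 1"
    unfolding g_def
  proof (intro holomorphic_on_compose_gen[where t = "ball 0 1"] Moebius_function_holomorphic hol F a)
    show "Moebius_function 0 (- a) ` ball 0 1 \<subseteq> ball 0 1"
      using a Moebius_function_norm_lt_1[of "- a"] by auto
    then show "(F \<circ> Moebius_function 0 (- a)) ` ball 0 1 \<subseteq> ball 0 1"
      using F by (force simp: image_subset_iff)
  qed (use a in auto)
  have Ma0: "Moebius_function 0 (- a) 0 = a"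
    by (simp add: Moebius_function_of_zero)
  have g0: "g 0 = 0"
    by (simp add: g_def Ma0 Moebius_function_eq_zero)
  show "cmod (Moebius_function 0 (F a) (F z)) \<le> cmod (Moebius_function 0 a z)" if z: "cmod z < 1" for z
  proof -
    have "Moebius_function 0 (- a) (Moebius_function 0 a z) = z"
      using Moebius_function_compose[of "- a" a z] a z by simp
    then have "g (Moebius_function 0 a z) = Moebius_function 0 (F a) (F z)"
      by (simp only: g_def o_def)
    then show ?thesis
      using Schwarz_Lemma(1)[OF g_hol g0 g_lt Moebius_function_norm_lt_1[OF a z], of 0] by simp
  qed
  have d1: "(Moebius_function 0 (- a) has_field_derivative complex_of_real (1 - (cmod a)\<^sup>2)) (at 0)"
    using has_field_derivative_Moebius_function[of "- a" 0] by simp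
  have d2: "(F has_field_derivative deriv F a) (at (Moebius_function 0 (- a) 0))"
    unfolding Ma0 using hol a by (intro holomorphic_derivI[of _ "ball 0 1"]) auto
  have Fa: "cmod (F a) < 1"
    using F a by blast
  have pos: "0 < 1 - (cmod (F a))\<^sup>2" "0 < 1 - (cmod a)\<^sup>2"
    using Fa a by (simp_all add: abs_square_less_1)
  have "1 - cnj (F a) * F a = complex_of_real (1 - (cmod (F a))\<^sup>2)"
    by (simp only: of_real_diff complex_norm_square) (simp add: mult.commute)
  then have d3: "(Moebius_function 0 (F a) has_field_derivative
      1 / complex_of_real (1 - (cmod (F a))\<^sup>2)) (at ((F \<circ> Moebius_function 0 (- a)) 0))"
  proof -
    assume eq: "1 - cnj (F a) * F a = complex_of_real (1 - (cmod (F a))\<^sup>2)"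
    have ne: "complex_of_real (1 - (cmod (F a))\<^sup>2) \<noteq> 0"
      using pos by (simp only: of_real_eq_0_iff)
    then have "complex_of_real (1 - (cmod (F a))\<^sup>2) / (complex_of_real (1 - (cmod (F a))\<^sup>2))\<^sup>2
        = 1 / complex_of_real (1 - (cmod (F a))\<^sup>2)"
      by (simp only: power2_eq_square) (simp add: divide_simps del: of_real_diff of_real_power)
    then show ?thesis
      using has_field_derivative_Moebius_function[of "F a" "F a"] ne unfolding eq o_def Ma0 by metis
  qed
  have "(g has_field_derivative 1 / complex_of_real (1 - (cmod (F a))\<^sup>2) *
      (deriv F a * complex_of_real (1 - (cmod a)\<^sup>2))) (at 0)"
    unfolding g_def by (intro DERIV_chain d3 d2 d1)
  then have "deriv g 0 = 1 / complex_of_real (1 - (cmod (F a))\<^sup>2) *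
      (deriv F a * complex_of_real (1 - (cmod a)\<^sup>2))"
    by (rule DERIV_imp_deriv)
  moreover have "cmod (deriv g 0) \<le> 1"
    by (rule Schwarz_Lemma(2)[OF g_hol g0 g_lt, of 0]) auto
  moreover have "\<bar>1 - (cmod (F a))\<^sup>2\<bar> = 1 - (cmod (F a))\<^sup>2" "\<bar>1 - (cmod a)\<^sup>2\<bar> = 1 - (cmod a)\<^sup>2"
    using pos by linarith+
  ultimately have "1 / (1 - (cmod (F a))\<^sup>2) * (cmod (deriv F a) * (1 - (cmod a)\<^sup>2)) \<le> 1"
    by (simp only: norm_mult norm_divide norm_of_real norm_one)
  then show "cmod (deriv F a) * (1 - (cmod a)\<^sup>2) \<le> 1 - (cmod (F a))\<^sup>2"
    using pos by (simp add: divide_simps)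
qed

lemma Schwarz_Pick_dist:
  assumes hol: "F holomorphic_on ball 0 1" and F: "\<And>z. cmod z < 1 \<Longrightarrow> cmod (F z) < 1"
    and a: "cmod a < 1" and z: "cmod z < 1"
  shows "cmod (F z - F a) * cmod (1 - cnj a * z) \<le> cmod (z - a) * cmod (1 - cnj (F a) * F z)"
proof -
  have "1 - cnj a * z \<noteq> 0" "1 - cnj (F a) * F z \<noteq> 0"
    using one_minus_cnj_mult_nonzero[of a z] one_minus_cnj_mult_nonzero[of "F a" "F z"] a z F[OF a] F[OF z]
    by auto
  then show ?thesis
    using Schwarz_Pick_Moebius[OF assms]
    by (simp add: Moebius_function_simple norm_divide divide_simps mult.commute split: if_splits)
qed

text \<open>Squaring the contraction estimate and applying \<open>disc_identity\<close> leaves the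
  factors \<open>1 - (cmod a)\<^sup>2\<close> and \<open>1 - (cmod (F a))\<^sup>2\<close> explicit.
  They can then be compared along an orbit even when the orbit runs to the circle.\<close>

lemma Schwarz_Pick_one_minus:
  assumes hol: "F holomorphic_on ball 0 1" and F: "\<And>z. cmod z < 1 \<Longrightarrow> cmod (F z) < 1"
    and a: "cmod a < 1" and z: "cmod z < 1"
  shows "(1 - (cmod a)\<^sup>2) * (1 - (cmod z)\<^sup>2) * (cmod (1 - cnj (F a) * F z))\<^sup>2
       \<le> (1 - (cmod (F a))\<^sup>2) * (1 - (cmod (F z))\<^sup>2) * (cmod (1 - cnj a * z))\<^sup>2"
proof -
  have "(cmod (F z - F a))\<^sup>2 * (cmod (1 - cnj a * z))\<^sup>2 \<le> (cmod (z - a))\<^sup>2 * (cmod (1 - cnj (F a) * F z))\<^sup>2"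
    using power_mono[OF Schwarz_Pick_dist[OF assms], of 2] by (simp add: power_mult_distrib)
  then show ?thesis
    unfolding disc_identity[symmetric] by (simp add: algebra_simps)
qed

text \<open>The constant depends on \<open>a\<close> alone and not on \<open>F\<close>. Applied to
  all \<open>F t\<close> at once it controls a trajectory at any time by its behaviour near time
  0.\<close>

lemma Schwarz_Pick_norm:
  assumes hol: "F holomorphic_on ball 0 1" and F: "\<And>z. cmod z < 1 \<Longrightarrow> cmod (F z) < 1"
    and a: "cmod a < 1" and z: "cmod z < 1"
  shows "cmod (F z - F a) \<le> 2 / (1 - cmod a) * cmod (z - a)"
proof -
  have "1 - cmod a \<le> 1 - cmod (cnj a * z)"
    using a z by (simp add: norm_mult mult_left_le)
  also have "\<dots> \<le> cmod (1 - cnj a * z)"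
    using norm_triangle_ineq2[of 1 "cnj a * z"] by simp
  finally have 1: "1 - cmod a \<le> cmod (1 - cnj a * z)" .
  have "cmod (cnj (F a) * F z) \<le> 1"
    using F[OF a] F[OF z] by (simp add: norm_mult mult_le_one)
  then have 2: "cmod (1 - cnj (F a) * F z) \<le> 2"
    using norm_triangle_ineq4[of 1 "cnj (F a) * F z"] by simp
  have "cmod (F z - F a) * (1 - cmod a) \<le> cmod (F z - F a) * cmod (1 - cnj a * z)"
    by (intro mult_left_mono 1) auto
  also have "\<dots> \<le> cmod (z - a) * cmod (1 - cnj (F a) * F z)"
    by (rule Schwarz_Pick_dist[OF assms])
  also have "\<dots> \<le> cmod (z - a) * 2"
    by (intro mult_left_mono 2) auto
  finally show ?thesis
    using a by (simp add: field_simps)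
qed

subsection \<open>The Berkson--Porta representation\<close>

text \<open>The factor \<open>1 + e\<close> absorbs the ratio of consecutive values of \<open>1 - (cmod (F^n 0))\<^sup>2\<close>, which
  cannot grow geometrically since these values are bounded. This treats interior and boundary
  points \<open>\<tau>\<close> alike.\<close>

lemma Wolff_inequality:
  assumes hol: "F holomorphic_on ball 0 1" and F: "\<And>z. cmod z < 1 \<Longrightarrow> cmod (F z) < 1"
    and lim: "(\<lambda>n. (F ^^ n) 0) \<longlonglongrightarrow> \<tau>"
    and z: "cmod z < 1"
  shows "(1 - (cmod z)\<^sup>2) * (cmod (1 - cnj \<tau> * F z))\<^sup>2 \<le> (1 - (cmod (F z))\<^sup>2) * (cmod (1 - cnj \<tau> * z))\<^sup>2"
    (is "?L \<le> ?R")
proof -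
  define a where "a n = (F ^^ n) 0" for n
  have a_lt: "cmod (a n) < 1" for n
    by (induction n) (simp_all add: a_def F)
  define c where "c n = 1 - (cmod (a n))\<^sup>2" for n
  have c_pos: "0 < c n" and c_le: "c n \<le> 1" for n
    using a_lt[of n] by (simp_all add: c_def abs_square_less_1)
  have step: "c n * (1 - (cmod z)\<^sup>2) * (cmod (1 - cnj (a (Suc n)) * F z))\<^sup>2
      \<le> c (Suc n) * (1 - (cmod (F z))\<^sup>2) * (cmod (1 - cnj (a n) * z))\<^sup>2" for n
    using Schwarz_Pick_one_minus[OF hol F a_lt[of n] z] by (simp add: c_def a_def)
  have la: "a \<longlonglongrightarrow> \<tau>"
    using lim by (simp add: a_def [abs_def])
  have le: "?L \<le> (1 + e) * ?R" if e: "e > 0" for e :: real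
  proof -
    have "\<exists>\<^sub>F n in sequentially. c (Suc n) \<le> (1 + e) * c n"
    proof (rule ccontr)
      assume "\<not> ?thesis"
      then obtain N where N: "\<And>n. n \<ge> N \<Longrightarrow> (1 + e) * c n < c (Suc n)"
        unfolding not_frequently eventually_sequentially by (auto simp: not_le)
      have grow: "(1 + e) ^ k * c N \<le> c (N + k)" for k
      proof (induction k)
        case (Suc k)
        have "(1 + e) ^ Suc k * c N = (1 + e) * ((1 + e) ^ k * c N)"
          by simp
        also have "\<dots> \<le> (1 + e) * c (N + k)"
          using Suc e by (intro mult_left_mono) auto
        also have "\<dots> \<le> c (N + Suc k)"
          using N[of "N + k"] by simp
        finally show ?case .
      qed simp
      obtain k where "1 / c N < (1 + e) ^ k"
        using real_arch_pow[of "1 + e" "1 / c N"] e by auto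
      then show False
        using grow[of k] c_le[of "N + k"] c_pos[of N] by (simp add: field_simps)
    qed
    then have fr: "\<exists>\<^sub>F n in sequentially. (1 - (cmod z)\<^sup>2) * (cmod (1 - cnj (a (Suc n)) * F z))\<^sup>2
        \<le> (1 + e) * ((1 - (cmod (F z))\<^sup>2) * (cmod (1 - cnj (a n) * z))\<^sup>2)"
    proof (rule frequently_elim1)
      fix n assume n: "c (Suc n) \<le> (1 + e) * c n"
      have "0 \<le> 1 - (cmod (F z))\<^sup>2"
        using F[OF z] by (simp add: abs_square_le_1)
      then have "c (Suc n) * ((1 - (cmod (F z))\<^sup>2) * (cmod (1 - cnj (a n) * z))\<^sup>2)
          \<le> ((1 + e) * c n) * ((1 - (cmod (F z))\<^sup>2) * (cmod (1 - cnj (a n) * z))\<^sup>2)"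
        by (intro mult_right_mono[OF n]) auto
      with step[of n] have "c n * ((1 - (cmod z)\<^sup>2) * (cmod (1 - cnj (a (Suc n)) * F z))\<^sup>2)
          \<le> c n * ((1 + e) * ((1 - (cmod (F z))\<^sup>2) * (cmod (1 - cnj (a n) * z))\<^sup>2))"
        by (simp add: algebra_simps)
      then show "(1 - (cmod z)\<^sup>2) * (cmod (1 - cnj (a (Suc n)) * F z))\<^sup>2
          \<le> (1 + e) * ((1 - (cmod (F z))\<^sup>2) * (cmod (1 - cnj (a n) * z))\<^sup>2)"
        using c_pos[of n] by simp
    qed
    have l1: "(\<lambda>n. (1 - (cmod z)\<^sup>2) * (cmod (1 - cnj (a (Suc n)) * F z))\<^sup>2) \<longlonglongrightarrow> ?L"
      using LIMSEQ_Suc[OF la] by (intro tendsto_intros)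
    have l2: "(\<lambda>n. (1 + e) * ((1 - (cmod (F z))\<^sup>2) * (cmod (1 - cnj (a n) * z))\<^sup>2)) \<longlonglongrightarrow> (1 + e) * ?R"
      using la by (intro tendsto_intros)
    show ?thesis
    proof (rule ccontr)
      assume "\<not> ?thesis"
      then have "0 < ?L - (1 + e) * ?R" by simp
      from order_tendstoD(1)[OF tendsto_diff[OF l1 l2] this]
      have "\<forall>\<^sub>F n in sequentially. \<not> (1 - (cmod z)\<^sup>2) * (cmod (1 - cnj (a (Suc n)) * F z))\<^sup>2
          \<le> (1 + e) * ((1 - (cmod (F z))\<^sup>2) * (cmod (1 - cnj (a n) * z))\<^sup>2)"
        by (rule eventually_mono) linarith
      then show False
        using fr by (simp add: frequently_def)
    qed
  qed
  have "((\<lambda>e. (1 + e) * ?R) \<longlongrightarrow> (1 + 0) * ?R) (at_right 0)"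
    by (intro tendsto_intros)
  then have "?L \<le> (1 + 0) * ?R"
    by (rule tendsto_lowerbound) (use le in \<open>auto simp: eventually_at_right_field intro: exI[of _ 1]\<close>)
  then show ?thesis by simp
qed

text \<open>The sets \<open>{w. H z \<le> H w}\<close> with \<open>H z = (1 - (cmod z)\<^sup>2) / (cmod (1 - cnj \<tau> * z))\<^sup>2\<close> are discs; by
  convexity the chord from \<open>z\<close> to \<open>F z\<close> points to the inner side of the tangent at \<open>z\<close>.\<close>

lemma Wolff_chord:
  assumes "(1 - (cmod z)\<^sup>2) * (cmod (1 - cnj \<tau> * w))\<^sup>2 \<le> (1 - (cmod w)\<^sup>2) * (cmod (1 - cnj \<tau> * z))\<^sup>2"
    and "cmod z < 1"
  shows "0 \<le> Re ((z - w) * cnj ((z - \<tau>) * (1 - cnj \<tau> * z)))"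
proof -
  define g where "g = z - w"
  have w: "w = z - g" by (simp add: g_def)
  \<comment> \<open>An exact expansion around \<open>z\<close>: both terms quadratic in
    \<open>g\<close> enter with a minus sign, so a nonnegative left side forces a nonnegative linear
    term.\<close>
  have id: "(1 - (cmod w)\<^sup>2) * (cmod (1 - cnj \<tau> * z))\<^sup>2 - (1 - (cmod z)\<^sup>2) * (cmod (1 - cnj \<tau> * w))\<^sup>2
     = 2 * Re (g * cnj ((z - \<tau>) * (1 - cnj \<tau> * z)))
       - (cmod g)\<^sup>2 * (cmod (1 - cnj \<tau> * z))\<^sup>2 - (1 - (cmod z)\<^sup>2) * ((cmod \<tau>)\<^sup>2 * (cmod g)\<^sup>2)"
    unfolding w cmod_power2 by (simp add: power2_eq_square algebra_simps)
  have "0 \<le> (cmod g)\<^sup>2 * (cmod (1 - cnj \<tau> * z))\<^sup>2" "0 \<le> (1 - (cmod z)\<^sup>2) * ((cmod \<tau>)\<^sup>2 * (cmod g)\<^sup>2)"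
    using assms(2) by (auto simp: abs_square_le_1)
  with id assms(1) show ?thesis
    unfolding g_def[symmetric] by linarith
qed

lemma Re_Cayley_nonneg:
  assumes "cmod b \<le> 1"
  shows "0 \<le> Re ((1 - b) / (1 + b))"
proof -
  have "Re ((1 - b) * cnj (1 + b)) = 1 - (cmod b)\<^sup>2"
    unfolding cmod_power2 by (simp add: power2_eq_square algebra_simps)
  then show ?thesis
    using assms by (simp add: Re_complex_div_ge_0 abs_square_le_1)
qed

lemma norm_Cayley_le_1:
  assumes "0 \<le> Re p"
  shows "1 + p \<noteq> 0" "cmod ((1 - p) / (1 + p)) \<le> 1"
proof -
  show ne: "1 + p \<noteq> 0"
    using assms by (auto simp: complex_eq_iff)
  have "(cmod (1 - p))\<^sup>2 \<le> (cmod (1 + p))\<^sup>2"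
    unfolding cmod_power2 using assms by (simp add: power2_eq_square algebra_simps)
  then have "cmod (1 - p) \<le> cmod (1 + p)"
    by (rule power2_le_imp_le) simp
  then show "cmod ((1 - p) / (1 + p)) \<le> 1"
    using ne by (simp add: norm_divide divide_simps)
qed

text \<open>Generators are defined by one-sided difference quotients; in this form the chain and
  product rules for vector derivatives apply to them.\<close>

lemma has_vector_derivative_at_right_0_iff:
  "(\<phi> has_vector_derivative v) (at_right (0::real)) \<longleftrightarrow>
     ((\<lambda>t. (1 / t) *\<^sub>R (\<phi> t - \<phi> 0)) \<longlongrightarrow> v) (at_right 0)"
proof -
  have "(\<phi> has_vector_derivative v) (at_right 0) \<longleftrightarrow>
      ((\<lambda>y. (1 / norm (y - 0)) *\<^sub>R (\<phi> y - (\<phi> 0 + (y - 0) *\<^sub>R v))) \<longlongrightarrow> 0) (at_right 0)"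
    unfolding has_vector_derivative_def has_derivative_within by (simp add: bounded_linear_scaleR_left)
  also have "\<dots> \<longleftrightarrow> ((\<lambda>t. (1 / t) *\<^sub>R (\<phi> t - \<phi> 0) - v) \<longlongrightarrow> 0) (at_right 0)"
    by (intro filterlim_cong refl)
       (auto simp: eventually_at_right_field algebra_simps intro!: exI[of _ 1])
  also have "\<dots> \<longleftrightarrow> ((\<lambda>t. (1 / t) *\<^sub>R (\<phi> t - \<phi> 0)) \<longlongrightarrow> v) (at_right 0)"
    by (rule Lim_null[symmetric])
  finally show ?thesis .
qed

lemma filterlim_inverse_Suc_at_right_0: "filterlim (\<lambda>n. 1 / real (Suc n)) (at_right 0) sequentially"
  unfolding filterlim_at
  using LIMSEQ_inverse_real_of_nat by (simp add: inverse_eq_divide)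

section \<open>Semigroups on the disc and their trajectories\<close>

locale disc_semigroup =
  fixes F :: "real \<Rightarrow> complex \<Rightarrow> complex" and f :: "complex \<Rightarrow> complex"
  assumes generator: "generator_of_on f F (ball 0 1)"
begin

lemma holomorphic: "0 \<le> t \<Longrightarrow> F t holomorphic_on ball 0 1"
  using generator by (simp add: generator_of_on_def continuous_semigroup_on_def holomorphic_map_on_complex_iff)

lemma maps: "0 \<le> t \<Longrightarrow> cmod z < 1 \<Longrightarrow> cmod (F t z) < 1"
  using generator by (auto simp: generator_of_on_def continuous_semigroup_on_def image_subset_iff)

lemma add: "0 \<le> t \<Longrightarrow> 0 \<le> s \<Longrightarrow> cmod z < 1 \<Longrightarrow> F (t + s) z = F t (F s z)"
  using generator by (simp add: generator_of_on_def continuous_semigroup_on_def)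

lemma tendsto_id: "cmod z < 1 \<Longrightarrow> ((\<lambda>t. F t z) \<longlongrightarrow> z) (at_right 0)"
  using generator by (simp add: generator_of_on_def continuous_semigroup_on_def)

lemma tendsto_generator: "cmod z < 1 \<Longrightarrow> ((\<lambda>t. (1 / t) *\<^sub>R (z - F t z)) \<longlongrightarrow> f z) (at_right 0)"
  using generator by (simp add: generator_of_on_def)

lemma isCont: "0 \<le> t \<Longrightarrow> cmod z < 1 \<Longrightarrow> isCont (F t) z"
  using holomorphic[of t] holomorphic_on_imp_continuous_on[of "F t" "ball 0 1"]
  by (simp add: continuous_on_eq_continuous_at)

text \<open>\<open>F 0\<close> fixes every point \<open>F s z\<close> with \<open>s > 0\<close>, and
  these points tend to \<open>z\<close>.\<close>

lemma at_0:
  assumes "cmod z < 1"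
  shows "F 0 z = z"
proof -
  have "((\<lambda>s. F 0 (F s z)) \<longlongrightarrow> F 0 z) (at_right 0)"
    using assms by (intro isCont_tendsto_compose[OF isCont] tendsto_id) auto
  moreover have "\<forall>\<^sub>F s in at_right 0. F 0 (F s z) = F s z"
  proof (rule eventually_mono[OF eventually_at_right_less[of 0]])
    show "F 0 (F s z) = F s z" if "0 < s" for s
      using add[of 0 s z, symmetric] assms that by simp
  qed
  ultimately have "((\<lambda>s. F s z) \<longlongrightarrow> F 0 z) (at_right 0)"
    by (simp add: filterlim_cong)
  then show ?thesis
    using tendsto_id[OF assms] tendsto_unique trivial_limit_at_right_real by blast
qed

lemma has_vector_derivative_at_0:
  assumes "cmod z < 1"
  shows "((\<lambda>t. F t z) has_vector_derivative - f z) (at_right 0)"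
  unfolding has_vector_derivative_at_right_0_iff at_0[OF assms]
  using tendsto_minus[OF tendsto_generator[OF assms]] by (simp add: scaleR_diff_right)

lemma norm_diff_le:
  assumes "cmod z < 1" "0 \<le> t" "t \<le> u"
  shows "cmod (F u z - F t z) \<le> 2 / (1 - cmod z) * cmod (F (u - t) z - z)"
  using Schwarz_Pick_norm[of "F t" z "F (u - t) z", OF holomorphic maps] assms maps[of "u - t" z]
    add[of t "u - t" z] by simp

lemma continuous_on_time:
  assumes z: "cmod z < 1"
  shows "continuous_on {0..} (\<lambda>t. F t z)"
  unfolding continuous_on_iff
proof (intro ballI allI impI)
  fix t e :: real assume t: "t \<in> {0..}" and e: "0 < e"
  have "((\<lambda>d. 2 / (1 - cmod z) * cmod (F d z - z)) \<longlongrightarrow> 2 / (1 - cmod z) * cmod (z - z)) (at_right 0)"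
    by (intro tendsto_intros tendsto_id z)
  then have "\<forall>\<^sub>F d in at_right 0. 2 / (1 - cmod z) * cmod (F d z - z) < e"
    using e by (intro order_tendstoD(2)) auto
  then obtain b where b: "b > 0" "\<And>d. 0 < d \<Longrightarrow> d < b \<Longrightarrow> 2 / (1 - cmod z) * cmod (F d z - z) < e"
    by (auto simp: eventually_at_right_field)
  show "\<exists>d>0. \<forall>u\<in>{0..}. dist u t < d \<longrightarrow> dist (F u z) (F t z) < e"
  proof (intro exI[of _ b] conjI b(1) ballI impI)
    fix u :: real assume u: "u \<in> {0..}" "dist u t < b"
    consider "u = t" | "u < t" | "t < u" by linarith
    then show "dist (F u z) (F t z) < e"
    proof cases
      case 2
      then show ?thesis
        using norm_diff_le[OF z, of u t] b(2)[of "t - u"] u t by (simp add: dist_norm norm_minus_commute)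
    next
      case 3
      then show ?thesis
        using norm_diff_le[OF z, of t u] b(2)[of "u - t"] u t by (simp add: dist_norm)
    qed (use e in simp)
  qed
qed

text \<open>Time 1 is split into \<open>n\<close> steps of length \<open>1 / n\<close>. By
  \<open>norm_diff_le\<close> each step moves by at most a constant times
  \<open>cmod (F (1 / n) z - z)\<close>, which is \<open>o (1 / n)\<close> when the generator
  vanishes at \<open>z\<close>.\<close>

lemma generator_zero_fixes:
  assumes z: "cmod z < 1" and "f z = 0"
  shows "F 1 z = z"
proof -
  define C where "C = 2 / (1 - cmod z)"
  have C: "0 \<le> C"
    using z by (simp add: C_def)
  have step: "cmod (F (real k * d) z - z) \<le> real k * (C * cmod (F d z - z))" if d: "0 \<le> d" for k d
  proof (induction k)
    case 0
    then show ?case using at_0[OF z] by simp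
  next
    case (Suc k)
    have "cmod (F (real (Suc k) * d) z - F (real k * d) z) \<le> C * cmod (F d z - z)"
      using norm_diff_le[OF z, of "real k * d" "real (Suc k) * d"] d by (simp add: C_def algebra_simps)
    then have "cmod (F (real (Suc k) * d) z - z) \<le> C * cmod (F d z - z) + cmod (F (real k * d) z - z)"
      using norm_triangle_sub[of "F (real (Suc k) * d) z - z" "F (real k * d) z - z"] by simp
    with Suc show ?case
      by (simp add: algebra_simps)
  qed
  have "((\<lambda>n. (1 / (1 / real (Suc n))) *\<^sub>R (z - F (1 / real (Suc n)) z)) \<longlonglongrightarrow> f z)"
    using filterlim_compose[OF tendsto_generator[OF z] filterlim_inverse_Suc_at_right_0] .
  then have "(\<lambda>n. C * cmod (real (Suc n) *\<^sub>R (z - F (1 / real (Suc n)) z))) \<longlonglongrightarrow> C * cmod 0"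
    unfolding \<open>f z = 0\<close> by (intro tendsto_intros) simp
  moreover have "cmod (F 1 z - z) \<le> C * cmod (real (Suc n) *\<^sub>R (z - F (1 / real (Suc n)) z))" for n
    using step[of "1 / real (Suc n)" "Suc n"] by (simp add: norm_minus_commute mult_ac)
  ultimately have "cmod (F 1 z - z) \<le> 0"
    by (intro tendsto_lowerbound) auto
  then show ?thesis by simp
qed

text \<open>Only right derivatives of trajectories are available. The function
  \<open>exp (\<mu> * s) * h (F s z)\<close> is continuous and, by the semigroup law, has right
  derivative 0 at every \<open>s\<close>; it is therefore \<open>e\<close>-Lipschitz for each
  \<open>e > 0\<close>, hence constant.\<close>

lemma eigenfunction:
  assumes hol: "h holomorphic_on ball 0 1"
    and eq: "\<And>z. cmod z < 1 \<Longrightarrow> deriv h z * f z = \<mu> * h z"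
    and z: "cmod z < 1" and t: "0 \<le> t"
  shows "h (F t z) = exp (- \<mu> * of_real t) * h z"
proof -
  define \<phi> where "\<phi> s = exp (\<mu> * of_real s) * h (F s z)" for s
  have cont: "continuous_on {0..t} \<phi>"
    unfolding \<phi>_def
    using maps z by (intro continuous_intros continuous_on_compose2[OF holomorphic_on_imp_continuous_on[OF hol]]
        continuous_on_subset[OF continuous_on_time[OF z]]) auto
  have loc: "((\<lambda>d. (1 / d) *\<^sub>R (\<phi> (s + d) - \<phi> s)) \<longlongrightarrow> 0) (at_right 0)" if s: "0 \<le> s" for s
  proof -
    define w where "w = F s z"
    have w: "cmod w < 1"
      using maps s z by (simp add: w_def)
    have "(h has_field_derivative deriv h w) (at w)"
      using hol w by (intro holomorphic_derivI[of _ "ball 0 1"]) auto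
    then have "((\<lambda>d. h (F d w)) has_vector_derivative - f w * deriv h w) (at_right 0)"
      using field_vector_diff_chain_within[OF has_vector_derivative_at_0[OF w], of h "deriv h w"] at_0[OF w]
      by (simp add: o_def has_field_derivative_at_within)
    moreover have "((\<lambda>d. exp (\<mu> * of_real d)) has_vector_derivative \<mu>) (at_right 0)"
      by (rule has_vector_derivative_real_field) (auto intro!: derivative_eq_intros)
    ultimately have "((\<lambda>d. exp (\<mu> * of_real d) * h (F d w)) has_vector_derivative
        exp (\<mu> * of_real 0) * (- f w * deriv h w) + \<mu> * h (F 0 w)) (at_right 0)"
      by (intro has_vector_derivative_mult)
    then have "((\<lambda>d. exp (\<mu> * of_real d) * h (F d w)) has_vector_derivative 0) (at_right 0)"
      using eq[OF w] at_0[OF w] by (simp add: mult.commute)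
    then have "((\<lambda>d. exp (\<mu> * of_real s) * (exp (\<mu> * of_real d) * h (F d w))) has_vector_derivative
        exp (\<mu> * of_real s) * 0) (at_right 0)"
      by (rule has_vector_derivative_mult_right)
    then have "((\<lambda>d. (1 / d) *\<^sub>R (exp (\<mu> * of_real s) * (exp (\<mu> * of_real d) * h (F d w)) - \<phi> s)) \<longlongrightarrow> 0) (at_right 0)"
      unfolding has_vector_derivative_at_right_0_iff using at_0[OF w] by (simp add: \<phi>_def w_def)
    moreover have "\<forall>\<^sub>F d in at_right 0. (1 / d) *\<^sub>R (exp (\<mu> * of_real s) * (exp (\<mu> * of_real d) * h (F d w)) - \<phi> s)
        = (1 / d) *\<^sub>R (\<phi> (s + d) - \<phi> s)"
      using add[of _ s z] s z
      by (auto simp: eventually_at_right_field \<phi>_def w_def exp_add distrib_left add.commute intro!: exI[of _ 1])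
    ultimately show ?thesis
      by (simp add: filterlim_cong)
  qed
  have lip: "e-lipschitz_on {0..t} \<phi>" if e: "0 < e" for e
  proof (rule locally_lipschitz_imp_lipschitz[OF cont])
    fix x y assume x: "x \<in> {0..<t}" and "x < y"
    have "\<forall>\<^sub>F d in at_right 0. dist ((1 / d) *\<^sub>R (\<phi> (x + d) - \<phi> x)) 0 < e"
      using loc[of x] x e by (intro tendstoD) auto
    then obtain b where b: "b > 0" "\<And>d. 0 < d \<Longrightarrow> d < b \<Longrightarrow> cmod ((1 / d) *\<^sub>R (\<phi> (x + d) - \<phi> x)) < e"
      by (auto simp: eventually_at_right_field)
    define d where "d = min (b / 2) (y - x)"
    have d: "0 < d" "d < b" "d \<le> y - x"
      using b(1) \<open>x < y\<close> by (auto simp: d_def)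
    have "cmod (\<phi> (x + d) - \<phi> x) < e * d"
      using b(2)[OF d(1,2)] d(1) unfolding norm_scaleR by (simp add: divide_less_eq)
    then show "\<exists>w\<in>{x<..y}. dist (\<phi> w) (\<phi> x) \<le> e * (w - x)"
      using d by (intro bexI[of _ "x + d"]) (auto simp: dist_norm)
  qed (use e in simp)
  have bound: "cmod (\<phi> t - \<phi> 0) \<le> e * t" if "0 < e" for e
    using lipschitz_onD[OF lip[OF that], of t 0] t by (simp add: dist_norm)
  have "cmod (\<phi> t - \<phi> 0) \<le> 0 + e" if "0 < e" for e
  proof -
    have "e / (t + 1) * t \<le> e"
      using that t by (simp add: field_simps)
    then show ?thesis
      using bound[of "e / (t + 1)"] that t by simp
  qed
  then have "cmod (\<phi> t - \<phi> 0) \<le> 0"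
    by (rule field_le_epsilon)
  then show ?thesis
    using at_0[OF z] by (simp add: \<phi>_def exp_minus field_simps)
qed

end

section \<open>Semigroups with a Denjoy-Wolff point\<close>

locale dw_semigroup = disc_semigroup +
  fixes \<tau> :: complex
  assumes dw: "denjoy_wolff_point F \<tau>"
begin

lemma norm_dw_le: "cmod \<tau> \<le> 1"
  using dw by (simp add: denjoy_wolff_point_def)

lemma iterates_tendsto: "0 < t \<Longrightarrow> cmod z < 1 \<Longrightarrow> (\<lambda>n. (F t ^^ n) z) \<longlonglongrightarrow> \<tau>"
  using dw by (simp add: denjoy_wolff_point_def)

lemma fixes_dw:
  assumes "cmod \<tau> < 1" "0 < t"
  shows "F t \<tau> = \<tau>"
proof -
  have lim: "(\<lambda>n. (F t ^^ n) 0) \<longlonglongrightarrow> \<tau>"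
    using assms by (intro iterates_tendsto) auto
  have "(\<lambda>n. F t ((F t ^^ n) 0)) \<longlonglongrightarrow> F t \<tau>"
    by (rule isCont_tendsto_compose[OF isCont lim]) (use assms in auto)
  moreover have "(\<lambda>n. F t ((F t ^^ n) 0)) \<longlonglongrightarrow> \<tau>"
    using LIMSEQ_Suc[OF lim] unfolding funpow.simps o_def .
  ultimately show ?thesis
    using LIMSEQ_unique by blast
qed

lemma generator_zero_imp_dw:
  assumes "cmod z < 1" "f z = 0"
  shows "z = \<tau>"
proof -
  have fx: "(F 1 ^^ n) z = z" for n
    by (induction n) (simp_all add: generator_zero_fixes[OF assms])
  have "(\<lambda>n. (F 1 ^^ n) z) \<longlonglongrightarrow> \<tau>"
    by (rule iterates_tendsto) (use assms in auto)
  then show ?thesis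
    unfolding fx LIMSEQ_const_iff .
qed

text \<open>\<open>Wolff_chord\<close> gives the representation, with some \<open>p n\<close>, for
  each difference quotient of the semigroup. The \<open>p n\<close> have no evident local bound, so
  the limit is taken for their Cayley transforms, which are bounded by 1 and to which Montel's
  theorem applies. The Cayley transform is an involution, which recovers \<open>P\<close>.\<close>

lemma Berkson_Porta:
  obtains P where "P holomorphic_on ball 0 1" "\<And>z. cmod z < 1 \<Longrightarrow> 0 \<le> Re (P z)"
    "\<And>z. cmod z < 1 \<Longrightarrow> f z = (z - \<tau>) * (1 - cnj \<tau> * z) * P z"
proof -
  define T where "T n = 1 / real (Suc n)" for n
  have T: "0 < T n" for n
    by (simp add: T_def)
  have nz: "1 - cnj \<tau> * z \<noteq> 0" if "cmod z < 1" for z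
    using one_minus_cnj_mult_nonzero[OF norm_dw_le that] .
  \<comment> \<open>For \<open>\<tau>\<close> in the disc the value 0 at \<open>\<tau>\<close> is
    the true one. For \<open>\<tau>\<close> on the circle it is a convention that lets the same
    formula for \<open>p\<close> serve both cases.\<close>
  define g where "g n z = (if z = \<tau> then 0 else (1 / T n) *\<^sub>R (z - F (T n) z))" for n z
  have g_eq: "g n z = (1 / T n) *\<^sub>R (z - F (T n) z)" if "cmod z < 1" for n z
    using fixes_dw[OF _ T[of n]] that by (auto simp: g_def)
  have g_hol: "g n holomorphic_on ball 0 1" for n
  proof -
    have "(\<lambda>z. of_real (1 / T n) * (z - F (T n) z)) holomorphic_on ball 0 1"
      using T[of n] by (intro holomorphic_intros holomorphic) auto
    then show ?thesis
      by (rule holomorphic_transform) (simp add: g_eq scaleR_conv_of_real)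
  qed
  define p where "p n z = (if z = \<tau> then deriv (g n) \<tau> else (g n z - g n \<tau>) / (z - \<tau>)) / (1 - cnj \<tau> * z)" for n z
  have p_hol: "p n holomorphic_on ball 0 1" for n
    unfolding p_def using nz by (intro holomorphic_intros pole_lemma_open g_hol) auto
  have p_eq: "p n z = g n z / ((z - \<tau>) * (1 - cnj \<tau> * z))" if "z \<noteq> \<tau>" for n z
    using that by (simp add: p_def g_def)
  have p_Re': "0 \<le> Re (p n z)" if z: "cmod z < 1" "z \<noteq> \<tau>" for n z
  proof -
    have "0 \<le> Re ((z - F (T n) z) * cnj ((z - \<tau>) * (1 - cnj \<tau> * z)))"
      using holomorphic[of "T n"] maps[of "T n"] T[of n] z(1) iterates_tendsto[of "T n" 0]
      by (intro Wolff_chord Wolff_inequality) auto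
    then have "0 \<le> Re (g n z * cnj ((z - \<tau>) * (1 - cnj \<tau> * z)))"
      using T[of n] z(1) by (simp add: g_eq del: complex_cnj_mult complex_cnj_diff)
    then show ?thesis
      unfolding p_eq[OF z(2)] Re_complex_div_ge_0 .
  qed
  have p_Re: "0 \<le> Re (p n z)" if z: "cmod z < 1" for n z
  proof (cases "z = \<tau>")
    case True
    have "isCont (p n) z"
      using holomorphic_on_imp_continuous_on[OF p_hol] z by (simp add: continuous_on_eq_continuous_at)
    then have "((\<lambda>w. Re (p n w)) \<longlongrightarrow> Re (p n z)) (at z)"
      by (intro tendsto_Re) (simp add: isCont_def)
    moreover have "\<forall>\<^sub>F w in at z. 0 \<le> Re (p n w)"
      by (rule eventually_mono[OF eventually_at_in_open[of "ball 0 1" z]]) (use z in \<open>auto intro!: p_Re' simp: True\<close>)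
    ultimately show ?thesis
      by (rule tendsto_lowerbound) simp
  qed (use p_Re' z in auto)
  define b where "b n z = (1 - p n z) / (1 + p n z)" for n z
  define H where "H = {h. h holomorphic_on ball 0 1 \<and> (\<forall>z\<in>ball 0 1. cmod (h z) \<le> 1)}"
  have b_H: "b n \<in> H" for n
    unfolding H_def b_def using norm_Cayley_le_1[OF p_Re] by (auto intro!: holomorphic_intros p_hol)
  obtain c k where c_hol: "c holomorphic_on ball 0 1" and k: "strict_mono (k :: nat \<Rightarrow> nat)"
    and c_lim: "\<And>z. z \<in> ball 0 1 \<Longrightarrow> ((\<lambda>n. b (k n) z) \<longlongrightarrow> c z) sequentially"
  proof (rule Montel[of "ball 0 1" H b])
    show "\<exists>B. \<forall>h\<in>H. \<forall>z\<in>K. cmod (h z) \<le> B" if "compact K" "K \<subseteq> ball 0 1" for K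
      using that by (intro exI[of _ 1]) (auto simp: H_def)
  qed (use b_H in \<open>auto simp: H_def\<close>)
  have c_le: "cmod (c z) \<le> 1" if "cmod z < 1" for z
  proof (rule tendsto_upperbound[OF tendsto_norm[OF c_lim[of z]]])
    show "\<forall>\<^sub>F n in sequentially. cmod (b (k n) z) \<le> 1"
      using b_H that by (simp add: H_def)
  qed (use that in simp_all)
  define q where "q z = f z / ((z - \<tau>) * (1 - cnj \<tau> * z))" for z
  have c_eq: "0 \<le> Re (q z) \<and> c z = (1 - q z) / (1 + q z)" if z: "cmod z < 1" "z \<noteq> \<tau>" for z
  proof -
    have Tlim: "filterlim (\<lambda>n. T (k n)) (at_right 0) sequentially"
      using filterlim_compose[OF filterlim_inverse_Suc_at_right_0 filterlim_subseq[OF k]] by (simp add: T_def)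
    have "(\<lambda>n. g (k n) z) \<longlonglongrightarrow> f z"
      using filterlim_compose[OF tendsto_generator[OF z(1)] Tlim] z(1) by (simp add: g_eq)
    then have p_lim: "(\<lambda>n. p (k n) z) \<longlonglongrightarrow> q z"
      unfolding p_eq[OF z(2)] q_def using nz[OF z(1)] z(2) by (intro tendsto_intros) auto
    have q: "0 \<le> Re (q z)"
      using tendsto_Re[OF p_lim] p_Re[OF z(1)] by (intro tendsto_lowerbound[of "\<lambda>n. Re (p (k n) z)"]) auto
    have "(\<lambda>n. b (k n) z) \<longlonglongrightarrow> (1 - q z) / (1 + q z)"
      unfolding b_def using norm_Cayley_le_1(1)[OF q] by (intro tendsto_intros p_lim)
    then show ?thesis
      using LIMSEQ_unique[OF c_lim[of z]] z(1) q by simp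
  qed
  have c_ne': "1 + c z \<noteq> 0 \<and> q z = (1 - c z) / (1 + c z)" if z: "cmod z < 1" "z \<noteq> \<tau>" for z
  proof -
    have ne: "1 + q z \<noteq> 0"
      using norm_Cayley_le_1(1)[of "q z"] c_eq[OF z] by blast
    have c: "c z = (1 - q z) / (1 + q z)"
      using c_eq[OF z] by blast
    have "1 + c z = 2 / (1 + q z)" "1 - c z = 2 * q z / (1 + q z)"
      unfolding c using ne by (simp_all add: divide_simps)
    then show ?thesis
      using ne by simp
  qed
  \<comment> \<open>The value \<open>- 1\<close> of \<open>c\<close> would mean an infinite value of
    \<open>P\<close>. Away from \<open>\<tau>\<close> it is excluded because \<open>f\<close> is
    finite there; at \<open>\<tau>\<close> the maximum principle would spread it over the whole
    disc.\<close>
  have c_ne: "1 + c z \<noteq> 0" if z: "cmod z < 1" for z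
  proof (cases "z = \<tau>")
    case True
    show ?thesis
    proof
      assume "1 + c z = 0"
      then have cz: "c z = - 1"
        by (simp add: add_eq_0_iff)
      have "c constant_on ball 0 1"
        by (rule maximum_modulus_principle[OF c_hol, of "ball 0 1" z]) (use z cz c_le in auto)
      then have eq: "c w = - 1" if "cmod w < 1" for w
        using z cz that by (auto simp: constant_on_def)
      obtain w where "cmod w < 1" "w \<noteq> \<tau>"
        by (cases "\<tau> = 0") (auto intro: that[of 0] that[of "1/2"])
      then show False
        using c_ne'[of w] eq[of w] by simp
    qed
  qed (use c_ne'[OF z] in blast)
  show ?thesis
  proof (rule that[of "\<lambda>z. (1 - c z) / (1 + c z)"])
    show "(\<lambda>z. (1 - c z) / (1 + c z)) holomorphic_on ball 0 1"
      using c_ne by (intro holomorphic_intros c_hol) auto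
  next
    fix z :: complex assume z: "cmod z < 1"
    show "0 \<le> Re ((1 - c z) / (1 + c z))"
      by (rule Re_Cayley_nonneg[OF c_le[OF z]])
    show "f z = (z - \<tau>) * (1 - cnj \<tau> * z) * ((1 - c z) / (1 + c z))"
    proof (cases "z = \<tau>")
      case True
      have "\<forall>\<^sub>F t in at_right 0. (1 / t) *\<^sub>R (z - F t z) = 0"
        using fixes_dw z True by (auto simp: eventually_at_right_field intro!: exI[of _ 1])
      then have "((\<lambda>t. (1 / t) *\<^sub>R (z - F t z)) \<longlongrightarrow> 0) (at_right 0)"
        by (rule tendsto_eventually)
      then have "f z = 0"
        using tendsto_generator[OF z] tendsto_unique trivial_limit_at_right_real by blast
      then show ?thesis
        using True by simp
    next
      case False
      then have "f z = (z - \<tau>) * (1 - cnj \<tau> * z) * q z"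
        using nz[OF z] by (simp add: q_def)
      then show ?thesis
        using c_ne'[OF z False] by simp
    qed
  qed
qed

end

subsection \<open>Herglotz estimates for functions with positive real part\<close>

lemma circlepath_unit_cis:
  shows circlepath_eq_cis: "circlepath 0 1 s = cis (2 * pi * s)"
    and vector_derivative_circlepath_cis: "s \<in> {0..1} \<Longrightarrow>
      vector_derivative (circlepath 0 1) (at s within {0..1}) = 2 * pi * \<i> * cis (2 * pi * s)"
  using vector_derivative_circlepath01[of s 0 1]
  by (simp_all add: circlepath cis_conv_exp mult_ac)

text \<open>On the circle \<open>\<zeta> / (\<zeta> - w) = 1 / (1 - w * cnj \<zeta>)\<close>. This
  turns Cauchy's formula into an integral over a real parameter, which can be conjugated.\<close>

lemma Cauchy_integral_unit_circle:
  assumes "p holomorphic_on cball 0 1" "cmod w < 1"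
  shows "((\<lambda>s. p (cis (2 * pi * s)) / (1 - w * cnj (cis (2 * pi * s)))) has_integral p w) {0..1}"
proof -
  have "((\<lambda>u. p u / (u - w)) has_contour_integral (2 * of_real pi * \<i> * p w)) (circlepath 0 1)"
    using assms by (intro Cauchy_integral_circlepath_simple) auto
  then have "((\<lambda>s. p (cis (2 * pi * s)) / (cis (2 * pi * s) - w) * (2 * pi * \<i> * cis (2 * pi * s)))
      has_integral (2 * of_real pi * \<i> * p w)) {0..1}"
    unfolding has_contour_integral_def
    by (rule has_integral_eq[rotated]) (simp only: circlepath_unit_cis)
  from has_integral_mult_right[OF this, of "1 / (2 * of_real pi * \<i>)"]
  have "((\<lambda>s. 1 / (2 * of_real pi * \<i>) * (p (cis (2 * pi * s)) / (cis (2 * pi * s) - w) *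
      (2 * pi * \<i> * cis (2 * pi * s)))) has_integral p w) {0..1}"
    by simp
  then show ?thesis
  proof (rule has_integral_eq[rotated])
    fix s :: real
    define \<zeta> where "\<zeta> = cis (2 * pi * s)"
    have \<zeta>: "\<zeta> * cnj \<zeta> = 1" "cmod \<zeta> = 1"
      by (simp_all add: \<zeta>_def cis_cnj cis_mult)
    then have "\<zeta> \<noteq> 0" "\<zeta> - w \<noteq> 0"
      using assms(2) by auto
    moreover have "1 - w * cnj \<zeta> = (\<zeta> - w) * cnj \<zeta>"
      using \<zeta> by (simp add: algebra_simps)
    moreover have "cnj \<zeta> = 1 / \<zeta>"
      using \<zeta>(1) \<open>\<zeta> \<noteq> 0\<close> by (simp add: field_simps)
    ultimately have "p \<zeta> / (1 - w * cnj \<zeta>) = p \<zeta> / (\<zeta> - w) * \<zeta>"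
      by simp
    moreover have "1 / (2 * of_real pi * \<i>) * (c * (2 * pi * \<i> * \<zeta>)) = c * \<zeta>" for c
      by (simp add: algebra_simps)
    ultimately show "1 / (2 * of_real pi * \<i>) * (p \<zeta> / (\<zeta> - w) * (2 * pi * \<i> * \<zeta>)) = p \<zeta> / (1 - w * cnj \<zeta>)"
      by metis
  qed
qed

lemma Cauchy_deriv_unit_circle:
  assumes "p holomorphic_on cball 0 1"
  shows "((\<lambda>s. p (cis (2 * pi * s)) * cnj (cis (2 * pi * s))) has_integral deriv p 0) {0..1}"
proof -
  have "((\<lambda>u. p u / (u - 0) ^ (Suc 1)) has_contour_integral
      ((2 * pi * \<i>) / (fact 1) * (deriv ^^ 1) p 0)) (circlepath 0 1)"
    using assms by (intro Cauchy_has_contour_integral_higher_derivative_circlepath)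
      (auto intro: holomorphic_on_imp_continuous_on holomorphic_on_subset)
  then have "((\<lambda>s. p (cis (2 * pi * s)) / (cis (2 * pi * s))\<^sup>2 * (2 * pi * \<i> * cis (2 * pi * s)))
      has_integral (2 * of_real pi * \<i> * deriv p 0)) {0..1}"
    unfolding has_contour_integral_def
    by (simp del: power_Suc) (erule has_integral_eq[rotated], simp only: circlepath_unit_cis numeral_2_eq_2 of_real_mult of_real_numeral)
  from has_integral_mult_right[OF this, of "1 / (2 * of_real pi * \<i>)"]
  have "((\<lambda>s. 1 / (2 * of_real pi * \<i>) * (p (cis (2 * pi * s)) / (cis (2 * pi * s))\<^sup>2 *
      (2 * pi * \<i> * cis (2 * pi * s)))) has_integral deriv p 0) {0..1}"
    by simp
  then show ?thesis
  proof (rule has_integral_eq[rotated])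
    fix s :: real
    define \<zeta> where "\<zeta> = cis (2 * pi * s)"
    have "\<zeta> * cnj \<zeta> = 1" "\<zeta> \<noteq> 0"
      by (simp_all add: \<zeta>_def cis_cnj cis_mult)
    then have "cnj \<zeta> = 1 / \<zeta>"
      by (simp add: field_simps)
    then show "1 / (2 * of_real pi * \<i>) * (p \<zeta> / \<zeta>\<^sup>2 * (2 * pi * \<i> * \<zeta>)) = p \<zeta> * cnj \<zeta>"
      using \<open>\<zeta> \<noteq> 0\<close> by (simp add: power2_eq_square)
  qed
qed

lemma has_integral_cnj': "(g has_integral I) S \<Longrightarrow> ((\<lambda>s. cnj (g s)) has_integral cnj I) S"
  using has_integral_linear[OF _ bounded_linear_cnj] by (simp add: o_def)

text \<open>Cauchy's formula at 0 for \<open>p u / (1 - cnj w * u)\<close>, conjugated, integrates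
  \<open>cnj p\<close> against the Cauchy kernel at \<open>w\<close>. Added to Cauchy's formula for
  \<open>p\<close> at \<open>w\<close> it leaves only \<open>2 * Re p\<close> under the
  integral.\<close>

lemma Herglotz_value:
  assumes hol: "p holomorphic_on cball 0 1" and w: "cmod w < 1"
  shows "((\<lambda>s. of_real (2 * Re (p (cis (2 * pi * s)))) / (1 - w * cnj (cis (2 * pi * s))))
           has_integral (p w + cnj (p 0))) {0..1}"
proof -
  have "(\<lambda>u. p u / (1 - cnj w * u)) holomorphic_on cball 0 1"
  proof (intro holomorphic_intros hol)
    fix u :: complex assume "u \<in> cball 0 1"
    then show "1 - cnj w * u \<noteq> 0"
      using one_minus_cnj_mult_nonzero[of "cnj u" "cnj w"] w by (simp add: mult.commute)
  qed
  from has_integral_cnj'[OF Cauchy_integral_unit_circle[OF this, of 0]]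
  have "((\<lambda>s. cnj (p (cis (2 * pi * s))) / (1 - w * cnj (cis (2 * pi * s)))) has_integral cnj (p 0)) {0..1}"
    by simp
  from has_integral_add[OF Cauchy_integral_unit_circle[OF hol w] this]
  show ?thesis
    by (simp add: add_divide_distrib[symmetric] complex_add_cnj)
qed

lemma Herglotz_deriv:
  assumes hol: "p holomorphic_on cball 0 1"
  shows "((\<lambda>s. of_real (2 * Re (p (cis (2 * pi * s)))) * cnj (cis (2 * pi * s))) has_integral deriv p 0) {0..1}"
proof -
  have "(\<lambda>u. p u * u) holomorphic_on cball 0 1"
    by (intro holomorphic_intros hol)
  from has_integral_cnj'[OF Cauchy_integral_unit_circle[OF this, of 0]]
  have "((\<lambda>s. cnj (p (cis (2 * pi * s))) * cnj (cis (2 * pi * s))) has_integral 0) {0..1}"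
    by simp
  from has_integral_add[OF Cauchy_deriv_unit_circle[OF hol] this]
  show ?thesis
    by (simp add: distrib_right[symmetric] complex_add_cnj)
qed

text \<open>On the circle \<open>2 * Re p\<close> is a nonnegative density of total mass
  \<open>2 * Re (p 0)\<close>.\<close>

lemma Herglotz_bound:
  assumes hol: "p holomorphic_on cball 0 1" and pos: "\<And>z. cmod z \<le> 1 \<Longrightarrow> 0 \<le> Re (p z)"
    and int: "((\<lambda>s. of_real (2 * Re (p (cis (2 * pi * s)))) * K (cis (2 * pi * s))) has_integral I) {0..1}"
    and K: "\<And>\<zeta>. cmod \<zeta> = 1 \<Longrightarrow> cmod (K \<zeta>) \<le> B"
  shows "cmod I \<le> 2 * Re (p 0) * B"
proof -
  have "((\<lambda>s. of_real (2 * Re (p (cis (2 * pi * s))))) has_integral (p 0 + cnj (p 0))) {0..1}"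
    using Herglotz_value[OF hol, of 0] by simp
  from has_integral_linear[OF this bounded_linear_Re]
  have R: "((\<lambda>s. 2 * Re (p (cis (2 * pi * s))) * B) has_integral 2 * Re (p 0) * B) {0..1}"
    by (intro has_integral_mult_left) (simp add: o_def)
  have "cmod (integral {0..1} (\<lambda>s. of_real (2 * Re (p (cis (2 * pi * s)))) * K (cis (2 * pi * s))))
      \<le> integral {0..1} (\<lambda>s. 2 * Re (p (cis (2 * pi * s))) * B)"
  proof (rule integral_norm_bound_integral)
    fix s :: real
    have "0 \<le> 2 * Re (p (cis (2 * pi * s)))"
      using pos[of "cis (2 * pi * s)"] by simp
    then show "cmod (of_real (2 * Re (p (cis (2 * pi * s)))) * K (cis (2 * pi * s)))
        \<le> 2 * Re (p (cis (2 * pi * s))) * B"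
      using mult_left_mono[OF K[of "cis (2 * pi * s)"]] by (simp add: norm_mult)
  qed (use int R in \<open>auto simp: has_integral_integrable\<close>)
  then show ?thesis
    unfolding integral_unique[OF int] integral_unique[OF R] .
qed

text \<open>The extremal case \<open>p = (1 + c z) / (1 - c z) + \<i> b\<close>, \<open>cmod c = 1\<close>, of the three point
  estimate below.\<close>

lemma Herglotz_kernel_bound:
  fixes \<eta> :: complex and b :: real
  assumes "cmod \<eta> < 1"
  shows "cmod ((1 - (cmod \<eta>)\<^sup>2) / (1 - \<eta>) + \<eta> - 1 - \<i> * of_real b * (cmod \<eta>)\<^sup>2)
    \<le> 2 * cmod \<eta> * sqrt (1 + b\<^sup>2)"
proof -
  define u v where uv: "u = Re \<eta>" "v = Im \<eta>"
  define N where "N = (cmod \<eta>)\<^sup>2"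
  have N: "N = u\<^sup>2 + v\<^sup>2" "N \<le> 1"
  proof -
    show "N = u\<^sup>2 + v\<^sup>2"
      by (simp add: N_def uv cmod_power2)
    show "N \<le> 1"
      using assms by (simp add: N_def abs_square_le_1)
  qed
  have ne: "1 - \<eta> \<noteq> 0"
    using assms by auto
  define A where "A = 2 * of_real (1 - u) - \<i> * of_real b * cnj \<eta> * (1 - \<eta>)"
  have cN: "complex_of_real ((cmod \<eta>)\<^sup>2) = \<eta> * cnj \<eta>" "2 * complex_of_real u = \<eta> + cnj \<eta>"
    by (simp_all add: complex_norm_square uv complex_add_cnj del: of_real_power)
  have "(1 - complex_of_real ((cmod \<eta>)\<^sup>2)) / (1 - \<eta>) + \<eta> - 1 - \<i> * of_real b * complex_of_real ((cmod \<eta>)\<^sup>2)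
      = \<eta> * (A / (1 - \<eta>))"
    unfolding A_def right_diff_distrib of_real_diff cN using ne
    by (simp add: divide_simps cN del: of_real_power) (simp add: algebra_simps)
  moreover have "(cmod A)\<^sup>2 \<le> (2 * sqrt (1 + b\<^sup>2) * cmod (1 - \<eta>))\<^sup>2"
  proof -
    have "(1 - u)\<^sup>2 * 1 \<le> ((1 - u)\<^sup>2 + v\<^sup>2) * (4 - N)"
      using N(2) by (intro mult_mono) auto
    \<comment> \<open>The right side is a decomposition, into a square and a nonnegative multiple of
      \<open>b\<^sup>2\<close>, of the difference of the two sides to be compared.\<close>
    then have "0 \<le> (2 * v + b * (1 - u))\<^sup>2 + b\<^sup>2 * (((1 - u)\<^sup>2 + v\<^sup>2) * (4 - N) - (1 - u)\<^sup>2)"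
      by simp
    also have "\<dots> = 4 * (1 + b\<^sup>2) * ((1 - u)\<^sup>2 + v\<^sup>2) - (cmod A)\<^sup>2"
      unfolding cmod_power2 A_def N(1)
      by (simp add: uv[symmetric] power2_eq_square algebra_simps)
    also have "4 * (1 + b\<^sup>2) * ((1 - u)\<^sup>2 + v\<^sup>2) = (2 * sqrt (1 + b\<^sup>2) * cmod (1 - \<eta>))\<^sup>2"
      by (simp add: power_mult_distrib cmod_power2 uv)
    finally show ?thesis by simp
  qed
  then have "cmod A \<le> 2 * sqrt (1 + b\<^sup>2) * cmod (1 - \<eta>)"
    by (rule power2_le_imp_le) simp
  then have "cmod A / cmod (1 - \<eta>) \<le> 2 * sqrt (1 + b\<^sup>2)"
    using ne by (simp add: divide_simps)
  then have "cmod \<eta> * (cmod A / cmod (1 - \<eta>)) \<le> cmod \<eta> * (2 * sqrt (1 + b\<^sup>2))"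
    by (rule mult_left_mono) simp
  ultimately show ?thesis
    by (simp add: norm_mult norm_divide mult_ac)
qed

text \<open>The Herglotz formulas reach \<open>p \<sigma>\<close> only together with
  \<open>cnj (p 0)\<close>. Writing \<open>p 0\<close> as \<open>m * (1 + \<i> * b)\<close> allows
  both \<open>p 0\<close> and \<open>cnj (p 0)\<close> to be expressed by the real total mass
  \<open>2 * m\<close>, at the price of the term with \<open>b\<close> in the kernel
  \<open>K\<close>. The bound becomes
  \<open>2 * m * (2 * cmod \<sigma> * sqrt (1 + b\<^sup>2))\<close>, and
  \<open>m * sqrt (1 + b\<^sup>2) = cmod (p 0)\<close> produces the constant 4.\<close>

lemma three_point_bound_cball:
  fixes p :: "complex \<Rightarrow> complex" and \<sigma> :: complex
  assumes hol: "p holomorphic_on cball 0 1" and pos: "\<And>z. cmod z \<le> 1 \<Longrightarrow> 0 < Re (p z)"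
    and \<sigma>: "cmod \<sigma> < 1"
  shows "cmod ((1 - (cmod \<sigma>)\<^sup>2) * p \<sigma> - (1 + (cmod \<sigma>)\<^sup>2) * p 0 + \<sigma> * deriv p 0) \<le> 4 * cmod \<sigma> * cmod (p 0)"
proof -
  define m where "m = Re (p 0)"
  define b where "b = Im (p 0) / m"
  define T where "T = (cmod \<sigma>)\<^sup>2"
  have m: "0 < m"
    using pos[of 0] by (simp add: m_def)
  have p0: "p 0 = of_real m * (1 + \<i> * of_real b)"
    using m by (simp add: complex_eq_iff m_def b_def)
  define I where "I = (1 - of_real T) * (p \<sigma> + cnj (p 0)) + \<sigma> * deriv p 0 - (1 + \<i> * of_real b * of_real T) * (p 0 + cnj (p 0))"
  define K where "K \<zeta> = (1 - of_real T) / (1 - \<sigma> * cnj \<zeta>) + \<sigma> * cnj \<zeta> - 1 - \<i> * of_real b * of_real T" for \<zeta>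
  have "((\<lambda>s. (1 - of_real T) * (of_real (2 * Re (p (cis (2 * pi * s)))) / (1 - \<sigma> * cnj (cis (2 * pi * s))))
      + \<sigma> * (of_real (2 * Re (p (cis (2 * pi * s)))) * cnj (cis (2 * pi * s)))
      - (1 + \<i> * of_real b * of_real T) * (of_real (2 * Re (p (cis (2 * pi * s)))) / (1 - 0 * cnj (cis (2 * pi * s)))))
      has_integral I) {0..1}"
    unfolding I_def
    by (intro has_integral_add has_integral_diff has_integral_mult_right Herglotz_value Herglotz_deriv hol \<sigma>) simp
  then have int: "((\<lambda>s. of_real (2 * Re (p (cis (2 * pi * s)))) * K (cis (2 * pi * s))) has_integral I) {0..1}"
    by (rule has_integral_eq[rotated]) (simp add: K_def algebra_simps)
  have "cmod I \<le> 2 * Re (p 0) * (2 * cmod \<sigma> * sqrt (1 + b\<^sup>2))"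
  proof (rule Herglotz_bound[OF hol _ int])
    fix \<zeta> assume "cmod \<zeta> = 1"
    then show "cmod (K \<zeta>) \<le> 2 * cmod \<sigma> * sqrt (1 + b\<^sup>2)"
      using Herglotz_kernel_bound[of "\<sigma> * cnj \<zeta>" b] \<sigma> by (simp add: K_def T_def norm_mult)
  qed (use pos in \<open>auto intro: less_imp_le\<close>)
  also have "\<dots> = 4 * cmod \<sigma> * cmod (p 0)"
    using m unfolding p0 norm_mult by (simp add: cmod_def)
  also have "I = (1 - of_real T) * p \<sigma> - (1 + of_real T) * p 0 + \<sigma> * deriv p 0"
    unfolding I_def p0 by (simp add: algebra_simps)
  finally show ?thesis
    by (simp add: T_def)
qed

lemma deriv_bound_cball:
  assumes hol: "p holomorphic_on cball 0 1" and pos: "\<And>z. cmod z \<le> 1 \<Longrightarrow> 0 < Re (p z)"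
  shows "cmod (deriv p 0) \<le> 2 * Re (p 0)"
  using Herglotz_bound[OF hol _ Herglotz_deriv[OF hol], of 1] pos less_imp_le by force

lemma
  fixes p :: "complex \<Rightarrow> complex" and \<sigma> :: complex
  assumes hol: "p holomorphic_on ball 0 1" and pos: "\<And>z. cmod z < 1 \<Longrightarrow> 0 \<le> Re (p z)"
  shows three_point_bound: "cmod \<sigma> < 1 \<Longrightarrow>
      cmod ((1 - (cmod \<sigma>)\<^sup>2) * p \<sigma> - (1 + (cmod \<sigma>)\<^sup>2) * p 0 + \<sigma> * deriv p 0) \<le> 4 * cmod \<sigma> * cmod (p 0)"
    and deriv_bound: "cmod (deriv p 0) \<le> 2 * Re (p 0)"
proof -
  \<comment> \<open>The dilation makes the function holomorphic on the closed disc, and the summand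
    \<open>1 - t\<close> makes its real part strictly positive, as the closed disc estimates demand.
    Both changes disappear as \<open>t\<close> tends to 1.\<close>
  define q where "q t z = p (of_real t * z) + of_real (1 - t)" for t z
  have lt: "cmod (of_real t * z) < 1" if "cmod z \<le> 1" "0 < t" "t < 1" for t z
  proof -
    have "t * cmod z \<le> t"
      using that by (intro mult_left_le) auto
    moreover have "cmod (of_real t * z) = t * cmod z"
      using that by (simp add: norm_mult)
    ultimately show ?thesis
      using that by linarith
  qed
  have q_hol: "q t holomorphic_on cball 0 1" if "0 < t" "t < 1" for t
    unfolding q_def using lt that
    by (intro holomorphic_intros holomorphic_on_compose_gen[OF _ hol, unfolded o_def]) auto
  have q_pos: "0 < Re (q t z)" if "0 < t" "t < 1" "cmod z \<le> 1" for t z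
    using pos[OF lt[of z t]] that by (simp add: q_def)
  have q_deriv: "deriv (q t) 0 = of_real t * deriv p 0" for t
  proof -
    have "(p has_field_derivative deriv p 0) (at (of_real t * 0))"
      using holomorphic_derivI[OF hol, of 0] by simp
    then have "((\<lambda>z. p (of_real t * z)) has_field_derivative deriv p 0 * of_real t) (at 0)"
      by (rule DERIV_chain2) (auto intro!: derivative_eq_intros)
    then have "(q t has_field_derivative deriv p 0 * of_real t) (at 0)"
      unfolding q_def by (auto intro!: derivative_eq_intros)
    then show ?thesis
      by (simp add: DERIV_imp_deriv mult.commute)
  qed
  have ev: "\<forall>\<^sub>F t in at_left (1::real). 0 < t \<and> t < 1"
    by (auto simp: eventually_at_left_field intro!: exI[of _ 0])
  have t1: "((\<lambda>t. complex_of_real t) \<longlongrightarrow> of_real 1) (at_left 1)"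
    by (intro tendsto_intros)
  have q_lim: "((\<lambda>t. q t z) \<longlongrightarrow> p z) (at_left 1)" if "cmod z < 1" for z
  proof -
    have "isCont p z"
      using hol that holomorphic_on_imp_continuous_on[OF hol] by (simp add: continuous_on_eq_continuous_at)
    moreover have "((\<lambda>t. of_real t * z) \<longlongrightarrow> z) (at_left 1)"
      using tendsto_mult[OF t1 tendsto_const[of z]] by simp
    ultimately have "((\<lambda>t. p (of_real t * z)) \<longlongrightarrow> p z) (at_left 1)"
      by (rule isCont_tendsto_compose)
    from tendsto_add[OF this tendsto_diff[OF tendsto_const[of "1::complex"] t1]] show ?thesis
      by (simp add: q_def)
  qed
  have d_lim: "((\<lambda>t. deriv (q t) 0) \<longlongrightarrow> deriv p 0) (at_left 1)"
    unfolding q_deriv using tendsto_mult[OF t1 tendsto_const[of "deriv p 0"]] by simp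
  have q0_lim: "((\<lambda>t. q t 0) \<longlongrightarrow> p 0) (at_left 1)"
    by (rule q_lim) simp
  show "cmod ((1 - (cmod \<sigma>)\<^sup>2) * p \<sigma> - (1 + (cmod \<sigma>)\<^sup>2) * p 0 + \<sigma> * deriv p 0) \<le> 4 * cmod \<sigma> * cmod (p 0)"
    if \<sigma>: "cmod \<sigma> < 1"
  proof (rule tendsto_le)
    show "((\<lambda>t. cmod ((1 - (cmod \<sigma>)\<^sup>2) * q t \<sigma> - (1 + (cmod \<sigma>)\<^sup>2) * q t 0 + \<sigma> * deriv (q t) 0)) \<longlongrightarrow>
        cmod ((1 - (cmod \<sigma>)\<^sup>2) * p \<sigma> - (1 + (cmod \<sigma>)\<^sup>2) * p 0 + \<sigma> * deriv p 0)) (at_left 1)"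
      by (intro tendsto_intros q_lim d_lim q0_lim \<sigma>)
    show "((\<lambda>t. 4 * cmod \<sigma> * cmod (q t 0)) \<longlongrightarrow> 4 * cmod \<sigma> * cmod (p 0)) (at_left 1)"
      by (intro tendsto_intros q0_lim)
    show "\<forall>\<^sub>F t in at_left 1. cmod ((1 - (cmod \<sigma>)\<^sup>2) * q t \<sigma> - (1 + (cmod \<sigma>)\<^sup>2) * q t 0 + \<sigma> * deriv (q t) 0)
        \<le> 4 * cmod \<sigma> * cmod (q t 0)"
      by (rule eventually_mono[OF ev]) (intro three_point_bound_cball q_hol q_pos \<sigma>; simp)
  qed simp
  show "cmod (deriv p 0) \<le> 2 * Re (p 0)"
  proof (rule tendsto_le)
    show "((\<lambda>t. cmod (deriv (q t) 0)) \<longlongrightarrow> cmod (deriv p 0)) (at_left 1)"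
      by (intro tendsto_intros d_lim)
    show "((\<lambda>t. 2 * Re (q t 0)) \<longlongrightarrow> 2 * Re (p 0)) (at_left 1)"
      by (intro tendsto_intros q0_lim)
    show "\<forall>\<^sub>F t in at_left 1. cmod (deriv (q t) 0) \<le> 2 * Re (q t 0)"
      by (rule eventually_mono[OF ev]) (intro deriv_bound_cball q_hol q_pos; simp)
  qed simp
qed

text \<open>Transfers the three point estimate to \<open>x\<close> by the automorphism mapping \<open>0\<close> to \<open>x\<close>; the second
  factor in the difference is the derivative of \<open>(z - \<sigma>) * (1 - cnj \<sigma> * z) * P z\<close> at \<open>x\<close>.\<close>

lemma half_plane_Moebius:
  fixes P :: "complex \<Rightarrow> complex" and \<sigma> x :: complex
  assumes hol: "P holomorphic_on ball 0 1" and pos: "\<And>z. cmod z < 1 \<Longrightarrow> 0 \<le> Re (P z)"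
    and x: "cmod x < 1"
  shows interior_null_bound: "cmod \<sigma> < 1 \<Longrightarrow>
      cmod ((1 - (cmod x)\<^sup>2) * ((1 - (cmod \<sigma>)\<^sup>2) * P \<sigma>
          - ((1 - cnj \<sigma> * x) * P x - cnj \<sigma> * (x - \<sigma>) * P x + (x - \<sigma>) * (1 - cnj \<sigma> * x) * deriv P x))
        - 2 * cnj x * ((x - \<sigma>) * (1 - cnj \<sigma> * x) * P x))
      \<le> 4 * cmod ((x - \<sigma>) * (1 - cnj \<sigma> * x) * P x)"
    and deriv_bound_Moebius: "(1 - (cmod x)\<^sup>2) * cmod (deriv P x) \<le> 2 * Re (P x)"
proof -
  define p where "p = P \<circ> Moebius_function 0 (- x)"
  have M0: "Moebius_function 0 (- x) 0 = x"
    by (simp add: Moebius_function_of_zero)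
  have M: "cmod (Moebius_function 0 (- x) z) < 1" if "cmod z < 1" for z
    by (rule Moebius_function_norm_lt_1) (use x that in auto)
  have p_hol: "p holomorphic_on ball 0 1"
    unfolding p_def using x M
    by (intro holomorphic_on_compose_gen[OF Moebius_function_holomorphic hol]) auto
  have p_pos: "0 \<le> Re (p z)" if "cmod z < 1" for z
    using pos[OF M[OF that]] by (simp add: p_def)
  have p0: "p 0 = P x"
    by (simp add: p_def M0)
  have "(P has_field_derivative deriv P x) (at (Moebius_function 0 (- x) 0))"
    unfolding M0 using hol x by (intro holomorphic_derivI[of _ "ball 0 1"]) auto
  moreover have "(Moebius_function 0 (- x) has_field_derivative of_real (1 - (cmod x)\<^sup>2)) (at 0)"
    using has_field_derivative_Moebius_function[of "- x" 0] by simp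
  ultimately have "(p has_field_derivative deriv P x * of_real (1 - (cmod x)\<^sup>2)) (at 0)"
    unfolding p_def by (rule DERIV_chain)
  then have dp: "deriv p 0 = deriv P x * of_real (1 - (cmod x)\<^sup>2)"
    by (rule DERIV_imp_deriv)
  have x2: "0 < 1 - (cmod x)\<^sup>2"
    using x by (simp add: abs_square_less_1)
  then have "\<bar>1 - (cmod x)\<^sup>2\<bar> = 1 - (cmod x)\<^sup>2"
    by linarith
  then show "(1 - (cmod x)\<^sup>2) * cmod (deriv P x) \<le> 2 * Re (P x)"
    using deriv_bound[OF p_hol p_pos] unfolding dp p0 norm_mult norm_of_real by (simp add: mult.commute)
  show "cmod ((1 - (cmod x)\<^sup>2) * ((1 - (cmod \<sigma>)\<^sup>2) * P \<sigma>
          - ((1 - cnj \<sigma> * x) * P x - cnj \<sigma> * (x - \<sigma>) * P x + (x - \<sigma>) * (1 - cnj \<sigma> * x) * deriv P x))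
        - 2 * cnj x * ((x - \<sigma>) * (1 - cnj \<sigma> * x) * P x))
      \<le> 4 * cmod ((x - \<sigma>) * (1 - cnj \<sigma> * x) * P x)" (is "cmod ?E \<le> _")
    if \<sigma>: "cmod \<sigma> < 1"
  proof -
    define s where "s = Moebius_function 0 x \<sigma>"
    have s: "cmod s < 1"
      unfolding s_def by (rule Moebius_function_norm_lt_1[OF x \<sigma>])
    have ps: "p s = P \<sigma>"
      using Moebius_function_compose[of "- x" x \<sigma>] x \<sigma> by (simp add: p_def s_def)
    define a where "a = 1 - cnj x * \<sigma>"
    have a: "a \<noteq> 0"
      unfolding a_def using x \<sigma> by (intro one_minus_cnj_mult_nonzero) auto
    have ca: "cnj a = 1 - cnj \<sigma> * x"
      by (simp add: a_def mult.commute)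
    have sa: "s * a = \<sigma> - x"
      using a by (simp add: s_def Moebius_function_simple a_def)
    have s2: "of_real ((cmod s)\<^sup>2) * (a * cnj a) = (\<sigma> - x) * cnj (\<sigma> - x)"
      unfolding complex_norm_square sa[symmetric] by simp
    \<comment> \<open>Multiplying the three point expression of \<open>p\<close> at \<open>s\<close>
      by \<open>a * cnj a\<close> clears the denominators of \<open>s\<close> and of its
      conjugate.\<close>
    have E: "?E = a * cnj a * (of_real (1 - (cmod s)\<^sup>2) * P \<sigma> - of_real (1 + (cmod s)\<^sup>2) * P x
        + s * (deriv P x * of_real (1 - (cmod x)\<^sup>2)))"
    proof -
      have "a * cnj a * (of_real (1 - (cmod s)\<^sup>2) * P \<sigma> - of_real (1 + (cmod s)\<^sup>2) * P x
          + s * (deriv P x * of_real (1 - (cmod x)\<^sup>2)))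
        = (a * cnj a - of_real ((cmod s)\<^sup>2) * (a * cnj a)) * P \<sigma>
          - (a * cnj a + of_real ((cmod s)\<^sup>2) * (a * cnj a)) * P x
          + (s * a) * cnj a * (deriv P x * of_real (1 - (cmod x)\<^sup>2))"
        by (simp add: algebra_simps)
      also have "\<dots> = (a * cnj a - (\<sigma> - x) * cnj (\<sigma> - x)) * P \<sigma>
          - (a * cnj a + (\<sigma> - x) * cnj (\<sigma> - x)) * P x
          + (\<sigma> - x) * cnj a * (deriv P x * of_real (1 - (cmod x)\<^sup>2))"
        unfolding s2 sa ..
      also have "\<dots> = ?E"
        unfolding of_real_diff of_real_1 complex_norm_square
        by (simp add: a_def algebra_simps)
      finally show ?thesis ..
    qed
    have "cmod ?E = cmod a * cmod a * cmod (of_real (1 - (cmod s)\<^sup>2) * P \<sigma> - of_real (1 + (cmod s)\<^sup>2) * P x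
        + s * (deriv P x * of_real (1 - (cmod x)\<^sup>2)))"
      unfolding E norm_mult complex_mod_cnj ..
    also have "\<dots> \<le> cmod a * cmod a * (4 * cmod s * cmod (P x))"
      using three_point_bound[OF p_hol p_pos s] unfolding ps p0 dp
      by (intro mult_left_mono) auto
    also have "\<dots> = 4 * cmod ((s * a) * cnj a * P x)"
      by (simp add: norm_mult)
    also have "\<dots> = 4 * cmod ((x - \<sigma>) * (1 - cnj \<sigma> * x) * P x)"
      unfolding sa ca norm_mult by (simp add: norm_minus_commute)
    finally show ?thesis .
  qed
qed

text \<open>As \<open>t\<close> tends to \<open>1\<close>, the derivative of \<open>(z - t \<tau>) * (1 - t cnj \<tau> * z) * P z\<close> at \<open>t \<tau>\<close> tends to \<open>2 \<mu>\<close>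
  rather than \<open>\<mu>\<close>, so the claim is the mean of the limiting estimate and of the one for \<open>0\<close> in
  place of \<open>\<mu>\<close>.\<close>

lemma boundary_null_bound:
  fixes P :: "complex \<Rightarrow> complex" and \<tau> x \<mu> :: complex
  assumes hol: "P holomorphic_on ball 0 1" and pos: "\<And>z. cmod z < 1 \<Longrightarrow> 0 \<le> Re (P z)"
    and x: "cmod x < 1" and \<tau>: "cmod \<tau> = 1"
    and lim: "((\<lambda>t. (1 - of_real t) * P (of_real t * \<tau>)) \<longlongrightarrow> \<mu>) (at_left 1)"
  shows "cmod ((1 - (cmod x)\<^sup>2) * (\<mu>
          - ((1 - cnj \<tau> * x) * P x - cnj \<tau> * (x - \<tau>) * P x + (x - \<tau>) * (1 - cnj \<tau> * x) * deriv P x))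
        - 2 * cnj x * ((x - \<tau>) * (1 - cnj \<tau> * x) * P x))
      \<le> 4 * cmod ((x - \<tau>) * (1 - cnj \<tau> * x) * P x)" (is "cmod (?X * (\<mu> - ?d) - ?v) \<le> 4 * ?n")
proof -
  have ev: "\<forall>\<^sub>F t in at_left (1::real). 0 < t \<and> t < 1"
    by (auto simp: eventually_at_left_field intro!: exI[of _ 0])
  have t1: "((\<lambda>t. complex_of_real t) \<longlongrightarrow> of_real 1) (at_left 1)"
    by (intro tendsto_intros)
  have s1: "((\<lambda>t. of_real t * \<tau>) \<longlongrightarrow> \<tau>) (at_left 1)"
    using tendsto_mult[OF t1 tendsto_const[of \<tau>]] by simp
  have nrm: "cmod (of_real t * \<tau>) = t" if "0 < t" for t
    using that \<tau> by (simp add: norm_mult)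
  have "((\<lambda>t. (1 + of_real t) * ((1 - of_real t) * P (of_real t * \<tau>))) \<longlongrightarrow> (1 + of_real 1) * \<mu>) (at_left 1)"
    by (intro tendsto_intros lim)
  moreover have "\<forall>\<^sub>F t in at_left 1. (1 + of_real t) * ((1 - of_real t) * P (of_real t * \<tau>))
      = complex_of_real (1 - (cmod (of_real t * \<tau>))\<^sup>2) * P (of_real t * \<tau>)"
    by (rule eventually_mono[OF ev]) (simp only: nrm, simp add: power2_eq_square algebra_simps)
  ultimately have \<mu>2: "((\<lambda>t. complex_of_real (1 - (cmod (of_real t * \<tau>))\<^sup>2) * P (of_real t * \<tau>)) \<longlongrightarrow> 2 * \<mu>) (at_left 1)"
    by (simp add: filterlim_cong)
  define d where "d \<sigma> = (1 - cnj \<sigma> * x) * P x - cnj \<sigma> * (x - \<sigma>) * P x + (x - \<sigma>) * (1 - cnj \<sigma> * x) * deriv P x" for \<sigma>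
  define g where "g \<sigma> = (x - \<sigma>) * (1 - cnj \<sigma> * x) * P x" for \<sigma>
  have dl: "((\<lambda>t. d (of_real t * \<tau>)) \<longlongrightarrow> d \<tau>) (at_left 1)" and gl: "((\<lambda>t. g (of_real t * \<tau>)) \<longlongrightarrow> g \<tau>) (at_left 1)"
    unfolding d_def g_def by (intro tendsto_intros s1)+
  have two: "cmod (?X * (2 * \<mu> - d \<tau>) - 2 * cnj x * g \<tau>) \<le> 4 * cmod (g \<tau>)"
  proof (rule tendsto_le)
    show "((\<lambda>t. cmod (?X * (of_real (1 - (cmod (of_real t * \<tau>))\<^sup>2) * P (of_real t * \<tau>) - d (of_real t * \<tau>))
        - 2 * cnj x * g (of_real t * \<tau>))) \<longlongrightarrow> cmod (?X * (2 * \<mu> - d \<tau>) - 2 * cnj x * g \<tau>)) (at_left 1)"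
      by (intro tendsto_intros \<mu>2 dl gl)
    show "((\<lambda>t. 4 * cmod (g (of_real t * \<tau>))) \<longlongrightarrow> 4 * cmod (g \<tau>)) (at_left 1)"
      by (intro tendsto_intros gl)
    show "\<forall>\<^sub>F t in at_left 1. cmod (?X * (of_real (1 - (cmod (of_real t * \<tau>))\<^sup>2) * P (of_real t * \<tau>)
        - d (of_real t * \<tau>)) - 2 * cnj x * g (of_real t * \<tau>)) \<le> 4 * cmod (g (of_real t * \<tau>))"
    proof (rule eventually_mono[OF ev])
      fix t :: real assume "0 < t \<and> t < 1"
      then have "cmod (of_real t * \<tau>) < 1"
        using nrm by simp
      from interior_null_bound[OF hol pos x this]
      show "cmod (?X * (of_real (1 - (cmod (of_real t * \<tau>))\<^sup>2) * P (of_real t * \<tau>)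
        - d (of_real t * \<tau>)) - 2 * cnj x * g (of_real t * \<tau>)) \<le> 4 * cmod (g (of_real t * \<tau>))"
        unfolding d_def g_def .
    qed
  qed simp
  have zero: "cmod (?X * (- d \<tau>) - 2 * cnj x * g \<tau>) \<le> 4 * cmod (g \<tau>)"
  proof -
    define a where "a = 1 - cnj x * \<tau>"
    have \<tau>\<tau>: "\<tau> * cnj \<tau> = 1"
      using complex_norm_square[of \<tau>] \<tau> by simp
    have ca: "cnj a = 1 - cnj \<tau> * x"
      by (simp add: a_def mult.commute)
    have xa: "x - \<tau> = - \<tau> * cnj a"
      using \<tau>\<tau> by (simp add: ca algebra_simps)
    \<comment> \<open>For \<open>cmod \<tau> = 1\<close> the coefficient of \<open>P x\<close>
      collapses to \<open>2 * (cmod a)\<^sup>2\<close>. The first term then has modulus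
      \<open>2 * cmod (g \<tau>)\<close>, and \<open>deriv_bound_Moebius\<close> bounds the second
      by the same amount.\<close>
    have eq: "?X * (- d \<tau>) - 2 * cnj x * g \<tau> =
        - (2 * (cnj a * a) * P x) - (x - \<tau>) * cnj a * (of_real (1 - (cmod x)\<^sup>2) * deriv P x)"
    proof -
      have "?X * ((1 - cnj \<tau> * x) - cnj \<tau> * (x - \<tau>)) + 2 * cnj x * ((x - \<tau>) * (1 - cnj \<tau> * x)) = 2 * (cnj a * a)"
      proof -
        have c: "cnj \<tau> * (x - \<tau>) = - cnj a"
          using \<tau>\<tau> by (simp add: ca algebra_simps)
        have "?X * ((1 - cnj \<tau> * x) - cnj \<tau> * (x - \<tau>)) + 2 * cnj x * ((x - \<tau>) * (1 - cnj \<tau> * x))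
          = 2 * cnj a * (?X + cnj x * (x - \<tau>))"
          unfolding ca[symmetric] c by (simp add: algebra_simps)
        also have "?X + cnj x * (x - \<tau>) = a"
          unfolding of_real_diff of_real_1 complex_norm_square by (simp add: a_def algebra_simps)
        finally show ?thesis by simp
      qed
      then have "(?X * ((1 - cnj \<tau> * x) - cnj \<tau> * (x - \<tau>)) + 2 * cnj x * ((x - \<tau>) * (1 - cnj \<tau> * x))) * P x
          = 2 * (cnj a * a) * P x"
        by simp
      then show ?thesis
        unfolding d_def g_def ca by (simp add: algebra_simps)
    qed
    have x2: "0 \<le> 1 - (cmod x)\<^sup>2"
      using x by (simp add: abs_square_le_1)
    have n: "cmod (g \<tau>) = cmod a * cmod a * cmod (P x)"
      unfolding g_def ca[symmetric] xa norm_mult using \<tau> by simp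
    have "cmod (?X * (- d \<tau>) - 2 * cnj x * g \<tau>)
        \<le> cmod (2 * (cnj a * a) * P x) + cmod ((x - \<tau>) * cnj a * (of_real (1 - (cmod x)\<^sup>2) * deriv P x))"
      unfolding eq using norm_triangle_ineq4[of "- (2 * (cnj a * a) * P x)"] by (simp only: norm_minus_cancel)
    also have "\<dots> = 2 * cmod (g \<tau>) + cmod a * cmod a * ((1 - (cmod x)\<^sup>2) * cmod (deriv P x))"
      unfolding n xa norm_mult norm_of_real complex_mod_cnj using \<tau> x2 by simp
    also have "\<dots> \<le> 2 * cmod (g \<tau>) + cmod a * cmod a * (2 * cmod (P x))"
      using deriv_bound_Moebius[OF hol pos x] complex_Re_le_cmod[of "P x"]
      by (intro add_left_mono mult_left_mono) auto
    also have "\<dots> = 4 * cmod (g \<tau>)"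
      by (simp add: n)
    finally show ?thesis .
  qed
  have "2 * cmod (?X * (\<mu> - d \<tau>) - 2 * cnj x * g \<tau>)
      = cmod ((?X * (2 * \<mu> - d \<tau>) - 2 * cnj x * g \<tau>) + (?X * (- d \<tau>) - 2 * cnj x * g \<tau>))"
    unfolding norm_numeral[of "num.Bit0 num.One", where 'a = complex, symmetric] norm_mult[symmetric]
    by (rule arg_cong[of _ _ cmod]) (simp add: algebra_simps)
  also have "\<dots> \<le> 8 * cmod (g \<tau>)"
    using norm_triangle_mono[OF two zero] by simp
  finally have "cmod (?X * (\<mu> - d \<tau>) - 2 * cnj x * g \<tau>) \<le> 4 * cmod (g \<tau>)"
    by simp
  then show ?thesis
    unfolding d_def g_def .
qed

subsection \<open>Koenigs functions\<close>

text \<open>The mean value theorem for \<open>Re (e * g * cnj (w1 - w2))\<close> on the segment. The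
  conclusion is an inequality rather than mere injectivity because its nonstrict form passes to the
  limit in \<open>boundary_log_lift\<close>.\<close>

lemma Noshiro_Warschawski:
  assumes S: "convex S" and w: "w1 \<in> S" "w2 \<in> S" "w1 \<noteq> w2"
    and g: "\<And>z. z \<in> S \<Longrightarrow> (g has_field_derivative g' z) (at z)"
    and pos: "\<And>z. z \<in> S \<Longrightarrow> 0 < Re (e * g' z)"
  shows "0 < Re (e * (g w1 - g w2) * cnj (w1 - w2))"
proof -
  define p where "p t = w2 + of_real t * (w1 - w2)" for t :: real
  have pS: "p t \<in> S" if "0 \<le> t" "t \<le> 1" for t
  proof -
    have "p t = (1 - t) *\<^sub>R w2 + t *\<^sub>R w1"
      by (simp add: p_def scaleR_conv_of_real algebra_simps)
    then show ?thesis
      using convexD_alt[OF S w(2,1) that] by simp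
  qed
  have D: "((\<lambda>t. Re (e * g (p t) * cnj (w1 - w2))) has_real_derivative
      Re (e * g' (p t)) * (cmod (w1 - w2))\<^sup>2) (at t)" if t: "0 \<le> t" "t \<le> 1" for t
  proof -
    have "(p has_vector_derivative (w1 - w2)) (at t)"
      unfolding p_def by (auto intro!: derivative_eq_intros)
    from field_vector_diff_chain_at[OF this g[OF pS[OF t]]]
    have "((\<lambda>t. e * g (p t) * cnj (w1 - w2)) has_vector_derivative
        e * ((w1 - w2) * g' (p t)) * cnj (w1 - w2)) (at t)"
      by (intro has_vector_derivative_mult_left has_vector_derivative_mult_right) (simp add: o_def)
    then have "((\<lambda>t. Re (e * g (p t) * cnj (w1 - w2))) has_vector_derivative
        Re (e * ((w1 - w2) * g' (p t)) * cnj (w1 - w2))) (at t)"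
      by (rule bounded_linear.has_vector_derivative[OF bounded_linear_Re])
    moreover have "e * ((w1 - w2) * g' (p t)) * cnj (w1 - w2) = of_real ((cmod (w1 - w2))\<^sup>2) * (e * g' (p t))"
      unfolding complex_norm_square by (simp only: mult_ac)
    then have "Re (e * ((w1 - w2) * g' (p t)) * cnj (w1 - w2)) = Re (e * g' (p t)) * (cmod (w1 - w2))\<^sup>2"
      by (simp only: Re_complex_of_real Im_complex_of_real times_complex.sel) simp
    ultimately show ?thesis
      unfolding has_real_derivative_iff_has_vector_derivative by metis
  qed
  obtain t where t: "0 < t" "t < 1" and eq: "Re (e * g (p 1) * cnj (w1 - w2)) - Re (e * g (p 0) * cnj (w1 - w2))
      = (1 - 0) * (Re (e * g' (p t)) * (cmod (w1 - w2))\<^sup>2)"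
    using MVT2[of 0 1 "\<lambda>t. Re (e * g (p t) * cnj (w1 - w2))" "\<lambda>t. Re (e * g' (p t)) * (cmod (w1 - w2))\<^sup>2"] D
    by auto
  have "p 1 = w1" "p 0 = w2"
    by (simp_all add: p_def)
  then have "Re (e * (g w1 - g w2) * cnj (w1 - w2)) = Re (e * g' (p t)) * (cmod (w1 - w2))\<^sup>2"
    using eq by (simp add: algebra_simps)
  also have "\<dots> > 0"
    using pos[OF pS[of t]] t w(3) by (intro mult_pos_pos) auto
  finally show ?thesis .
qed

lemma Moebius_function_inverse:
  assumes "cmod \<sigma> < 1" "cmod z < 1"
  shows "Moebius_function 0 (- \<sigma>) (Moebius_function 0 \<sigma> z) = z"
  using Moebius_function_compose[of "- \<sigma>" \<sigma> z] assms by simp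

text \<open>In the coordinate \<open>W\<close> with \<open>exp W = Moebius_function 0 \<sigma> z\<close> the logarithm of the Koenigs function is
  \<open>W + G (exp W)\<close>, which has derivative \<open>P \<sigma> / P z\<close>. So the criterion of Noshiro and Warschawski
  applies on the left half plane.\<close>

lemma Koenigs_log_lift:
  fixes P :: "complex \<Rightarrow> complex" and e \<sigma> :: complex
  assumes hol: "P holomorphic_on ball 0 1" and pos: "\<And>z. cmod z < 1 \<Longrightarrow> 0 < Re (e / P z)"
    and \<sigma>: "cmod \<sigma> < 1"
  obtains G where "G holomorphic_on ball 0 1"
    "\<And>v. cmod v < 1 \<Longrightarrow> v * deriv G v = P \<sigma> / P (Moebius_function 0 (- \<sigma>) v) - 1"
    "\<And>W1 W2. Re W1 < 0 \<Longrightarrow> Re W2 < 0 \<Longrightarrow> W1 \<noteq> W2 \<Longrightarrow>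
       0 < Re (e / P \<sigma> * ((W1 + G (exp W1)) - (W2 + G (exp W2))) * cnj (W1 - W2))"
proof -
  have nz: "P z \<noteq> 0" if "cmod z < 1" for z
    using pos[OF that] by auto
  have M: "cmod (Moebius_function 0 (- \<sigma>) z) < 1" if "cmod z < 1" for z
    by (rule Moebius_function_norm_lt_1) (use \<sigma> that in auto)
  define g where "g v = P \<sigma> / P (Moebius_function 0 (- \<sigma>) v) - 1" for v
  have g_hol: "g holomorphic_on ball 0 1"
    unfolding g_def using \<sigma> M nz
    by (intro holomorphic_intros holomorphic_on_compose_gen[OF Moebius_function_holomorphic hol, unfolded o_def]) auto
  have g0: "g 0 = 0"
    using nz[OF \<sigma>] by (simp add: g_def Moebius_function_of_zero)
  define q where "q v = (if v = 0 then deriv g 0 else (g v - g 0) / (v - 0))" for v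
  have "q holomorphic_on ball 0 1"
    unfolding q_def by (intro pole_lemma_open g_hol) auto
  then obtain G where G: "\<And>v. v \<in> ball 0 1 \<Longrightarrow> (G has_field_derivative q v) (at v within ball 0 1)"
    using holomorphic_convex_primitive'[of "ball 0 1" q] by auto
  have G': "(G has_field_derivative q v) (at v)" if "cmod v < 1" for v
    using G[of v] that by (simp add: at_within_open[of _ "ball 0 1"])
  have vq: "v * q v = g v" for v
    by (simp add: q_def g0)
  show ?thesis
  proof (rule that[of G])
    show "G holomorphic_on ball 0 1"
      unfolding holomorphic_on_def field_differentiable_def using G by blast
    show "v * deriv G v = P \<sigma> / P (Moebius_function 0 (- \<sigma>) v) - 1" if "cmod v < 1" for v
      using DERIV_imp_deriv[OF G'[OF that]] vq[of v] by (simp add: g_def)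
    show "0 < Re (e / P \<sigma> * ((W1 + G (exp W1)) - (W2 + G (exp W2))) * cnj (W1 - W2))"
      if W: "Re W1 < 0" "Re W2 < 0" "W1 \<noteq> W2" for W1 W2
    proof (rule Noshiro_Warschawski[of "{W. Re W < 0}"])
      fix W :: complex assume "W \<in> {W. Re W < 0}"
      then have W: "cmod (exp W) < 1"
        by simp
      have "((\<lambda>W. W + G (exp W)) has_field_derivative 1 + q (exp W) * exp W) (at W)"
        by (intro derivative_intros DERIV_chain2[where f = G and g = exp and x = W, OF G'[OF W] DERIV_exp])
      then show "((\<lambda>W. W + G (exp W)) has_field_derivative 1 + g (exp W)) (at W)"
        using vq[of "exp W"] by (simp add: mult.commute)
      have "e / P \<sigma> * (1 + g (exp W)) = e / P (Moebius_function 0 (- \<sigma>) (exp W))"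
        using nz[OF \<sigma>] by (simp add: g_def)
      then show "0 < Re (e / P \<sigma> * (1 + g (exp W)))"
        using pos[OF M[OF W]] by simp
    qed (use W in \<open>auto intro: convex_halfspace_Re_lt\<close>)
  qed
qed

text \<open>\<open>h\<close> is the exponential of the lift \<open>W + G (exp W)\<close>, read back
  in \<open>v = exp W\<close>; this is \<open>v * exp (G v)\<close>, which is also holomorphic at
  the zero of \<open>v\<close>. The differential equation is the formula for
  \<open>v * deriv G v\<close>.\<close>

lemma Koenigs_interior:
  fixes P :: "complex \<Rightarrow> complex" and e \<sigma> :: complex
  assumes hol: "P holomorphic_on ball 0 1" and pos: "\<And>z. cmod z < 1 \<Longrightarrow> 0 < Re (e / P z)"
    and \<sigma>: "cmod \<sigma> < 1"
  obtains h where "h holomorphic_on ball 0 1" "inj_on h (ball 0 1)"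
    "\<And>z. cmod z < 1 \<Longrightarrow> deriv h z * ((z - \<sigma>) * (1 - cnj \<sigma> * z) * P z) = (1 - (cmod \<sigma>)\<^sup>2) * P \<sigma> * h z"
proof -
  obtain G where G: "G holomorphic_on ball 0 1"
    and G': "\<And>v. cmod v < 1 \<Longrightarrow> v * deriv G v = P \<sigma> / P (Moebius_function 0 (- \<sigma>) v) - 1"
    and lift: "\<And>W1 W2. Re W1 < 0 \<Longrightarrow> Re W2 < 0 \<Longrightarrow> W1 \<noteq> W2 \<Longrightarrow>
       0 < Re (e / P \<sigma> * ((W1 + G (exp W1)) - (W2 + G (exp W2))) * cnj (W1 - W2))"
    using Koenigs_log_lift[OF assms] by metis
  define v where "v = Moebius_function 0 \<sigma>"
  have v_lt: "cmod (v z) < 1" if "cmod z < 1" for z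
    unfolding v_def by (rule Moebius_function_norm_lt_1[OF \<sigma> that])
  have v_inj: "z1 = z2" if "cmod z1 < 1" "cmod z2 < 1" "v z1 = v z2" for z1 z2
    using Moebius_function_inverse[OF \<sigma>] that unfolding v_def by metis
  have nz: "P z \<noteq> 0" if "cmod z < 1" for z
    using pos[OF that] by auto
  define h where "h z = v z * exp (G (v z))" for z
  have v_hol: "v holomorphic_on ball 0 1"
    unfolding v_def by (rule Moebius_function_holomorphic[OF \<sigma>])
  have h_hol: "h holomorphic_on ball 0 1"
    unfolding h_def using v_lt
    by (intro holomorphic_intros v_hol holomorphic_on_compose_gen[OF v_hol G, unfolded o_def]) auto
  have h_inj: "inj_on h (ball 0 1)"
  proof (rule inj_onI)
    fix z1 z2 assume "z1 \<in> ball 0 1" "z2 \<in> ball 0 1" and eq: "h z1 = h z2"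
    then have z: "cmod z1 < 1" "cmod z2 < 1" by auto
    have "v z1 = v z2"
    proof (cases "v z1 = 0 \<or> v z2 = 0")
      case True
      then show ?thesis
        using eq by (auto simp: h_def)
    next
      case False
      define W1 W2 where "W1 = Ln (v z1)" and "W2 = Ln (v z2)"
      have W: "exp W1 = v z1" "exp W2 = v z2"
        using False by (simp_all add: W1_def W2_def)
      have Re: "Re W1 < 0" "Re W2 < 0"
        using v_lt[OF z(1)] v_lt[OF z(2)] unfolding W[symmetric] by simp_all
      have "exp (W1 + G (exp W1)) = exp (W2 + G (exp W2))"
        using eq unfolding exp_add W h_def .
      then obtain n :: int where n: "W1 + G (exp W1) = W2 + G (exp W2) + (of_int (2 * n) * pi) * \<i>"
        unfolding exp_eq by blast
      \<comment> \<open>Replacing \<open>W2\<close> by another logarithm of the same point absorbs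
        the period, so the lifted values at \<open>W1\<close> and \<open>W3\<close> agree and the
        strict inequality forces \<open>W1 = W3\<close>.\<close>
      define W3 where "W3 = W2 + (of_int (2 * n) * pi) * \<i>"
      have W3: "exp W3 = exp W2"
        unfolding exp_eq W3_def by blast
      have "W1 = W3"
        using lift[of W1 W3] Re n unfolding W3 by (auto simp: W3_def)
      then show ?thesis
        using W W3 by simp
    qed
    then show "z1 = z2"
      by (rule v_inj[OF z])
  qed
  have "deriv h z * ((z - \<sigma>) * (1 - cnj \<sigma> * z) * P z) = (1 - (cmod \<sigma>)\<^sup>2) * P \<sigma> * h z" if z: "cmod z < 1" for z
  proof -
    define a where "a = 1 - cnj \<sigma> * z"
    have a: "a \<noteq> 0"
      unfolding a_def using \<sigma> z by (intro one_minus_cnj_mult_nonzero) auto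
    have dv: "(v has_field_derivative of_real (1 - (cmod \<sigma>)\<^sup>2) / a\<^sup>2) (at z)"
      unfolding v_def a_def by (rule has_field_derivative_Moebius_function) (use a a_def in simp)
    have "(G has_field_derivative deriv G (v z)) (at (v z))"
      using G v_lt[OF z] by (intro holomorphic_derivI[of _ "ball 0 1"]) auto
    note dG = DERIV_chain2[OF this dv]
    have "(h has_field_derivative (of_real (1 - (cmod \<sigma>)\<^sup>2) / a\<^sup>2) * exp (G (v z))
        + (exp (G (v z)) * (deriv G (v z) * (of_real (1 - (cmod \<sigma>)\<^sup>2) / a\<^sup>2))) * v z) (at z)"
      unfolding h_def by (intro DERIV_mult dv DERIV_chain2[OF DERIV_exp dG])
    from DERIV_imp_deriv[OF this]
    have "deriv h z = (of_real (1 - (cmod \<sigma>)\<^sup>2) / a\<^sup>2) * exp (G (v z)) * (1 + v z * deriv G (v z))"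
      by (simp only: distrib_left mult_1_right) (simp only: mult_ac)
    also have "1 + v z * deriv G (v z) = P \<sigma> / P z"
      using G'[OF v_lt[OF z]] Moebius_function_inverse[OF \<sigma> z] by (simp add: v_def)
    finally have "deriv h z = of_real (1 - (cmod \<sigma>)\<^sup>2) / a\<^sup>2 * exp (G (v z)) * (P \<sigma> / P z)" .
    moreover have "v z = (z - \<sigma>) / a"
      by (simp add: v_def Moebius_function_simple a_def)
    ultimately show ?thesis
      unfolding h_def a_def[symmetric] using a nz[OF z]
      by (simp add: power2_eq_square del: of_real_diff of_real_power)
  qed
  with h_hol h_inj show ?thesis
    by (rule that)
qed

text \<open>The coordinate \<open>1 / (1 - cnj \<tau> * z)\<close> maps the disc onto the half plane
  of real parts above \<open>1 / 2\<close>, and there the derivative of \<open>\<psi>\<close> is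
  \<open>- 1 / P\<close>. The univalence criterion applies with rotation factor
  \<open>- 1\<close>.\<close>

lemma primitive_of_inverse_boundary_inj:
  fixes P :: "complex \<Rightarrow> complex" and \<tau> :: complex
  assumes pos: "\<And>z. cmod z < 1 \<Longrightarrow> 0 < Re (P z)"
    and \<tau>: "cmod \<tau> = 1"
    and \<psi>: "\<And>z. cmod z < 1 \<Longrightarrow> (\<psi> has_field_derivative 1 / ((z - \<tau>) * (1 - cnj \<tau> * z) * P z)) (at z)"
  shows "inj_on \<psi> (ball 0 1)"
proof (rule inj_onI, rule ccontr)
  fix z1 z2 assume z: "z1 \<in> ball 0 1" "z2 \<in> ball 0 1" and eq: "\<psi> z1 = \<psi> z2" and ne: "z1 \<noteq> z2"
  have \<tau>\<tau>: "\<tau> * cnj \<tau> = 1"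
    using complex_norm_square[of \<tau>] \<tau> by simp
  then have \<tau>0: "\<tau> \<noteq> 0" "cnj \<tau> \<noteq> 0"
    by auto
  define w where "w z = 1 / (1 - cnj \<tau> * z)" for z
  define Z where "Z u = \<tau> * (1 - 1 / u)" for u
  have w: "1 / 2 < Re (w z)" "Z (w z) = z" if "cmod z < 1" for z
  proof -
    define a where "a = 1 - cnj \<tau> * z"
    have a: "a \<noteq> 0"
      unfolding a_def using \<tau> that by (intro one_minus_cnj_mult_nonzero) auto
    have "(cmod (1 - a))\<^sup>2 < 1"
      using that \<tau> by (simp add: a_def norm_mult abs_square_less_1)
    then have "(cmod a)\<^sup>2 < 2 * Re a"
      unfolding cmod_power2 by (simp add: power2_eq_square algebra_simps)
    moreover have "Re (1 / a) = Re a / (cmod a)\<^sup>2"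
      by (simp add: Re_divide cmod_power2)
    moreover have "1 / 2 < Re a / (cmod a)\<^sup>2" if "(cmod a)\<^sup>2 < 2 * Re a"
      using that a by (simp add: field_simps)
    ultimately show "1 / 2 < Re (w z)"
      unfolding w_def a_def[symmetric] by simp
    show "Z (w z) = z"
      using \<tau>\<tau> by (simp add: Z_def w_def mult.assoc[symmetric])
  qed
  have Z_lt: "cmod (Z u) < 1" if u: "1 / 2 < Re u" for u
  proof -
    have u0: "u \<noteq> 0"
      using u by auto
    have "(cmod (u - 1))\<^sup>2 < (cmod u)\<^sup>2"
      unfolding cmod_power2 using u by (simp add: power2_eq_square algebra_simps)
    then have "cmod (u - 1) < cmod u"
      by (rule power2_less_imp_less) simp
    moreover have "1 - 1 / u = (u - 1) / u"
      using u0 by (simp add: diff_divide_distrib)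
    ultimately show ?thesis
      using u0 \<tau> by (simp add: Z_def norm_mult norm_divide)
  qed
  have "0 < Re (- 1 * (\<psi> (Z (w z1)) - \<psi> (Z (w z2))) * cnj (w z1 - w z2))"
  proof (rule Noshiro_Warschawski[of "{u. 1 / 2 < Re u}"])
    fix u :: complex assume "u \<in> {u. 1 / 2 < Re u}"
    then have u: "1 / 2 < Re u" by simp
    then have u0: "u \<noteq> 0" by auto
    have Pz: "P (Z u) \<noteq> 0" "0 < Re (P (Z u))"
      using pos[OF Z_lt[OF u]] by auto
    have "(Z has_field_derivative \<tau> / u\<^sup>2) (at u)"
      unfolding Z_def using u0 by (auto intro!: derivative_eq_intros simp: power2_eq_square)
    from DERIV_chain2[OF \<psi>[OF Z_lt[OF u]] this]
    have "((\<lambda>u. \<psi> (Z u)) has_field_derivative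
        1 / ((Z u - \<tau>) * (1 - cnj \<tau> * Z u) * P (Z u)) * (\<tau> / u\<^sup>2)) (at u)" .
    moreover have "Z u - \<tau> = - \<tau> / u" "1 - cnj \<tau> * Z u = 1 / u"
      using \<tau>\<tau> by (simp_all add: Z_def right_diff_distrib mult.assoc[symmetric] mult.commute[of _ \<tau>])
    ultimately show "((\<lambda>u. \<psi> (Z u)) has_field_derivative - 1 / P (Z u)) (at u)"
      using u0 \<tau>0 Pz by (simp add: power2_eq_square)
    show "0 < Re (- 1 * (- 1 / P (Z u)))"
      using Pz by (simp add: Re_divide sum_power2_gt_zero_iff)
  next
    show "w z1 \<noteq> w z2"
      using w(2)[of z1] w(2)[of z2] z ne by (metis mem_ball_0)
    show "convex {u. 1 / 2 < Re u}"
      by (rule convex_halfspace_Re_gt)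
  qed (use w(1) z in auto)
  then show False
    using eq w(2) z by simp
qed

lemma Re_of_real_mult: "Re (of_real c * x) = c * Re x"
  by simp

text \<open>The strip of width \<open>\<pi>\<close> shows up by following the interior Koenigs functions for the points \<open>t \<tau>\<close> with
  branches of the logarithm that differ by \<open>2 \<pi> k\<close>: in the limit the univalence criterion of
  \<open>Koenigs_log_lift\<close> becomes the present inequality.\<close>

lemma boundary_log_lift:
  fixes P :: "complex \<Rightarrow> complex" and \<tau> z1 z2 :: complex and m :: real and k :: int
  assumes hol: "P holomorphic_on ball 0 1" and pos: "\<And>z. cmod z < 1 \<Longrightarrow> 0 < Re (P z)"
    and \<tau>: "cmod \<tau> = 1"
    and \<psi>: "\<And>z. cmod z < 1 \<Longrightarrow> (\<psi> has_field_derivative 1 / ((z - \<tau>) * (1 - cnj \<tau> * z) * P z)) (at z)"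
    and lim: "((\<lambda>t. (1 - of_real t) * P (of_real t * \<tau>)) \<longlongrightarrow> of_real m) (at_left 1)" and m: "0 < m"
    and z: "cmod z1 < 1" "cmod z2 < 1"
  shows "0 \<le> Re ((2 * of_real m * (\<psi> z1 - \<psi> z2) + 2 * pi * of_int k * \<i>) * cnj (2 * pi * of_int k * \<i>))"
proof -
  define \<rho> where "\<rho> = max (cmod z1) (cmod z2)"
  have \<rho>: "0 \<le> \<rho>" "\<rho> < 1" "cmod z1 \<le> \<rho>" "cmod z2 \<le> \<rho>"
    using z by (auto simp: \<rho>_def le_max_iff_disj)
  have \<tau>\<tau>: "\<tau> * cnj \<tau> = 1"
    using complex_norm_square[of \<tau>] \<tau> by simp
  define \<sigma> where "\<sigma> t = of_real t * \<tau>" for t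
  define v where "v t z = Moebius_function 0 (\<sigma> t) z" for t z
  define \<mu> where "\<mu> t = of_real (1 - t\<^sup>2) * P (\<sigma> t)" for t
  define a where "a t z = (z - \<sigma> t) * (1 - cnj (\<sigma> t) * z)" for t z
  have nz: "P z \<noteq> 0" if "cmod z < 1" for z
    using pos[OF that] by auto
  have pos': "0 < Re (1 / P z)" if "cmod z < 1" for z
    using pos[OF that] by (simp add: Re_divide add_pos_nonneg)
  have n\<sigma>: "cmod (\<sigma> t) = t" if "0 \<le> t" for t
    using that \<tau> by (simp add: \<sigma>_def norm_mult)
  define Q where "Q t G \<longleftrightarrow> G holomorphic_on ball 0 1 \<and>
    (\<forall>v. cmod v < 1 \<longrightarrow> v * deriv G v = P (\<sigma> t) / P (Moebius_function 0 (- \<sigma> t) v) - 1) \<and>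
    (\<forall>W1 W2. Re W1 < 0 \<longrightarrow> Re W2 < 0 \<longrightarrow> W1 \<noteq> W2 \<longrightarrow>
       0 < Re (1 / P (\<sigma> t) * ((W1 + G (exp W1)) - (W2 + G (exp W2))) * cnj (W1 - W2)))" for t G
  \<comment> \<open>One lift is chosen for each \<open>t\<close>. The lift is determined only up to
    an additive constant, so only differences of its values can have a limit.\<close>
  define G where "G t = (SOME G. Q t G)" for t
  have G: "Q t (G t)" if "0 \<le> t" "t < 1" for t
    unfolding G_def
  proof (rule someI_ex[of "Q t"])
    have \<sigma>1: "cmod (\<sigma> t) < 1"
      using n\<sigma> that by simp
    show "\<exists>G. Q t G"
      unfolding Q_def by (rule Koenigs_log_lift[OF hol pos' \<sigma>1]) blast+
  qed
  \<comment> \<open>For \<open>t > t0\<close> the point \<open>t * \<tau>\<close> has distance at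
    least \<open>(1 - \<rho>) / 2\<close> from \<open>cball 0 \<rho>\<close>. Together with the
    lower bound \<open>1 - \<rho>\<close> for the other factor of \<open>a\<close> this is the
    origin of \<open>\<delta>\<close> below.\<close>
  define t0 where "t0 = (1 + \<rho>) / 2"
  have t0: "0 < t0" "t0 < 1" "\<rho> < t0"
    using \<rho> by (auto simp: t0_def)
  have ev: "\<forall>\<^sub>F t in at_left (1::real). t0 < t \<and> t < 1"
    using t0 by (auto simp: eventually_at_left_field intro!: exI[of _ t0])
  define \<delta> where "\<delta> = (1 - \<rho>)\<^sup>2 / 2"
  have \<delta>: "0 < \<delta>"
    using \<rho> by (simp add: \<delta>_def)
  have a_ge: "\<delta> \<le> cmod (a t z)" if t: "t0 < t" "t \<le> 1" and zr: "cmod z \<le> \<rho>" for t z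
  proof -
    have "(1 - \<rho>) / 2 \<le> t - \<rho>"
      using t by (simp add: t0_def field_simps)
    also have "\<dots> \<le> cmod (z - \<sigma> t)"
      using norm_triangle_ineq3[of z "\<sigma> t"] n\<sigma>[of t] t t0 zr by simp
    finally have 1: "(1 - \<rho>) / 2 \<le> cmod (z - \<sigma> t)" .
    have "cmod (cnj (\<sigma> t) * z) \<le> 1 * \<rho>"
      unfolding norm_mult using n\<sigma>[of t] t t0 zr by (intro mult_mono) auto
    then have 2: "1 - \<rho> \<le> cmod (1 - cnj (\<sigma> t) * z)"
      using norm_triangle_ineq2[of 1 "cnj (\<sigma> t) * z"] by simp
    have "(1 - \<rho>) / 2 * (1 - \<rho>) \<le> cmod (z - \<sigma> t) * cmod (1 - cnj (\<sigma> t) * z)"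
      using 1 2 \<rho> by (intro mult_mono) auto
    then show ?thesis
      by (simp add: \<delta>_def a_def norm_mult power2_eq_square)
  qed
  have a_diff: "cmod (a 1 z - a t z) \<le> 4 * (1 - t)" if t: "t0 < t" "t < 1" and zr: "cmod z \<le> \<rho>" for t z
  proof -
    have \<tau>c: "\<tau> * (cnj \<tau> * c) = c" for c
      using \<tau>\<tau> by (metis mult.assoc mult_1)
    have "a 1 z - a t z = of_real (1 - t) * (of_real (1 + t) * z - \<tau> - cnj \<tau> * z * z)"
      unfolding a_def \<sigma>_def using \<tau>\<tau> by (simp, algebra)
    moreover have "cmod (of_real (1 + t) * z - \<tau> - cnj \<tau> * z * z) \<le> 4"
    proof -
      have "cmod (of_real (1 + t) * z) \<le> 2 * 1" "cmod (cnj \<tau> * z * z) \<le> 1 * 1 * 1"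
        unfolding norm_mult norm_of_real using t t0 zr \<rho> \<tau> by (intro mult_mono; simp)+
      then show ?thesis
        using norm_triangle_ineq4[of "of_real (1 + t) * z - \<tau>" "cnj \<tau> * z * z"]
          norm_triangle_ineq4[of "of_real (1 + t) * z" \<tau>] \<tau> by linarith
    qed
    ultimately have "cmod (a 1 z - a t z) \<le> \<bar>1 - t\<bar> * 4"
      by (simp only: norm_mult norm_of_real mult_left_mono abs_ge_zero)
    then show ?thesis
      using t by simp
  qed
  have a1_le: "cmod (a 1 z) \<le> 4" if zr: "cmod z \<le> \<rho>" for z
  proof -
    have 1: "cmod (z - \<sigma> 1) \<le> 2"
      using norm_triangle_ineq4[of z "\<sigma> 1"] n\<sigma>[of 1] zr \<rho> by simp
    have "cmod (cnj (\<sigma> 1) * z) \<le> 1"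
      using n\<sigma>[of 1] zr \<rho> by (simp add: norm_mult)
    then have 2: "cmod (1 - cnj (\<sigma> 1) * z) \<le> 2"
      using norm_triangle_ineq4[of 1 "cnj (\<sigma> 1) * z"] by simp
    have "cmod (z - \<sigma> 1) * cmod (1 - cnj (\<sigma> 1) * z) \<le> 2 * 2"
      by (intro mult_mono 1 2) auto
    then show ?thesis
      by (simp add: a_def norm_mult)
  qed
  obtain B where B: "0 < B" "\<And>z. cmod z \<le> \<rho> \<Longrightarrow> cmod (1 / P z) \<le> B"
  proof -
    have "continuous_on (cball 0 \<rho>) (\<lambda>z. 1 / P z)"
      using \<rho> nz by (intro continuous_intros holomorphic_on_imp_continuous_on holomorphic_on_subset[OF hol]) auto
    then have "bounded ((\<lambda>z. 1 / P z) ` cball 0 \<rho>)"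
      by (intro compact_imp_bounded compact_continuous_image) auto
    then show ?thesis
      using that unfolding bounded_pos by auto
  qed
  have t1: "((\<lambda>t. complex_of_real t) \<longlongrightarrow> of_real 1) (at_left 1)"
    by (intro tendsto_intros)
  have t1r: "((\<lambda>t. t) \<longlongrightarrow> (1::real)) (at_left 1)"
    by (intro tendsto_intros)
  have "((\<lambda>t. (1 + of_real t) * ((1 - of_real t) * P (of_real t * \<tau>))) \<longlongrightarrow> (1 + of_real 1) * of_real m) (at_left 1)"
    by (intro tendsto_intros lim)
  moreover have "(\<lambda>t. (1 + of_real t) * ((1 - of_real t) * P (of_real t * \<tau>))) = \<mu>"
    by (simp add: fun_eq_iff \<mu>_def \<sigma>_def power2_eq_square algebra_simps)
  ultimately have \<mu>_lim: "(\<mu> \<longlongrightarrow> 2 * of_real m) (at_left 1)"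
    by simp
  \<comment> \<open>\<open>\<beta> t\<close> is to bound the derivative of \<open>\<Phi> t\<close>
    on \<open>cball 0 \<rho>\<close>. The first summand estimates the difference of
    \<open>\<mu> t / a t z\<close> and \<open>2 * m / a 1 z\<close>, the second the logarithmic
    derivative \<open>q\<close> of \<open>v t\<close>.\<close>
  define \<beta> where "\<beta> t = B * ((4 * cmod (\<mu> t - 2 * of_real m) + 8 * m * (1 - t)) / \<delta>\<^sup>2) + 2 * (1 - t) / \<delta>" for t
  have "(\<beta> \<longlongrightarrow> B * ((4 * cmod (2 * of_real m - 2 * of_real m) + 8 * m * (1 - 1)) / \<delta>\<^sup>2) + 2 * (1 - 1) / \<delta>) (at_left 1)"
    unfolding \<beta>_def using \<delta> by (intro tendsto_intros \<mu>_lim t1r) auto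
  then have \<beta>_lim: "(\<beta> \<longlongrightarrow> 0) (at_left 1)"
    by simp
  \<comment> \<open>The derivative of \<open>G t (v t z)\<close> tends to \<open>2 * m\<close> times
    that of \<open>\<psi>\<close>. The factor 2 is the limit of \<open>1 + t\<close> in
    \<open>1 - t\<^sup>2 = (1 + t) * (1 - t)\<close>.\<close>
  define \<Phi> where "\<Phi> t z = G t (v t z) - 2 * of_real m * \<psi> z" for t z
  have D: "cmod (\<Phi> t z1 - \<Phi> t z2) \<le> \<beta> t * cmod (z1 - z2)" if t: "t0 < t" "t < 1" for t
  proof (rule field_differentiable_bound[of "cball 0 \<rho>"])
    define q where "q z = of_real (1 - t\<^sup>2) / a t z" for z
    define \<Phi>' where "\<Phi>' z = 1 / P z * (\<mu> t / a t z - 2 * of_real m / a 1 z) - q z" for z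
    have tt: "0 \<le> t" "t < 1"
      using t t0 by auto
    fix z :: complex assume "z \<in> cball 0 \<rho>"
    then have zr: "cmod z \<le> \<rho>" by simp
    then have z1: "cmod z < 1"
      using \<rho> by simp
    have a0: "a t z \<noteq> 0" "a 1 z \<noteq> 0"
      using a_ge[of t z] a_ge[of 1 z] t t0 zr \<delta> by auto
    have vlt: "cmod (v t z) < 1"
      unfolding v_def by (rule Moebius_function_norm_lt_1) (use n\<sigma> tt z1 in auto)
    have ne: "z - \<sigma> t \<noteq> 0" "1 - cnj (\<sigma> t) * z \<noteq> 0"
      using a0 by (auto simp: a_def)
    have dv: "(v t has_field_derivative of_real (1 - t\<^sup>2) / (1 - cnj (\<sigma> t) * z)\<^sup>2) (at z)"
      using has_field_derivative_Moebius_function[OF ne(2)] n\<sigma>[OF tt(1)] by (simp add: v_def[abs_def])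
    have "(G t has_field_derivative deriv (G t) (v t z)) (at (v t z))"
      using G[OF tt] vlt unfolding Q_def by (intro holomorphic_derivI[of _ "ball 0 1"]) auto
    from DERIV_chain2[OF this dv]
    have dG: "((\<lambda>z. G t (v t z)) has_field_derivative
        deriv (G t) (v t z) * (of_real (1 - t\<^sup>2) / (1 - cnj (\<sigma> t) * z)\<^sup>2)) (at z)" .
    have vz: "v t z = (z - \<sigma> t) / (1 - cnj (\<sigma> t) * z)"
      by (simp add: v_def Moebius_function_simple)
    have "v t z * deriv (G t) (v t z) = P (\<sigma> t) / P z - 1"
      using G[OF tt] vlt Moebius_function_inverse[of "\<sigma> t" z] n\<sigma> tt z1 by (simp add: v_def Q_def)
    moreover have "of_real (1 - t\<^sup>2) / (1 - cnj (\<sigma> t) * z)\<^sup>2 = v t z * q z"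
      using ne unfolding vz q_def a_def by (simp add: power2_eq_square del: of_real_diff of_real_power)
    ultimately have "deriv (G t) (v t z) * (of_real (1 - t\<^sup>2) / (1 - cnj (\<sigma> t) * z)\<^sup>2) = (P (\<sigma> t) / P z - 1) * q z"
      by (simp add: mult_ac)
    also have "\<dots> = 1 / P z * (\<mu> t / a t z) - q z"
      unfolding q_def \<mu>_def left_diff_distrib by (simp add: mult_ac del: of_real_diff of_real_power)
    finally have dG': "((\<lambda>z. G t (v t z)) has_field_derivative 1 / P z * (\<mu> t / a t z) - q z) (at z)"
      using dG by simp
    have "(\<psi> has_field_derivative 1 / (a 1 z * P z)) (at z)"
      using \<psi>[OF z1] by (simp add: a_def \<sigma>_def)
    then have "((\<lambda>z. 2 * of_real m * \<psi> z) has_field_derivative 2 * of_real m * (1 / (a 1 z * P z))) (at z)"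
      by (rule DERIV_cmult)
    from DERIV_diff[OF dG' this]
    have "(\<Phi> t has_field_derivative \<Phi>' z) (at z)"
      unfolding \<Phi>_def \<Phi>'_def by (simp add: algebra_simps)
    then show "(\<Phi> t has_field_derivative \<Phi>' z) (at z within cball 0 \<rho>)"
      by (rule has_field_derivative_at_within)
    have "\<mu> t * a 1 z - 2 * of_real m * a t z = (\<mu> t - 2 * of_real m) * a 1 z + 2 * of_real m * (a 1 z - a t z)"
      by (simp add: algebra_simps)
    also have "cmod \<dots> \<le> cmod (\<mu> t - 2 * of_real m) * cmod (a 1 z) + 2 * m * cmod (a 1 z - a t z)"
      using m by (intro norm_triangle_le) (simp add: norm_mult)
    also have "\<dots> \<le> cmod (\<mu> t - 2 * of_real m) * 4 + 2 * m * (4 * (1 - t))"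
      using m by (intro add_mono mult_left_mono a1_le[OF zr] a_diff[OF t zr]) auto
    finally have num: "cmod (\<mu> t * a 1 z - 2 * of_real m * a t z) \<le> 4 * cmod (\<mu> t - 2 * of_real m) + 8 * m * (1 - t)"
      by (simp add: algebra_simps)
    have den: "\<delta>\<^sup>2 \<le> cmod (a t z) * cmod (a 1 z)"
      unfolding power2_eq_square using a_ge[of t z] a_ge[of 1 z] t t0 zr \<delta> by (intro mult_mono) auto
    have "\<mu> t / a t z - 2 * of_real m / a 1 z = (\<mu> t * a 1 z - 2 * of_real m * a t z) / (a t z * a 1 z)"
      using a0 by (simp add: divide_simps)
    then have "cmod (\<mu> t / a t z - 2 * of_real m / a 1 z)
        = cmod (\<mu> t * a 1 z - 2 * of_real m * a t z) / (cmod (a t z) * cmod (a 1 z))"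
      by (simp add: norm_mult norm_divide)
    also have "\<dots> \<le> (4 * cmod (\<mu> t - 2 * of_real m) + 8 * m * (1 - t)) / \<delta>\<^sup>2"
      using \<delta> m t by (intro frac_le num den) auto
    finally have 1: "cmod (1 / P z * (\<mu> t / a t z - 2 * of_real m / a 1 z))
        \<le> B * ((4 * cmod (\<mu> t - 2 * of_real m) + 8 * m * (1 - t)) / \<delta>\<^sup>2)"
      unfolding norm_mult using B(1) by (intro mult_mono B(2) zr) auto
    have "\<bar>1 - t\<^sup>2\<bar> = (1 + t) * (1 - t)"
      using tt by (simp add: power2_eq_square algebra_simps abs_if) (use tt in \<open>auto simp: not_less mult_le_one\<close>)
    also have "\<dots> \<le> 2 * (1 - t)"
      using tt by (intro mult_right_mono) auto
    finally have 2: "cmod (q z) \<le> 2 * (1 - t) / \<delta>"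
      unfolding q_def norm_divide norm_of_real using a_ge[of t z] t zr \<delta> tt by (intro frac_le) auto
    show "cmod (\<Phi>' z) \<le> \<beta> t"
      unfolding \<Phi>'_def \<beta>_def using norm_triangle_ineq4 1 2 by (rule order_trans[OF _ add_mono])
  qed (use \<rho> in \<open>auto intro: convex_cball\<close>)
  have "((\<lambda>t. \<Phi> t z1 - \<Phi> t z2) \<longlongrightarrow> 0) (at_left 1)"
  proof (rule Lim_null_comparison)
    show "\<forall>\<^sub>F t in at_left 1. cmod (\<Phi> t z1 - \<Phi> t z2) \<le> \<beta> t * cmod (z1 - z2)"
      by (rule eventually_mono[OF ev]) (use D in auto)
    show "((\<lambda>t. \<beta> t * cmod (z1 - z2)) \<longlongrightarrow> 0) (at_left 1)"
      using tendsto_mult[OF \<beta>_lim tendsto_const[of "cmod (z1 - z2)"]] by simp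
  qed
  from tendsto_add[OF this tendsto_const[of "2 * of_real m * (\<psi> z1 - \<psi> z2)"]]
  have G_lim: "((\<lambda>t. G t (v t z1) - G t (v t z2)) \<longlongrightarrow> 2 * of_real m * (\<psi> z1 - \<psi> z2)) (at_left 1)"
    by (simp add: \<Phi>_def algebra_simps)
  have v_lim: "((\<lambda>t. v t z) \<longlongrightarrow> - \<tau>) (at_left 1)" if "cmod z < 1" for z
  proof -
    have \<sigma>_lim: "(\<sigma> \<longlongrightarrow> \<tau>) (at_left 1)"
      unfolding \<sigma>_def using tendsto_mult[OF t1 tendsto_const[of \<tau>]] by simp
    have ne: "1 - cnj \<tau> * z \<noteq> 0"
      using \<tau> that by (intro one_minus_cnj_mult_nonzero) auto
    have "((\<lambda>t. (z - \<sigma> t) / (1 - cnj (\<sigma> t) * z)) \<longlongrightarrow> (z - \<tau>) / (1 - cnj \<tau> * z)) (at_left 1)"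
      by (intro tendsto_intros \<sigma>_lim ne)
    moreover have "z - \<tau> = - \<tau> * (1 - cnj \<tau> * z)"
      using \<tau>\<tau> by (simp add: algebra_simps mult.assoc[symmetric])
    ultimately show ?thesis
      using ne by (simp add: v_def Moebius_function_simple)
  qed
  \<comment> \<open>The difference of two logarithms of \<open>v t z1\<close> and
    \<open>v t z2\<close>, with \<open>k\<close> extra turns. Both points tend to
    \<open>- \<tau>\<close>, so the principal logarithm of their quotient tends to 0 and only the
    turns remain.\<close>
  define lam where "lam t = Ln (v t z1 / v t z2) + 2 * pi * of_int k * \<i>" for t
  have lam_lim: "(lam \<longlongrightarrow> Ln 1 + 2 * pi * of_int k * \<i>) (at_left 1)"
    unfolding lam_def
  proof (intro tendsto_intros)
    show "((\<lambda>t. v t z1 / v t z2) \<longlongrightarrow> 1) (at_left 1)"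
    proof -
      have "\<tau> \<noteq> 0"
        using \<tau> by auto
      then show ?thesis
        using tendsto_divide[OF v_lim[OF z(1)] v_lim[OF z(2)]] by simp
    qed
  qed simp
  have fin: "0 \<le> Re (1 / ((1 - of_real t) * P (of_real t * \<tau>)) * (lam t + (G t (v t z1) - G t (v t z2))) * cnj (lam t))"
    if t: "t0 < t" "t < 1" for t
  proof -
    have tt: "0 \<le> t" "t < 1"
      using t t0 by auto
    have v0: "v t z1 \<noteq> 0" "v t z2 \<noteq> 0"
      using a_ge[of t z1] a_ge[of t z2] t \<rho> \<delta> by (auto simp: v_def Moebius_function_simple a_def)
    have vlt: "cmod (v t z1) < 1" "cmod (v t z2) < 1"
      unfolding v_def by (rule Moebius_function_norm_lt_1; use n\<sigma> tt z in auto)+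
    define W2 where "W2 = Ln (v t z2)"
    define W1 where "W1 = W2 + lam t"
    have e2: "exp W2 = v t z2"
      using v0 by (simp add: W2_def)
    have "exp (2 * pi * of_int k * \<i>) = 1"
      by (metis exp_integer_2pi Ints_of_int mult.commute mult.left_commute)
    then have e1: "exp W1 = v t z1"
      using v0 e2 by (simp add: W1_def lam_def exp_add)
    have Re: "Re W1 < 0" "Re W2 < 0"
      using vlt unfolding e1[symmetric] e2[symmetric] by simp_all
    have "0 \<le> Re (1 / P (\<sigma> t) * ((W1 + G t (exp W1)) - (W2 + G t (exp W2))) * cnj (W1 - W2))"
    proof (cases "W1 = W2")
      case False
      then show ?thesis
        using G[OF tt] Re unfolding Q_def by (meson less_imp_le)
    qed simp
    then have "0 \<le> Re (1 / P (\<sigma> t) * (lam t + (G t (v t z1) - G t (v t z2))) * cnj (lam t))"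
      unfolding e1 e2 by (simp add: W1_def add_diff_eq)
    \<comment> \<open>\<open>P (t * \<tau>)\<close> grows like \<open>m / (1 - t)\<close>; the
      positive factor \<open>1 / (1 - t)\<close> keeps the inequality from degenerating to
      \<open>0 \<le> 0\<close> in the limit.\<close>
    then have "0 \<le> (1 / (1 - t)) * Re (1 / P (\<sigma> t) * (lam t + (G t (v t z1) - G t (v t z2))) * cnj (lam t))"
      using tt by (intro mult_nonneg_nonneg) auto
    also have "\<dots> = Re (of_real (1 / (1 - t)) * (1 / P (\<sigma> t) * (lam t + (G t (v t z1) - G t (v t z2))) * cnj (lam t)))"
      by (rule Re_of_real_mult[symmetric])
    also have "of_real (1 / (1 - t)) * (1 / P (\<sigma> t) * (lam t + (G t (v t z1) - G t (v t z2))) * cnj (lam t))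
        = 1 / ((1 - of_real t) * P (of_real t * \<tau>)) * (lam t + (G t (v t z1) - G t (v t z2))) * cnj (lam t)"
      by (simp add: \<sigma>_def)
    finally show ?thesis .
  qed
  have "((\<lambda>t. Re (1 / ((1 - of_real t) * P (of_real t * \<tau>)) * (lam t + (G t (v t z1) - G t (v t z2))) * cnj (lam t)))
      \<longlongrightarrow> Re (1 / of_real m * ((Ln 1 + 2 * pi * of_int k * \<i>) + 2 * of_real m * (\<psi> z1 - \<psi> z2)) * cnj (Ln 1 + 2 * pi * of_int k * \<i>)))
      (at_left 1)"
    using m by (intro tendsto_intros lim G_lim lam_lim) simp
  then have "0 \<le> Re (1 / of_real m * ((Ln 1 + 2 * pi * of_int k * \<i>) + 2 * of_real m * (\<psi> z1 - \<psi> z2)) * cnj (Ln 1 + 2 * pi * of_int k * \<i>))"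
    by (rule tendsto_lowerbound[OF _ eventually_mono[OF ev]]) (use fin in blast, simp)
  also have "1 / of_real m * ((Ln 1 + 2 * pi * of_int k * \<i>) + 2 * of_real m * (\<psi> z1 - \<psi> z2)) * cnj (Ln 1 + 2 * pi * of_int k * \<i>)
      = of_real (1 / m) * ((2 * of_real m * (\<psi> z1 - \<psi> z2) + 2 * pi * of_int k * \<i>) * cnj (2 * pi * of_int k * \<i>))"
    by (simp add: add.commute)
  also have "Re \<dots> = 1 / m * Re ((2 * of_real m * (\<psi> z1 - \<psi> z2) + 2 * pi * of_int k * \<i>) * cnj (2 * pi * of_int k * \<i>))"
    by (rule Re_of_real_mult)
  finally show ?thesis
    using m by (simp add: zero_le_mult_iff zero_le_divide_iff)
qed

text \<open>With \<open>\<psi>\<close> a primitive of \<open>1 / f\<close>, the function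
  \<open>exp (m * \<psi>)\<close> solves the equation. Since \<open>\<psi>\<close> is injective,
  univalence fails only if two of its values differ by a nonzero period
  \<open>2 * pi * n * \<i> / m\<close>.\<close>

lemma Koenigs_boundary:
  fixes P :: "complex \<Rightarrow> complex" and \<tau> :: complex and m :: real
  assumes hol: "P holomorphic_on ball 0 1" and pos: "\<And>z. cmod z < 1 \<Longrightarrow> 0 < Re (P z)"
    and \<tau>: "cmod \<tau> = 1"
    and lim: "((\<lambda>t. (1 - of_real t) * P (of_real t * \<tau>)) \<longlongrightarrow> of_real m) (at_left 1)" and m: "0 < m"
  obtains h where "h holomorphic_on ball 0 1" "inj_on h (ball 0 1)"
    "\<And>z. cmod z < 1 \<Longrightarrow> deriv h z * ((z - \<tau>) * (1 - cnj \<tau> * z) * P z) = of_real m * h z"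
proof -
  define f where "f z = (z - \<tau>) * (1 - cnj \<tau> * z) * P z" for z
  have f_nz: "f z \<noteq> 0" if "cmod z < 1" for z
    using one_minus_cnj_mult_nonzero[of \<tau> z] that \<tau> pos[OF that] by (auto simp: f_def)
  have "(\<lambda>z. 1 / f z) holomorphic_on ball 0 1"
    using f_nz by (intro holomorphic_intros) (auto simp: f_def intro!: holomorphic_intros hol)
  then obtain \<psi> where \<psi>: "\<And>z. z \<in> ball 0 1 \<Longrightarrow> (\<psi> has_field_derivative 1 / f z) (at z within ball 0 1)"
    using holomorphic_convex_primitive'[of "ball 0 1" "\<lambda>z. 1 / f z"] by auto
  have \<psi>': "(\<psi> has_field_derivative 1 / f z) (at z)" if "cmod z < 1" for z
    using \<psi>[of z] that by (simp add: at_within_open[of _ "ball 0 1"])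
  note \<psi>'' = \<psi>'[unfolded f_def]
  define h where "h z = exp (of_real m * \<psi> z)" for z
  have dh: "(h has_field_derivative exp (of_real m * \<psi> z) * (of_real m * (1 / f z))) (at z)" if "cmod z < 1" for z
    unfolding h_def by (intro DERIV_chain2[OF DERIV_exp] DERIV_cmult \<psi>' that)
  show ?thesis
  proof (rule that[of h])
    show "h holomorphic_on ball 0 1"
      unfolding holomorphic_on_def field_differentiable_def
      using dh has_field_derivative_at_within by (metis mem_ball_0)
    show "deriv h z * ((z - \<tau>) * (1 - cnj \<tau> * z) * P z) = of_real m * h z" if "cmod z < 1" for z
      using DERIV_imp_deriv[OF dh[OF that]] f_nz[OF that] by (simp add: f_def[symmetric] h_def)
    show "inj_on h (ball 0 1)"
    proof (rule inj_onI)
      fix z1 z2 assume z: "z1 \<in> ball 0 1" "z2 \<in> ball 0 1" and "h z1 = h z2"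
      then obtain n :: int where n: "of_real m * \<psi> z1 = of_real m * \<psi> z2 + (of_int (2 * n) * pi) * \<i>"
        unfolding h_def exp_eq by blast
      have "2 * of_real m * (\<psi> z1 - \<psi> z2) = 2 * (of_real m * \<psi> z1 - of_real m * \<psi> z2)"
        by (simp add: algebra_simps)
      also have "\<dots> = 2 * (2 * pi * of_int n * \<i>)"
        unfolding n by simp
      finally have "2 * of_real m * (\<psi> z1 - \<psi> z2) = 2 * (2 * pi * of_int n * \<i>)" .
      \<comment> \<open>The choice \<open>k = - n\<close> makes the product equal to
        \<open>- (2 * pi * n)\<^sup>2\<close>, which contradicts the sign unless
        \<open>n = 0\<close>.\<close>
      moreover have "0 \<le> Re ((2 * of_real m * (\<psi> z1 - \<psi> z2) + 2 * pi * of_int (- n) * \<i>) * cnj (2 * pi * of_int (- n) * \<i>))"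
        by (rule boundary_log_lift[OF hol pos \<tau> \<psi>'' lim m]) (use z in auto)
      ultimately have "0 \<le> Re ((2 * (2 * pi * of_int n * \<i>) + 2 * pi * of_int (- n) * \<i>) * cnj (2 * pi * of_int (- n) * \<i>))"
        by (simp only:)
      then have "(2 * pi * of_int n)\<^sup>2 \<le> 0"
        by (simp add: power2_eq_square algebra_simps)
      then have "n = 0"
        by simp
      then have "\<psi> z1 = \<psi> z2"
        using n m by simp
      then show "z1 = z2"
        using primitive_of_inverse_boundary_inj[OF pos \<tau> \<psi>''] z by (auto dest: inj_onD)
    qed
  qed
qed

subsection \<open>The distortion of the conformal radius\<close>

text \<open>\<open>l\<close> is a logarithm of \<open>h'\<close>, so
  \<open>deriv l = h'' / h'\<close>. The assumption \<open>second_coeff\<close> is Bieberbach's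
  bound 2 for the second coefficient of the Koebe transform of \<open>h\<close> at
  \<open>z\<close>.\<close>

locale univalent_disc =
  fixes h l :: "complex \<Rightarrow> complex"
  assumes h_hol: "h holomorphic_on ball 0 1" and h_inj: "inj_on h (ball 0 1)"
    and l_hol: "l holomorphic_on ball 0 1" and exp_l: "\<And>z. cmod z < 1 \<Longrightarrow> exp (l z) = deriv h z"
    and second_coeff: "\<And>z. cmod z < 1 \<Longrightarrow> cmod ((1 - (cmod z)\<^sup>2) * deriv l z - 2 * cnj z) \<le> 4"
begin

text \<open>\<open>radius z\<close> is the conformal radius of \<open>h ` ball 0 1\<close> at the point \<open>h z\<close>.\<close>

definition radius :: "complex \<Rightarrow> real" where
  "radius z = cmod (deriv h z) * (1 - (cmod z)\<^sup>2)"

lemma deriv_h_nonzero: "cmod z < 1 \<Longrightarrow> deriv h z \<noteq> 0"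
  using exp_l[of z] exp_not_eq_zero by metis

lemma h_deriv: "cmod z < 1 \<Longrightarrow> (h has_field_derivative deriv h z) (at z)"
  using h_hol by (intro holomorphic_derivI[of _ "ball 0 1"]) auto

lemma l_deriv: "cmod z < 1 \<Longrightarrow> (l has_field_derivative deriv l z) (at z)"
  using l_hol by (intro holomorphic_derivI[of _ "ball 0 1"]) auto

lemma open_range: "open (h ` ball 0 1)"
  by (rule open_mapping_thm3[OF h_hol _ h_inj]) simp

definition h_inv :: "complex \<Rightarrow> complex" where
  "h_inv = the_inv_into (ball 0 1) h"

lemma h_inv_h: "cmod z < 1 \<Longrightarrow> h_inv (h z) = z"
  unfolding h_inv_def using h_inj by (intro the_inv_into_f_f) auto

lemma h_inv:
  assumes "w \<in> h ` ball 0 1"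
  shows "cmod (h_inv w) < 1" "h (h_inv w) = w"
  using assms h_inv_h by auto

lemma h_inv_deriv:
  assumes w: "w \<in> h ` ball 0 1"
  shows "(h_inv has_field_derivative 1 / deriv h (h_inv w)) (at w)"
proof -
  obtain g where g: "g holomorphic_on (h ` ball 0 1)"
    "\<And>z. z \<in> ball 0 1 \<Longrightarrow> deriv h z * deriv g (h z) = 1" "\<And>z. z \<in> ball 0 1 \<Longrightarrow> g (h z) = z"
    using holomorphic_has_inverse[OF h_hol _ h_inj] by auto
  have "(g has_field_derivative deriv g w) (at w)"
    by (rule holomorphic_derivI[OF g(1) open_range w])
  moreover have "deriv h (h_inv w) * deriv g w = 1"
    using g(2)[of "h_inv w"] h_inv[OF w] by simp
  then have "deriv g w = 1 / deriv h (h_inv w)"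
    by (metis mult.commute mult_zero_left nonzero_eq_divide_eq zero_neq_one)
  ultimately have "(g has_field_derivative 1 / deriv h (h_inv w)) (at w)"
    by simp
  then show ?thesis
    by (rule has_field_derivative_transform_within_open[OF _ open_range w]) (use g(3) h_inv_h in auto)
qed

lemma radius_eq: "cmod z < 1 \<Longrightarrow> radius z = exp (Re (l z)) * (1 - (cmod z)\<^sup>2)"
  using exp_l[of z, symmetric] by (simp add: radius_def)

text \<open>Along the preimage \<open>x\<close> of the segment the radius decreases at rate at most
  \<open>4 * cmod v\<close>, so it stays above \<open>\<delta>\<close>. Hence
  \<open>cmod (x' u)\<close> is at most
  \<open>(1 - (cmod (x u))\<^sup>2) * cmod v / \<delta>\<close>, which bounds the decrease of the
  logarithm. The end \<open>s\<close> is variable because the whole segment is not yet known to lie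
  in the range.\<close>

lemma segment_estimates:
  assumes x0: "cmod x0 < 1" and s: "0 \<le> s" "s \<le> 1"
    and seg: "\<And>u. 0 \<le> u \<Longrightarrow> u \<le> s \<Longrightarrow> h x0 + of_real u * v \<in> h ` ball 0 1"
    and v: "4 * cmod v < radius x0"
  shows "radius x0 - 4 * s * cmod v \<le> radius (h_inv (h x0 + of_real s * v))"
    and "ln (1 - (cmod x0)\<^sup>2) - 2 * cmod v / (radius x0 - 4 * cmod v) \<le> ln (1 - (cmod (h_inv (h x0 + of_real s * v)))\<^sup>2)"
proof -
  define x where "x u = h_inv (h x0 + of_real u * v)" for u
  define \<delta> where "\<delta> = radius x0 - 4 * cmod v"
  have \<delta>: "0 < \<delta>"
    using v by (simp add: \<delta>_def)
  have x_0: "x 0 = x0"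
    using h_inv_h[OF x0] by (simp add: x_def)
  have x_lt: "cmod (x u) < 1" if "0 \<le> u" "u \<le> s" for u
    unfolding x_def by (rule h_inv[OF seg[OF that]])
  define x' where "x' u = v / deriv h (x u)" for u
  have dx: "(x has_vector_derivative x' u) (at u)" if "0 \<le> u" "u \<le> s" for u
  proof -
    have "((\<lambda>u. h x0 + of_real u * v) has_vector_derivative v) (at u)"
      by (auto intro!: derivative_eq_intros)
    from field_vector_diff_chain_at[OF this h_inv_deriv[OF seg[OF that]]]
    show ?thesis
      by (simp add: x_def[abs_def] x'_def o_def)
  qed
  have dN: "((\<lambda>u. 1 - (cmod (x u))\<^sup>2) has_real_derivative - 2 * Re (cnj (x u) * x' u)) (at u)"
    if u: "0 \<le> u" "u \<le> s" for u
  proof -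
    have re: "((\<lambda>u. Re (x u)) has_real_derivative Re (x' u)) (at u)"
      and im: "((\<lambda>u. Im (x u)) has_real_derivative Im (x' u)) (at u)"
      unfolding has_real_derivative_iff_has_vector_derivative
      using bounded_linear.has_vector_derivative[OF bounded_linear_Re dx[OF u]]
        bounded_linear.has_vector_derivative[OF bounded_linear_Im dx[OF u]] by auto
    from DERIV_diff[OF DERIV_const DERIV_add[OF DERIV_power[OF re, of 2] DERIV_power[OF im, of 2]], of 1]
    show ?thesis
      unfolding cmod_power2 by (simp add: algebra_simps)
  qed
  have dl: "((\<lambda>u. Re (l (x u))) has_real_derivative Re (deriv l (x u) * x' u)) (at u)"
    if u: "0 \<le> u" "u \<le> s" for u
  proof -
    have "((\<lambda>u. l (x u)) has_vector_derivative x' u * deriv l (x u)) (at u)"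
      using field_vector_diff_chain_at[OF dx[OF u] l_deriv[OF x_lt[OF u]]] by (simp add: o_def)
    from bounded_linear.has_vector_derivative[OF bounded_linear_Re this]
    show ?thesis
      unfolding has_real_derivative_iff_has_vector_derivative by (simp add: mult.commute)
  qed
  have x'_norm: "cmod (deriv h (x u)) * cmod (x' u) = cmod v" if "0 \<le> u" "u \<le> s" for u
    using deriv_h_nonzero[OF x_lt[OF that]] by (simp add: x'_def norm_divide)
  have first: "radius x0 - 4 * t * cmod v \<le> radius (x t)" if t: "0 \<le> t" "t \<le> s" for t
  proof -
    have "exp (Re (l (x 0))) * (1 - (cmod (x 0))\<^sup>2) + 4 * cmod v * 0
        \<le> exp (Re (l (x t))) * (1 - (cmod (x t))\<^sup>2) + 4 * cmod v * t"
    proof (rule DERIV_nonneg_imp_nondecreasing[OF t(1)])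
      fix u assume "0 \<le> u" "u \<le> t"
      then have u: "0 \<le> u" "u \<le> s"
        using t by auto
      define E where "E = exp (Re (l (x u)))"
      define K where "K = (1 - (cmod (x u))\<^sup>2) * deriv l (x u) - 2 * cnj (x u)"
      have E: "E = cmod (deriv h (x u))"
        unfolding exp_l[OF x_lt[OF u], symmetric] E_def by simp
      have "((\<lambda>u. exp (Re (l (x u))) * (1 - (cmod (x u))\<^sup>2) + 4 * cmod v * u) has_real_derivative
          (E * Re (deriv l (x u) * x' u)) * (1 - (cmod (x u))\<^sup>2) + (- 2 * Re (cnj (x u) * x' u)) * E + 4 * cmod v * 1) (at u)"
        unfolding E_def
        by (intro DERIV_add DERIV_mult dN[OF u] DERIV_chain2[OF DERIV_exp dl[OF u]] DERIV_cmult DERIV_ident)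
      \<comment> \<open>The derivative of the radius along \<open>x\<close> is exactly the
        expression of \<open>second_coeff\<close> paired with \<open>x' u\<close>.\<close>
      moreover have "(E * Re (deriv l (x u) * x' u)) * (1 - (cmod (x u))\<^sup>2) + (- 2 * Re (cnj (x u) * x' u)) * E
          = E * Re (K * x' u)"
        unfolding K_def left_diff_distrib minus_complex.sel mult.assoc Re_of_real_mult
        by (simp add: algebra_simps)
      moreover have "- (4 * cmod v) \<le> E * Re (K * x' u)"
      proof -
        have "\<bar>E * Re (K * x' u)\<bar> \<le> E * (cmod K * cmod (x' u))"
          using abs_Re_le_cmod[of "K * x' u"] by (simp add: E_def abs_mult norm_mult)
        also have "\<dots> \<le> E * (4 * cmod (x' u))"
          using second_coeff[OF x_lt[OF u]] by (intro mult_left_mono mult_right_mono) (auto simp: E_def K_def)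
        also have "\<dots> = 4 * cmod v"
          using x'_norm[OF u] by (simp add: E)
        finally show ?thesis by linarith
      qed
      ultimately show "\<exists>y. ((\<lambda>u. exp (Re (l (x u))) * (1 - (cmod (x u))\<^sup>2) + 4 * cmod v * u) has_real_derivative y) (at u) \<and> 0 \<le> y"
        by (intro exI conjI) (assumption, linarith)
    qed
    then show ?thesis
      using x0 x_lt[OF t] by (simp add: radius_eq x_0 mult_ac)
  qed
  show "radius x0 - 4 * s * cmod v \<le> radius (h_inv (h x0 + of_real s * v))"
    using first[of s] s by (simp add: x_def)
  have "ln (1 - (cmod (x 0))\<^sup>2) + 2 * cmod v / \<delta> * 0 \<le> ln (1 - (cmod (x s))\<^sup>2) + 2 * cmod v / \<delta> * s"
  proof (rule DERIV_nonneg_imp_nondecreasing[OF s(1)])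
    fix u assume u: "0 \<le> u" "u \<le> s"
    define N where "N = 1 - (cmod (x u))\<^sup>2"
    have N: "0 < N"
      using x_lt[OF u] by (simp add: N_def abs_square_less_1)
    have "((\<lambda>u. ln (1 - (cmod (x u))\<^sup>2) + 2 * cmod v / \<delta> * u) has_real_derivative
        1 / N * (- 2 * Re (cnj (x u) * x' u)) + 2 * cmod v / \<delta> * 1) (at u)"
      by (intro DERIV_add DERIV_cmult DERIV_ident DERIV_chain2[OF _ dN[OF u]])
         (use N in \<open>simp add: N_def DERIV_ln_divide\<close>)
    moreover have "Re (cnj (x u) * x' u) / N \<le> cmod v / \<delta>"
    proof -
      have "4 * u * cmod v \<le> 4 * cmod v"
        using u s by (simp add: mult_left_le_one_le)
      then have "\<delta> \<le> radius (x u)"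
        using first[OF u] unfolding \<delta>_def by linarith
      then have "\<delta> * cmod (x' u) \<le> radius (x u) * cmod (x' u)"
        by (rule mult_right_mono) simp
      also have "\<dots> = N * cmod v"
        using x'_norm[OF u] by (simp add: radius_def N_def)
      finally have "\<delta> * cmod (x' u) \<le> N * cmod v" .
      moreover have "Re (cnj (x u) * x' u) \<le> 1 * cmod (x' u)"
        using complex_Re_le_cmod[of "cnj (x u) * x' u"] x_lt[OF u]
          mult_right_mono[of "cmod (x u)" 1 "cmod (x' u)"] by (simp add: norm_mult)
      then have "\<delta> * Re (cnj (x u) * x' u) \<le> \<delta> * cmod (x' u)"
        using \<delta> by simp
      ultimately have "\<delta> * Re (cnj (x u) * x' u) \<le> N * cmod v"
        by linarith
      then show ?thesis
        using \<delta> N by (simp add: field_simps)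
    qed
    moreover have "0 \<le> 1 / N * (- 2 * a) + 2 * cmod v / \<delta> * 1" if "a / N \<le> cmod v / \<delta>" for a
    proof -
      have "1 / N * (- 2 * a) + 2 * cmod v / \<delta> * 1 = 2 * (cmod v / \<delta> - a / N)"
        by (simp add: algebra_simps)
      with that show ?thesis by simp
    qed
    ultimately show "\<exists>y. ((\<lambda>u. ln (1 - (cmod (x u))\<^sup>2) + 2 * cmod v / \<delta> * u) has_real_derivative y) (at u) \<and> 0 \<le> y"
      by blast
  qed
  moreover have "2 * cmod v / \<delta> * s \<le> 2 * cmod v / \<delta>"
    using s \<delta> by (intro mult_left_le) auto
  ultimately show "ln (1 - (cmod x0)\<^sup>2) - 2 * cmod v / (radius x0 - 4 * cmod v)
      \<le> ln (1 - (cmod (h_inv (h x0 + of_real s * v)))\<^sup>2)"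
    unfolding \<delta>_def[symmetric] x_0 by (simp add: x_def)
qed

text \<open>The logarithmic estimate keeps \<open>h_inv\<close> of the segment in a compact subset of the disc, hence the segment
  cannot leave the range of \<open>h\<close>.\<close>

lemma Koebe_distortion:
  assumes x0: "cmod x0 < 1" and v: "4 * cmod v < radius x0"
  shows "h x0 + v \<in> h ` ball 0 1" "radius x0 - 4 * cmod v \<le> radius (h_inv (h x0 + v))"
proof -
  define \<gamma> where "\<gamma> u = h x0 + of_real u * v" for u :: real
  have \<gamma>_cont: "continuous_on S \<gamma>" for S
    unfolding \<gamma>_def by (intro continuous_intros)
  have all: "\<gamma> s \<in> h ` ball 0 1" if s: "s \<in> {0..1}" for s
  proof (rule ccontr)
    assume ns: "\<gamma> s \<notin> h ` ball 0 1"
    define B where "B = {0..1} \<inter> \<gamma> -` (- (h ` ball 0 1))"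
    have "compact B"
      unfolding B_def using open_range \<gamma>_cont
      by (intro compact_Int_closed closed_vimage closed_Compl) auto
    moreover have "B \<noteq> {}"
      using s ns by (auto simp: B_def)
    \<comment> \<open>The first exit from the range exists because the range is open, so the set of
      exit parameters is compact.\<close>
    ultimately obtain T where T: "T \<in> B" "\<And>u. u \<in> B \<Longrightarrow> T \<le> u"
      using compact_attains_inf by metis
    have T01: "0 \<le> T" "T \<le> 1" "\<gamma> T \<notin> h ` ball 0 1"
      using T(1) by (auto simp: B_def)
    have below: "\<gamma> u \<in> h ` ball 0 1" if "0 \<le> u" "u < T" for u
      using T(2)[of u] that T01 by (auto simp: B_def)
    have "T \<noteq> 0"
      using T01(3) x0 by (auto simp: \<gamma>_def)
    \<comment> \<open>\<open>c\<close> is the lower bound for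
      \<open>1 - (cmod (h_inv (\<gamma> u)))\<^sup>2\<close> given by the logarithmic estimate,
      uniformly in \<open>u < T\<close>; \<open>\<rho>\<close> is the corresponding bound for
      \<open>cmod (h_inv (\<gamma> u))\<close>.\<close>
    define c where "c = exp (ln (1 - (cmod x0)\<^sup>2) - 2 * cmod v / (radius x0 - 4 * cmod v))"
    define \<rho> where "\<rho> = sqrt (1 - c)"
    have x02: "0 < 1 - (cmod x0)\<^sup>2"
      using x0 by (simp add: abs_square_less_1)
    have "c \<le> exp (ln (1 - (cmod x0)\<^sup>2))"
      unfolding c_def using v by simp
    then have "c \<le> 1 - (cmod x0)\<^sup>2"
      using x02 by simp
    then have c: "0 < c" "c \<le> 1"
      using zero_le_power2[of "cmod x0"] by (simp add: c_def, linarith)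
    have \<rho>: "\<rho> < 1"
      using c by (simp add: \<rho>_def)
    have in_K: "\<gamma> u \<in> h ` cball 0 \<rho>" if u: "0 \<le> u" "u < T" for u
    proof -
      have lt: "cmod (h_inv (\<gamma> u)) < 1" "h (h_inv (\<gamma> u)) = \<gamma> u"
        using h_inv[OF below[OF u]] by auto
      have "ln (1 - (cmod x0)\<^sup>2) - 2 * cmod v / (radius x0 - 4 * cmod v) \<le> ln (1 - (cmod (h_inv (\<gamma> u)))\<^sup>2)"
        unfolding \<gamma>_def
        by (rule segment_estimates(2)[OF x0 _ _ _ v]) (use u T01 below[unfolded \<gamma>_def] in auto)
      then have "c \<le> exp (ln (1 - (cmod (h_inv (\<gamma> u)))\<^sup>2))"
        unfolding c_def by simp
      then have "c \<le> 1 - (cmod (h_inv (\<gamma> u)))\<^sup>2"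
        using lt by (simp add: abs_square_less_1)
      then have "cmod (h_inv (\<gamma> u)) \<le> \<rho>"
        unfolding \<rho>_def by (intro real_le_rsqrt) simp
      then show ?thesis
        using lt(2) by (intro image_eqI[of _ _ "h_inv (\<gamma> u)"]) auto
    qed
    have "continuous_on (cball 0 \<rho>) h"
      by (rule continuous_on_subset[OF holomorphic_on_imp_continuous_on[OF h_hol]]) (use \<rho> in auto)
    then have "closed (h ` cball 0 \<rho>)"
      by (intro compact_imp_closed compact_continuous_image) auto
    moreover have "(\<gamma> \<longlongrightarrow> \<gamma> T) (at_left T)"
      using \<gamma>_cont[of UNIV] by (simp add: continuous_on_eq_continuous_at isCont_def filterlim_at_split)
    moreover have "\<forall>\<^sub>F u in at_left T. \<gamma> u \<in> h ` cball 0 \<rho>"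
      using \<open>T \<noteq> 0\<close> T01 in_K by (auto simp: eventually_at_left_field intro!: exI[of _ 0])
    ultimately have "\<gamma> T \<in> h ` cball 0 \<rho>"
      by (intro Lim_in_closed_set) auto
    then show False
      using T01(3) \<rho> by auto
  qed
  show "h x0 + v \<in> h ` ball 0 1"
    using all[of 1] by (simp add: \<gamma>_def)
  show "radius x0 - 4 * cmod v \<le> radius (h_inv (h x0 + v))"
    using segment_estimates(1)[OF x0, of 1 v] all v by (auto simp: \<gamma>_def)
qed

end

subsection \<open>Complex differentiability in normed spaces\<close>

lemma bounded_bilinear_scaleC:
  "bounded_bilinear (scaleC :: complex \<Rightarrow> 'a::complex_normed_vector \<Rightarrow> 'a)"
proof
  fix a a' :: complex and b b' :: 'a and t :: real
  show "(a + a') *\<^sub>C b = a *\<^sub>C b + a' *\<^sub>C b" "a *\<^sub>C (b + b') = a *\<^sub>C b + a *\<^sub>C b'"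
    by (rule scaleC_add_left, rule scaleC_add_right)
  show "(t *\<^sub>R a) *\<^sub>C b = t *\<^sub>R a *\<^sub>C b" "a *\<^sub>C t *\<^sub>R b = t *\<^sub>R a *\<^sub>C b"
    by (simp_all add: scaleR_scaleC[where 'a = 'a] scaleC_scaleC scaleR_conv_of_real mult.commute)
  show "\<exists>K. \<forall>a (b :: 'a). norm (a *\<^sub>C b) \<le> norm a * norm b * K"
    by (intro exI[of _ 1]) (simp add: norm_scaleC)
qed

lemma scaleC_one: "1 *\<^sub>C (y :: 'a::complex_normed_vector) = y"
  using scaleR_scaleC[of 1 y] by simp

lemma scaleC_zero: "c *\<^sub>C (0 :: 'a::complex_normed_vector) = 0"
  using norm_scaleC[of c "0 :: 'a"] by simp

text \<open>The derivative is taken along the full neighbourhood filter, so the chain rule composes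
  without tracking images of domains. Holomorphy on a set then follows by restriction.\<close>

definition complex_differentiable_at ::
    "('a::complex_normed_vector \<Rightarrow> 'b::complex_normed_vector) \<Rightarrow> 'a \<Rightarrow> bool" where
  "complex_differentiable_at g p \<longleftrightarrow> (\<exists>L. (g has_derivative L) (at p) \<and> (\<forall>c v. L (c *\<^sub>C v) = c *\<^sub>C L v))"

lemma complex_differentiable_at_imp_holomorphic_map:
  assumes "\<And>p. p \<in> D \<Longrightarrow> complex_differentiable_at g p"
  shows "holomorphic_map_on g D"
  using assms has_derivative_at_withinI
  unfolding holomorphic_map_on_def complex_differentiable_at_def by metis

lemma complex_differentiable_at_const: "complex_differentiable_at (\<lambda>_. c) p"
  unfolding complex_differentiable_at_def
  by (intro exI[of _ "\<lambda>_. 0"]) (simp add: scaleC_zero)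

lemma complex_differentiable_at_fst: "complex_differentiable_at fst p"
  unfolding complex_differentiable_at_def
  by (intro exI[of _ fst]) (simp add: scaleC_prod_def bounded_linear_imp_has_derivative bounded_linear_fst)

lemma complex_differentiable_at_snd: "complex_differentiable_at snd p"
  unfolding complex_differentiable_at_def
  by (intro exI[of _ snd]) (simp add: scaleC_prod_def bounded_linear_imp_has_derivative bounded_linear_snd)

lemma complex_differentiable_at_Pair:
  assumes "complex_differentiable_at g p" "complex_differentiable_at k p"
  shows "complex_differentiable_at (\<lambda>p. (g p, k p)) p"
proof -
  obtain L M where "(g has_derivative L) (at p)" "\<forall>c v. L (c *\<^sub>C v) = c *\<^sub>C L v"
    "(k has_derivative M) (at p)" "\<forall>c v. M (c *\<^sub>C v) = c *\<^sub>C M v"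
    using assms unfolding complex_differentiable_at_def by blast
  then show ?thesis
    unfolding complex_differentiable_at_def
    by (intro exI[of _ "\<lambda>v. (L v, M v)"]) (auto intro: has_derivative_Pair simp: scaleC_prod_def)
qed

lemma complex_differentiable_at_compose:
  assumes "complex_differentiable_at g p" "complex_differentiable_at k (g p)"
  shows "complex_differentiable_at (\<lambda>p. k (g p)) p"
proof -
  obtain L M where "(g has_derivative L) (at p)" "\<forall>c v. L (c *\<^sub>C v) = c *\<^sub>C L v"
    "(k has_derivative M) (at (g p))" "\<forall>c v. M (c *\<^sub>C v) = c *\<^sub>C M v"
    using assms unfolding complex_differentiable_at_def by blast
  then show ?thesis
    unfolding complex_differentiable_at_def
    by (intro exI[of _ "\<lambda>v. M (L v)"]) (auto intro: has_derivative_compose)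
qed

lemma complex_differentiable_at_field:
  fixes k :: "complex \<Rightarrow> complex"
  assumes "(k has_field_derivative k') (at z)"
  shows "complex_differentiable_at k z"
  unfolding complex_differentiable_at_def
  using assms by (intro exI[of _ "(*) k'"]) (simp add: has_field_derivative_def scaleC_complex_def)

lemma complex_differentiable_at_scaleC:
  assumes "complex_differentiable_at g p" "complex_differentiable_at k p"
  shows "complex_differentiable_at (\<lambda>p. g p *\<^sub>C k p) p"
proof -
  obtain L M where *: "(g has_derivative L) (at p)" "\<forall>c v. L (c *\<^sub>C v) = c *\<^sub>C L v"
    "(k has_derivative M) (at p)" "\<forall>c v. M (c *\<^sub>C v) = c *\<^sub>C M v"
    using assms unfolding complex_differentiable_at_def by blast
  have "((\<lambda>p. g p *\<^sub>C k p) has_derivative (\<lambda>v. g p *\<^sub>C M v + L v *\<^sub>C k p)) (at p)"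
    by (rule bounded_bilinear.FDERIV[OF bounded_bilinear_scaleC *(1,3)])
  with * show ?thesis
    unfolding complex_differentiable_at_def
    by (intro exI[of _ "\<lambda>v. g p *\<^sub>C M v + L v *\<^sub>C k p"])
       (simp add: scaleC_add_right scaleC_scaleC scaleC_complex_def mult.commute)
qed

lemma complex_differentiable_at_mult:
  fixes g k :: "'a::complex_normed_vector \<Rightarrow> complex"
  shows "complex_differentiable_at g p \<Longrightarrow> complex_differentiable_at k p \<Longrightarrow> complex_differentiable_at (\<lambda>p. g p * k p) p"
  using complex_differentiable_at_scaleC[of g p k] by (simp add: scaleC_complex_def)

lemma complex_differentiable_at_diff:
  assumes "complex_differentiable_at g p" "complex_differentiable_at k p"
  shows "complex_differentiable_at (\<lambda>p. g p - k p) p"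
proof -
  obtain L M where *: "(g has_derivative L) (at p)" "\<forall>c v. L (c *\<^sub>C v) = c *\<^sub>C L v"
    "(k has_derivative M) (at p)" "\<forall>c v. M (c *\<^sub>C v) = c *\<^sub>C M v"
    using assms unfolding complex_differentiable_at_def by blast
  have "c *\<^sub>C (a - b) = c *\<^sub>C a - c *\<^sub>C b" for c and a b :: 'b
    by (rule bounded_bilinear.diff_right[OF bounded_bilinear_scaleC])
  with * show ?thesis
    unfolding complex_differentiable_at_def
    by (intro exI[of _ "\<lambda>v. L v - M v"]) (auto intro: has_derivative_diff)
qed

subsection \<open>Homogeneous polynomials\<close>

locale bounded_multilinear_map =
  fixes m :: nat and A :: "(nat \<Rightarrow> 'a::complex_normed_vector) \<Rightarrow> 'b::complex_normed_vector"
  assumes multilinear: "bounded_multilinear m A"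
begin

lemma cong: "(\<And>i. i < m \<Longrightarrow> v i = w i) \<Longrightarrow> A v = A w"
  using multilinear unfolding bounded_multilinear_def by blast

lemma additive: "i < m \<Longrightarrow> A (v(i := x + y)) = A (v(i := x)) + A (v(i := y))"
  using multilinear unfolding bounded_multilinear_def by blast

lemma scale: "i < m \<Longrightarrow> A (v(i := c *\<^sub>C x)) = c *\<^sub>C A (v(i := x))"
  using multilinear unfolding bounded_multilinear_def by blast

lemma bound:
  obtains K where "0 < K" "\<And>v. norm (A v) \<le> K * (\<Prod>i<m. norm (v i))"
proof -
  obtain K where K: "\<And>v. norm (A v) \<le> K * (\<Prod>i<m. norm (v i))"
    using multilinear unfolding bounded_multilinear_def by blast
  have "norm (A v) \<le> (\<bar>K\<bar> + 1) * (\<Prod>i<m. norm (v i))" for v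
    by (rule order_trans[OF K mult_right_mono]) (auto intro: prod_nonneg)
  then show ?thesis
    using that[of "\<bar>K\<bar> + 1"] by simp
qed

text \<open>The arguments are exchanged one at a time. The identity is applied to the increment of
  the polynomial, and once more to the resulting terms to obtain a remainder of second
  order.\<close>

lemma telescope:
  "A v - A w = (\<Sum>i<m. A (\<lambda>j. if j < i then v j else if j = i then v i - w i else w j))"
proof -
  define t where "t i = A (\<lambda>j. if j < i then v j else w j)" for i
  have "A v - A w = t m - t 0"
    unfolding t_def by (intro arg_cong2[where f = "(-)"] cong) auto
  also have "\<dots> = (\<Sum>i<m. t (Suc i) - t i)"
    by (rule sum_lessThan_telescope[symmetric])
  also have "\<dots> = (\<Sum>i<m. A (\<lambda>j. if j < i then v j else if j = i then v i - w i else w j))"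
  proof (rule sum.cong)
    fix i assume "i \<in> {..<m}"
    then have i: "i < m" by simp
    define u where "u = (\<lambda>j. if j < i then v j else w j)"
    have "t (Suc i) = A (u(i := (v i - w i) + w i))"
      unfolding t_def u_def by (intro cong) auto
    also have "\<dots> = A (u(i := v i - w i)) + A (u(i := w i))"
      by (rule additive[OF i])
    also have "u(i := w i) = u"
      by (auto simp: u_def)
    also have "A u = t i"
      by (simp add: t_def u_def)
    also have "u(i := v i - w i) = (\<lambda>j. if j < i then v j else if j = i then v i - w i else w j)"
      by (auto simp: u_def)
    finally show "t (Suc i) - t i = A (\<lambda>j. if j < i then v j else if j = i then v i - w i else w j)"
      by simp
  qed simp
  finally show ?thesis .
qed

lemma diagonal_scale: "A (\<lambda>_. c *\<^sub>C y) = c ^ m *\<^sub>C A (\<lambda>_. y)"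
proof -
  have "k \<le> m \<Longrightarrow> A (\<lambda>j. if j < k then c *\<^sub>C y else y) = c ^ k *\<^sub>C A (\<lambda>_. y)" for k
  proof (induction k)
    case 0
    then show ?case by (simp add: scaleC_one)
  next
    case (Suc k)
    define u where "u = (\<lambda>j. if j < k then c *\<^sub>C y else y)"
    have "(\<lambda>j. if j < Suc k then c *\<^sub>C y else y) = u(k := c *\<^sub>C y)" "u(k := y) = u"
      by (auto simp: u_def fun_eq_iff)
    then show ?case
      using Suc scale[of k u c y] by (simp add: scaleC_scaleC u_def)
  qed
  from this[of m] show ?thesis
    using cong[of "\<lambda>_. c *\<^sub>C y" "\<lambda>j. if j < m then c *\<^sub>C y else y"] by simp
qed

lemma complex_differentiable_at_diagonal: "complex_differentiable_at (\<lambda>y. A (\<lambda>_. y)) y"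
proof -
  obtain K where K: "0 < K" "\<And>v. norm (A v) \<le> K * (\<Prod>i<m. norm (v i))"
    using bound by blast
  \<comment> \<open>\<open>M\<close> bounds both \<open>norm y\<close> and
    \<open>norm (y + v)\<close> for \<open>norm v \<le> 1\<close>. Being at least 1, it may also be
    inserted at the slots occupied by \<open>v\<close>.\<close>
  define M where "M = norm y + 1"
  have M: "1 \<le> M"
    by (simp add: M_def)
  define D where "D v = (\<Sum>i<m. A ((\<lambda>_. y)(i := v)))" for v
  have D_scale: "D (c *\<^sub>C v) = c *\<^sub>C D v" for c v
    unfolding D_def bounded_bilinear.sum_right[OF bounded_bilinear_scaleC]
    by (intro sum.cong refl scale) simp
  have "bounded_linear D"
    unfolding D_def
  proof (intro bounded_linear_sum bounded_linear_intro)
    fix i assume "i \<in> {..<m}"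
    then have i: "i < m" by simp
    show "A ((\<lambda>_. y)(i := v + w)) = A ((\<lambda>_. y)(i := v)) + A ((\<lambda>_. y)(i := w))" for v w
      by (rule additive[OF i])
    show "A ((\<lambda>_. y)(i := t *\<^sub>R v)) = t *\<^sub>R A ((\<lambda>_. y)(i := v))" for t v
      unfolding scaleR_scaleC by (rule scale[OF i])
    show "norm (A ((\<lambda>_. y)(i := v))) \<le> norm v * (K * M ^ m)" for v
    proof -
      have "(\<Prod>j<m. norm (((\<lambda>_. y)(i := v)) j)) \<le> (\<Prod>j<m. (if j = i then norm v else 1) * M)"
      proof (rule prod_mono, intro conjI)
        fix j assume "j \<in> {..<m}"
        have "norm v \<le> norm v * M"
          using mult_left_mono[OF M, of "norm v"] by simp
        moreover have "norm y \<le> M"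
          by (simp add: M_def)
        ultimately show "norm (((\<lambda>_. y)(i := v)) j) \<le> (if j = i then norm v else 1) * M"
          by simp
      qed simp
      also have "\<dots> = norm v * M ^ m"
        using i by (simp add: prod.distrib prod.delta)
      finally have "K * (\<Prod>j<m. norm (((\<lambda>_. y)(i := v)) j)) \<le> K * (norm v * M ^ m)"
        using K(1) by (intro mult_left_mono) auto
      also have "\<dots> = norm v * (K * M ^ m)"
        by (rule mult.left_commute)
      finally show ?thesis
        using K(2)[of "(\<lambda>_. y)(i := v)"] by linarith
    qed
  qed
  moreover have rem: "norm (A (\<lambda>_. y + v) - A (\<lambda>_. y) - D v) \<le> (real m * (real m * (K * M ^ m)) * norm v) * norm v"
    if v: "norm v \<le> 1" for v
  proof -
    \<comment> \<open>\<open>a i\<close> is the \<open>i\<close>-th argument of the first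
      telescoping, \<open>b i\<close> its linearisation, and \<open>c i k\<close> the
      \<open>k\<close>-th argument when their difference is telescoped again. For
      \<open>k < i\<close> it has \<open>v\<close> at both \<open>k\<close> and \<open>i\<close>,
      which gives the square of \<open>norm v\<close>; for \<open>k \<ge> i\<close> its
      \<open>k\<close>-th entry is 0.\<close>
    define a where "a i = (\<lambda>j. if j < i then y + v else if j = i then v else y)" for i :: nat
    define b where "b i = (\<lambda>_. y)(i := v)" for i :: nat
    define c where "c i k = (\<lambda>j. if j < k then a i j else if j = k then a i k - b i k else b i j)" for i k :: nat
    have yv: "norm (y + v) \<le> M"
      using norm_triangle_ineq[of y v] v by (simp add: M_def)
    have nc: "norm (A (c i k)) \<le> K * M ^ m * (norm v * norm v)" if i: "i < m" and k: "k < m" for i k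
    proof (cases "k < i")
      case True
      have "(\<Prod>j<m. norm (c i k j)) \<le> (\<Prod>j<m. ((if j = k then norm v else 1) * (if j = i then norm v else 1)) * M)"
      proof (rule prod_mono, intro conjI)
        fix j assume "j \<in> {..<m}"
        have "norm v \<le> norm v * M"
          using mult_left_mono[OF M, of "norm v"] by simp
        moreover have "norm y \<le> M"
          by (simp add: M_def)
        ultimately show "norm (c i k j) \<le> ((if j = k then norm v else 1) * (if j = i then norm v else 1)) * M"
          using True yv by (auto simp: c_def a_def b_def)
      qed simp
      also have "\<dots> = M ^ m * (norm v * norm v)"
        using i k by (simp add: prod.distrib prod.delta)
      finally have "K * (\<Prod>j<m. norm (c i k j)) \<le> K * (M ^ m * (norm v * norm v))"
        using K(1) by simp
      with K(2)[of "c i k"] show ?thesis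
        by (simp add: mult.assoc)
    next
      case False
      then have "c i k k = 0"
        by (auto simp: c_def a_def b_def)
      then have z: "(\<Prod>j<m. norm (c i k j)) = 0"
        using k by (intro prod_zero) auto
      have "norm (A (c i k)) \<le> 0"
        using K(2)[of "c i k"] unfolding z by simp
      then show ?thesis
        using K(1) M by simp
    qed
    have "A (\<lambda>_. y + v) - A (\<lambda>_. y) = (\<Sum>i<m. A (a i))"
      using telescope[of "\<lambda>_. y + v" "\<lambda>_. y"] unfolding a_def add_diff_cancel_left' .
    then have "A (\<lambda>_. y + v) - A (\<lambda>_. y) - D v = (\<Sum>i<m. A (a i) - A (b i))"
      by (simp add: D_def b_def sum_subtractf)
    also have "\<dots> = (\<Sum>i<m. \<Sum>k<m. A (c i k))"
      by (simp only: telescope c_def)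
    also have "norm \<dots> \<le> (\<Sum>i<m. real m * (K * M ^ m * (norm v * norm v)))"
    proof (rule sum_norm_le)
      fix i assume i: "i \<in> {..<m}"
      have "norm (\<Sum>k<m. A (c i k)) \<le> (\<Sum>k<m. K * M ^ m * (norm v * norm v))"
        by (rule sum_norm_le) (use i nc in auto)
      then show "norm (\<Sum>k<m. A (c i k)) \<le> real m * (K * M ^ m * (norm v * norm v))"
        by simp
    qed
    finally show ?thesis
      by (simp add: mult_ac)
  qed
  ultimately have "((\<lambda>y. A (\<lambda>_. y)) has_derivative D) (at y)"
    unfolding has_derivative_at
  proof (intro conjI)
    show "(\<lambda>v. norm (A (\<lambda>_. y + v) - A (\<lambda>_. y) - D v) / norm v) \<midarrow>0\<rightarrow> 0"
    proof (rule Lim_null_comparison)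
      show "\<forall>\<^sub>F v in at 0. norm (norm (A (\<lambda>_. y + v) - A (\<lambda>_. y) - D v) / norm v) \<le> real m * (real m * (K * M ^ m)) * norm v"
        unfolding eventually_at
        using rem by (intro exI[of _ 1]) (auto simp: divide_le_eq)
      have "((\<lambda>v::'a. real m * (real m * (K * M ^ m)) * norm v) \<longlongrightarrow> real m * (real m * (K * M ^ m)) * norm (0::'a)) (at 0)"
        by (intro tendsto_intros)
      then show "((\<lambda>v::'a. real m * (real m * (K * M ^ m)) * norm v) \<longlongrightarrow> 0) (at 0)"
        by simp
    qed
  qed
  with D_scale show ?thesis
    unfolding complex_differentiable_at_def by blast
qed

end

lemma
  assumes "homogeneous_polynomial m Q"
  shows homogeneous_polynomial_scale: "Q (c *\<^sub>C y) = c ^ m *\<^sub>C Q y"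
    and homogeneous_polynomial_differentiable: "complex_differentiable_at Q y"
proof -
  obtain A where "bounded_multilinear m A" and Q: "Q = (\<lambda>y. A (\<lambda>_. y))"
    using assms unfolding homogeneous_polynomial_def by blast
  then interpret bounded_multilinear_map m A
    by unfold_locales
  show "Q (c *\<^sub>C y) = c ^ m *\<^sub>C Q y"
    unfolding Q by (rule diagonal_scale)
  show "complex_differentiable_at Q y"
    unfolding Q by (rule complex_differentiable_at_diagonal)
qed

text \<open>Homogeneity reduces the estimate to \<open>y / norm y\<close>. The separate case
  \<open>y = 0\<close> also covers the trivial space, where the supremum runs over the empty
  set.\<close>

lemma homogeneous_polynomial_norm_le:
  assumes Q: "homogeneous_polynomial m Q" and m: "1 \<le> m"
    and B: "(SUP y\<in>{y. norm y = 1}. ereal (norm (Q y))) \<le> ereal B"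
  shows "norm (Q y) \<le> B * norm y ^ m"
proof (cases "y = 0")
  case True
  have "Q (0 *\<^sub>C 0) = 0 ^ m *\<^sub>C Q 0"
    by (rule homogeneous_polynomial_scale[OF Q])
  then have "Q 0 = 0"
    using m by (simp add: scaleC_zero zero_power bounded_bilinear.zero_left[OF bounded_bilinear_scaleC])
  then show ?thesis
    using True m by (simp add: zero_power)
next
  case False
  define u where "u = complex_of_real (1 / norm y) *\<^sub>C y"
  have u: "norm u = 1"
    using False by (simp add: u_def norm_scaleC norm_divide)
  have "y = complex_of_real (norm y) *\<^sub>C u"
    using False by (simp add: u_def scaleC_scaleC scaleC_one flip: of_real_mult)
  then have "norm (Q y) = norm y ^ m * norm (Q u)"
    using homogeneous_polynomial_scale[OF Q, of "of_real (norm y)" u] by (simp add: norm_scaleC norm_power)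
  moreover have "ereal (norm (Q u)) \<le> ereal B"
    using B u by (intro order_trans[OF SUP_upper B]) auto
  ultimately show ?thesis
    by (simp add: mult.commute mult_right_mono)
qed

subsection \<open>The extended semigroup\<close>

text \<open>The quotient is the integral of \<open>exp (- z * s)\<close> over \<open>{0..t}\<close>,
  and the bound is the integral of its modulus.\<close>

lemma norm_one_minus_exp_divide_le:
  fixes z :: complex
  assumes z: "0 < Re z" and t: "0 \<le> t"
  shows "cmod ((1 - exp (- z * of_real t)) / z) \<le> (1 - exp (- Re z * t)) / Re z"
proof -
  have 1: "((\<lambda>s. - exp (- z * of_real s) / z) has_vector_derivative exp (- z * of_real s)) (at s within {0..t})" for s
    using z by (intro has_vector_derivative_real_field) (auto intro!: derivative_eq_intros)
  have 2: "((\<lambda>s. - exp (- Re z * s) / Re z) has_vector_derivative exp (- Re z * s)) (at s within {0..t})" for s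
    unfolding has_real_derivative_iff_has_vector_derivative[symmetric]
    using z by (auto intro!: derivative_eq_intros)
  have I1: "((\<lambda>s. exp (- z * of_real s)) has_integral (- exp (- z * of_real t) / z - - exp (- z * of_real 0) / z)) {0..t}"
    by (rule fundamental_theorem_of_calculus[OF t 1])
  have I2: "((\<lambda>s. exp (- Re z * s)) has_integral (- exp (- Re z * t) / Re z - - exp (- Re z * 0) / Re z)) {0..t}"
    by (rule fundamental_theorem_of_calculus[OF t 2])
  have "norm (integral {0..t} (\<lambda>s. exp (- z * of_real s))) \<le> integral {0..t} (\<lambda>s. exp (- Re z * s))"
    by (rule integral_norm_bound_integral)
       (use I1 I2 in \<open>auto simp: has_integral_integrable norm_exp_eq_Re\<close>)
  then show ?thesis
    unfolding integral_unique[OF I1] integral_unique[OF I2] by (simp add: diff_divide_distrib)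
qed

section \<open>Action of the semigroup on the range of its Koenigs function\<close>

locale koenigs_semigroup = disc_semigroup F f + univalent_disc h l
  for F f h l +
  fixes \<mu> :: complex
  assumes h_eq: "\<And>z. cmod z < 1 \<Longrightarrow> deriv h z * f z = \<mu> * h z"
begin

lemma h_F: "cmod z < 1 \<Longrightarrow> 0 \<le> t \<Longrightarrow> h (F t z) = exp (- \<mu> * of_real t) * h z"
  by (rule eigenfunction[OF h_hol h_eq])

text \<open>\<open>F t\<close> becomes multiplication by \<open>exp (- \<mu> * t)\<close> on the
  range of \<open>h\<close>. This maps the range into itself, so the inequality is the monotonicity
  of the conformal radius, which amounts to Schwarz-Pick for \<open>F t\<close>.\<close>

lemma radius_F:
  assumes z: "cmod z < 1" and t: "0 \<le> t"
  shows "exp (- Re \<mu> * t) * radius z \<le> radius (F t z)"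
proof -
  have Fz: "cmod (F t z) < 1"
    by (rule maps[OF t z])
  have dF: "(F t has_field_derivative deriv (F t) z) (at z)"
    using holomorphic_derivI[OF holomorphic[OF t]] z by simp
  have "((\<lambda>z. h (F t z)) has_field_derivative deriv h (F t z) * deriv (F t) z) (at z)"
    by (rule DERIV_chain2[OF h_deriv[OF Fz] dF])
  moreover have "((\<lambda>z. h (F t z)) has_field_derivative exp (- \<mu> * of_real t) * deriv h z) (at z)"
    by (rule has_field_derivative_transform_within_open[OF DERIV_cmult[OF h_deriv[OF z]], of "ball 0 1"])
       (use z h_F t in auto)
  ultimately have "deriv h (F t z) * deriv (F t) z = exp (- \<mu> * of_real t) * deriv h z"
    by (rule DERIV_unique)
  then have "cmod (deriv h (F t z)) * cmod (deriv (F t) z) = exp (- Re \<mu> * t) * cmod (deriv h z)"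
    unfolding norm_mult[symmetric] by (simp add: norm_mult norm_exp_eq_Re)
  then have "exp (- Re \<mu> * t) * radius z = cmod (deriv h (F t z)) * (cmod (deriv (F t) z) * (1 - (cmod z)\<^sup>2))"
    unfolding radius_def by (simp add: mult.assoc[symmetric])
  also have "\<dots> \<le> radius (F t z)"
    unfolding radius_def using Schwarz_Pick_deriv[OF holomorphic[OF t] maps[OF t] z]
    by (intro mult_left_mono) auto
  finally show ?thesis .
qed

lemma f_deriv:
  assumes z: "cmod z < 1"
  shows "(f has_field_derivative \<mu> - deriv l z * f z) (at z)"
proof -
  have f_eq: "f z = \<mu> * (h z * exp (- l z))" if "cmod z < 1" for z
    using h_eq[OF that] exp_l[OF that] deriv_h_nonzero[OF that] by (simp add: exp_minus field_simps)
  have "((\<lambda>z. h z * exp (- l z)) has_field_derivative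
      deriv h z * exp (- l z) + (exp (- l z) * (- deriv l z)) * h z) (at z)"
    by (intro DERIV_mult h_deriv z DERIV_chain2[OF DERIV_exp] DERIV_minus l_deriv)
  from DERIV_cmult[OF this, of \<mu>]
  have "(f has_field_derivative \<mu> * (deriv h z * exp (- l z) + (exp (- l z) * (- deriv l z)) * h z)) (at z)"
    by (rule has_field_derivative_transform_within_open[of _ _ _ "ball 0 1"]) (use z f_eq in auto)
  moreover have "deriv h z * exp (- l z) = 1"
    using exp_l[OF z] by (simp add: exp_minus field_simps exp_not_eq_zero flip: exp_l[OF z])
  then have "\<mu> * (deriv h z * exp (- l z) + (exp (- l z) * (- deriv l z)) * h z) = \<mu> - deriv l z * f z"
    unfolding f_eq[OF z] by (simp add: algebra_simps)
  ultimately show ?thesis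
    by simp
qed

end

section \<open>The explicit flow on the ball and its generator\<close>

locale extended_semigroup = koenigs_semigroup F f h l \<mu>
  for F f h l \<mu> +
  fixes r :: nat and lam :: complex and Q :: "'y::complex_banach \<Rightarrow> complex"
  assumes r: "1 \<le> r" and lam: "0 < Re lam" and Q: "homogeneous_polynomial r Q"
    and Q_le: "\<And>y. cmod (Q y) \<le> real r * Re lam / 4 * norm y ^ r"
begin

text \<open>Along a trajectory of the system, \<open>h x - deriv h x * Q y / (r * lam)\<close> is multiplied by \<open>exp (- \<mu> * t)\<close> and
  \<open>deriv h x * Q y\<close> is multiplied by \<open>exp (- (\<mu> + r * lam) * t)\<close>. This determines \<open>h\<close> at the first component.\<close>

definition shift :: "real \<Rightarrow> complex" where
  "shift t = (1 - exp (- (of_nat r * lam) * of_real t)) / (of_nat r * lam)"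

definition base :: "real \<Rightarrow> complex \<times> 'y \<Rightarrow> complex" where
  "base t p = exp (- \<mu> * of_real t) * (h (fst p) - deriv h (fst p) * Q (snd p) * shift t)"

definition first :: "real \<Rightarrow> complex \<times> 'y \<Rightarrow> complex" where
  "first t p = h_inv (base t p)"

text \<open>The invariance of \<open>deriv h x * Q y\<close> up to its exponential prescribes only
  the \<open>r\<close>-th power of the multiplier of \<open>y\<close>. Writing it through the
  logarithm \<open>l\<close> of \<open>h'\<close> selects the root that is holomorphic in
  \<open>p\<close> and equals 1 at \<open>t = 0\<close>.\<close>

definition factor :: "real \<Rightarrow> complex \<times> 'y \<Rightarrow> complex" where
  "factor t p = exp (- (\<mu> / of_nat r + lam) * of_real t + (l (fst p) - l (first t p)) / of_nat r)"

definition flow :: "real \<Rightarrow> complex \<times> 'y \<Rightarrow> complex \<times> 'y" where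
  "flow t p = (first t p, factor t p *\<^sub>C snd p)"

lemma r_lam: "of_nat r * lam \<noteq> 0" "(of_nat r :: complex) \<noteq> 0"
  using r lam by auto

lemma fst_lt: "p \<in> unit_domain r \<Longrightarrow> cmod (fst p) < 1"
proof -
  assume "p \<in> unit_domain r"
  then have "(cmod (fst p))\<^sup>2 + norm (snd p) ^ r < 1"
    by (auto simp: unit_domain_def)
  moreover have "0 \<le> norm (snd p) ^ r"
    by simp
  ultimately have "(cmod (fst p))\<^sup>2 < 1"
    by linarith
  then show ?thesis
    by (simp add: abs_square_less_1)
qed

lemma factor_power:
  "factor t p ^ r = exp (- (\<mu> + of_nat r * lam) * of_real t + (l (fst p) - l (first t p)))"
proof -
  have "of_nat r * (- (\<mu> / of_nat r + lam) * of_real t + (l (fst p) - l (first t p)) / of_nat r)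
      = - (\<mu> + of_nat r * lam) * of_real t + (l (fst p) - l (first t p))"
    using r_lam(2) by (simp add: field_simps)
  then show ?thesis
    unfolding factor_def exp_of_nat_mult[symmetric] by (rule arg_cong)
qed

text \<open>The displacement \<open>v\<close> satisfies \<open>4 * cmod v \<le> a * (1 - q)\<close>
  with \<open>a < radius x\<close>. Koebe distortion keeps \<open>h x + v\<close> in the range and
  leaves there a radius above \<open>a * q\<close>. Multiplication by
  \<open>exp (- \<mu> * t)\<close> is then supplied by \<open>F t\<close>, and
  \<open>radius_F\<close> transports the inequality.\<close>

lemma flow_props:
  assumes p: "p \<in> unit_domain r" and t: "0 \<le> t"
  shows base_in_range: "base t p \<in> h ` ball 0 1"
    and flow_in_domain: "flow t p \<in> unit_domain r"
proof -
  obtain x y where xy: "p = (x, y)" by (cases p)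
  have x: "cmod x < 1"
    using fst_lt[OF p] xy by simp
  have fst_p: "fst p = x" and snd_p: "snd p = y"
    using xy by simp_all
  define a where "a = cmod (deriv h x) * norm y ^ r"
  define q where "q = exp (- (real r * Re lam) * t)"
  define v where "v = - (deriv h x * Q y * shift t)"
  have q: "0 < q" "q \<le> 1"
    using r lam t by (auto simp: q_def)
  have a0: "0 \<le> a"
    by (simp add: a_def)
  have "norm y ^ r < 1 - (cmod x)\<^sup>2"
    using p xy by (simp add: unit_domain_def)
  then have a_less: "a < radius x"
    unfolding a_def radius_def using deriv_h_nonzero[OF x] by (intro mult_strict_left_mono) auto
  have rl: "0 < real r * Re lam"
    using r lam by simp
  have "cmod (shift t) \<le> (1 - q) / (real r * Re lam)"
    using norm_one_minus_exp_divide_le[of "of_nat r * lam" t] rl t by (simp add: shift_def q_def)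
  then have "cmod v \<le> cmod (deriv h x) * (real r * Re lam / 4 * norm y ^ r) * ((1 - q) / (real r * Re lam))"
    unfolding v_def norm_minus_cancel norm_mult using rl q
    by (intro mult_mono mult_left_mono Q_le) auto
  also have "\<dots> = a * (1 - q) / 4"
  proof -
    have "c * (R / 4 * n) * ((1 - q) / R) = c * n * (1 - q) / 4" if "0 < R" for c R n :: real
      using that by simp
    then show ?thesis
      using rl unfolding a_def by blast
  qed
  finally have v4: "4 * cmod v \<le> a * (1 - q)"
    by simp
  also have "\<dots> \<le> a"
    using a0 q by (simp add: mult_left_le)
  also note a_less
  finally have vR: "4 * cmod v < radius x" .
  note K = Koebe_distortion[OF x vR]
  \<comment> \<open>The flow is split: first the displacement by \<open>v\<close> at the level of
    \<open>h\<close>, then \<open>F t\<close> applied to the point \<open>x1\<close> so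
    reached.\<close>
  define x1 where "x1 = h_inv (h x + v)"
  have x1: "cmod x1 < 1" "h x1 = h x + v"
    unfolding x1_def using h_inv[OF K(1)] by auto
  have "a * q < radius x1"
    using K(2) v4 a_less unfolding x1_def[symmetric] by (simp add: algebra_simps)
  have b: "base t p = h (F t x1)"
    using h_F[OF x1(1) t] by (simp add: base_def xy x1(2) v_def)
  have Fx: "cmod (F t x1) < 1"
    by (rule maps[OF t x1(1)])
  show "base t p \<in> h ` ball 0 1"
    unfolding b using Fx by simp
  have f1: "first t p = F t x1"
    unfolding first_def b by (rule h_inv_h[OF Fx])
  have "cmod (factor t p) ^ r = exp (- Re \<mu> * t) * q * (cmod (deriv h x) / cmod (deriv h (F t x1)))"
    unfolding norm_power[symmetric] factor_power f1 fst_p exp_add exp_diff exp_l[OF x] exp_l[OF Fx]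
    by (simp add: norm_mult norm_divide norm_exp_eq_Re q_def exp_add[symmetric] algebra_simps)
  then have "norm (factor t p *\<^sub>C y) ^ r = exp (- Re \<mu> * t) * (a * q) / cmod (deriv h (F t x1))"
    unfolding norm_scaleC power_mult_distrib a_def by simp
  also have "\<dots> < exp (- Re \<mu> * t) * radius x1 / cmod (deriv h (F t x1))"
    using \<open>a * q < radius x1\<close> deriv_h_nonzero[OF Fx] by (intro divide_strict_right_mono mult_strict_left_mono) auto
  also have "\<dots> \<le> radius (F t x1) / cmod (deriv h (F t x1))"
    by (intro divide_right_mono radius_F x1 t) auto
  also have "\<dots> = 1 - (cmod (F t x1))\<^sup>2"
    using deriv_h_nonzero[OF Fx] by (simp add: radius_def)
  finally show "flow t p \<in> unit_domain r"
    by (simp add: flow_def f1 snd_p unit_domain_def)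
qed

lemma first_props:
  assumes "p \<in> unit_domain r" "0 \<le> t"
  shows "cmod (first t p) < 1" "h (first t p) = base t p"
  unfolding first_def using h_inv[OF base_in_range[OF assms]] by auto

lemma Q_flow:
  assumes p: "p \<in> unit_domain r" and t: "0 \<le> t"
  shows "deriv h (fst (flow t p)) * Q (snd (flow t p))
    = exp (- (\<mu> + of_nat r * lam) * of_real t) * (deriv h (fst p) * Q (snd p))"
  unfolding flow_def fst_conv snd_conv homogeneous_polynomial_scale[OF Q] factor_power
    exp_l[OF first_props(1)[OF p t], symmetric] exp_l[OF fst_lt[OF p], symmetric]
  by (simp add: scaleC_complex_def exp_add exp_diff)

text \<open>The exponential integral obeys \<open>shift (t + s) = shift s + E s * shift t\<close>,
  and \<open>E s\<close> is the factor that \<open>Q_flow\<close> contributes beyond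
  \<open>exp (- \<mu> * s)\<close>. For the second component the differences of \<open>l\<close>
  telescope.\<close>

lemma flow_add:
  assumes p: "p \<in> unit_domain r" and t: "0 \<le> t" and s: "0 \<le> s"
  shows "flow (t + s) p = flow t (flow s p)"
proof -
  define E where "E u = exp (- (of_nat r * lam) * of_real u)" for u
  have Eadd: "E (t + s) = E t * E s"
    by (simp add: E_def exp_add[symmetric] algebra_simps)
  have "shift (t + s) = shift s + E s * shift t"
    using r_lam(1) unfolding shift_def E_def[symmetric] Eadd by (simp add: divide_simps) (simp add: algebra_simps)
  moreover have "base t (flow s p) = exp (- \<mu> * of_real t) *
      (base s p - exp (- (\<mu> + of_nat r * lam) * of_real s) * (deriv h (fst p) * Q (snd p)) * shift t)"
    unfolding base_def[of t] Q_flow[OF p s] using first_props(2)[OF p s] by (simp add: flow_def)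
  moreover have "exp (- (\<mu> + of_nat r * lam) * of_real s) = exp (- \<mu> * of_real s) * E s"
    by (simp add: E_def exp_add[symmetric] algebra_simps)
  moreover have "exp (- \<mu> * of_real (t + s)) = exp (- \<mu> * of_real t) * exp (- \<mu> * of_real s)"
    by (simp add: exp_add[symmetric] algebra_simps)
  ultimately have "base (t + s) p = base t (flow s p)"
    unfolding base_def by (simp only:) (simp add: algebra_simps)
  then have 1: "first (t + s) p = first t (flow s p)"
    by (simp add: first_def)
  have 2: "factor (t + s) p = factor t (flow s p) * factor s p"
    unfolding factor_def 1 exp_add[symmetric] using r_lam(2)
    by (intro arg_cong[of _ _ exp]) (simp add: flow_def add_divide_distrib diff_divide_distrib algebra_simps)
  have "snd (flow s p) = factor s p *\<^sub>C snd p"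
    by (simp add: flow_def)
  then show ?thesis
    by (simp only: flow_def[of "t + s"] flow_def[of t] 1 2 scaleC_scaleC)
qed

lemma flow_0: "p \<in> unit_domain r \<Longrightarrow> flow 0 p = p"
  using h_inv_h[OF fst_lt, of p] by (simp add: flow_def first_def factor_def base_def shift_def scaleC_one)

lemma holomorphic_flow:
  assumes t: "0 \<le> t"
  shows "holomorphic_map_on (flow t) (unit_domain r)"
proof (rule complex_differentiable_at_imp_holomorphic_map)
  fix p :: "complex \<times> 'y" assume p: "p \<in> unit_domain r"
  have x: "cmod (fst p) < 1"
    by (rule fst_lt[OF p])
  have comp: "complex_differentiable_at (\<lambda>p :: complex \<times> 'y. k (fst p)) p"
    if "(k has_field_derivative k') (at (fst p))" for k :: "complex \<Rightarrow> complex" and k'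
    using that by (intro complex_differentiable_at_compose[OF complex_differentiable_at_fst complex_differentiable_at_field])
  have dh: "(deriv h has_field_derivative deriv (deriv h) (fst p)) (at (fst p))"
    using holomorphic_derivI[OF holomorphic_deriv[OF h_hol]] x by simp
  have Qd: "complex_differentiable_at (\<lambda>p :: complex \<times> 'y. Q (snd p)) p"
    by (intro complex_differentiable_at_compose[OF complex_differentiable_at_snd homogeneous_polynomial_differentiable[OF Q]])
  have base_d: "complex_differentiable_at (base t) p"
    unfolding base_def
    by (intro complex_differentiable_at_mult complex_differentiable_at_const complex_differentiable_at_diff
        comp[OF h_deriv[OF x]] comp[OF dh] Qd)
  have first_d: "complex_differentiable_at (first t) p"
    unfolding first_def
    by (rule complex_differentiable_at_compose[OF base_d complex_differentiable_at_field[OF h_inv_deriv[OF base_in_range[OF p t]]]])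
  have "complex_differentiable_at (\<lambda>p. l (fst p) - l (first t p)) p"
    by (intro complex_differentiable_at_diff comp[OF l_deriv[OF x]]
        complex_differentiable_at_compose[OF first_d complex_differentiable_at_field[OF l_deriv[OF first_props(1)[OF p t]]]])
  moreover have "((\<lambda>z. exp (- (\<mu> / of_nat r + lam) * of_real t + z / of_nat r)) has_field_derivative
      exp (- (\<mu> / of_nat r + lam) * of_real t + z / of_nat r) * (1 / of_nat r)) (at z)" for z
    using r_lam(2) by (auto intro!: derivative_eq_intros)
  ultimately have factor_d: "complex_differentiable_at (factor t) p"
    unfolding factor_def
    by (rule complex_differentiable_at_compose[where k = "\<lambda>z. exp (- (\<mu> / of_nat r + lam) * of_real t + z / of_nat r)",
        OF _ complex_differentiable_at_field])
  show "complex_differentiable_at (flow t) p"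
    unfolding flow_def
    by (intro complex_differentiable_at_Pair complex_differentiable_at_scaleC first_d factor_d complex_differentiable_at_snd)
qed

lemma flow_deriv_0:
  assumes p: "p \<in> unit_domain r"
  shows "((\<lambda>t. flow t p) has_vector_derivative
     (- (f (fst p) + Q (snd p)),
      (- (\<mu> / of_nat r + lam) + deriv l (fst p) * (f (fst p) + Q (snd p)) / of_nat r) *\<^sub>C snd p)) (at_right 0)"
proof -
  obtain x y where xy: "p = (x, y)" by (cases p)
  have x: "cmod x < 1"
    using fst_lt[OF p] xy by simp
  have hx: "deriv h x \<noteq> 0"
    by (rule deriv_h_nonzero[OF x])
  have factor_eq: "factor t p = exp (- (\<mu> / of_nat r + lam) * of_real t + (l x - l (first t p)) * (1 / of_nat r))" for t
    by (simp add: factor_def xy)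
  have base0: "base 0 p = h x" and first0: "first 0 p = x"
    using h_inv_h[OF x] by (simp_all add: first_def base_def shift_def xy)
  have "((\<lambda>z. exp (- \<mu> * z) * (h x - deriv h x * Q y * ((1 - exp (- (of_nat r * lam) * z)) / (of_nat r * lam))))
      has_field_derivative (- \<mu> * h x - deriv h x * Q y)) (at (of_real 0))"
    using r_lam by (auto intro!: derivative_eq_intros)
  then have "((\<lambda>t. base t p) has_vector_derivative (- \<mu> * h x - deriv h x * Q y)) (at_right 0)"
    unfolding base_def shift_def xy fst_conv snd_conv by (rule has_vector_derivative_real_field)
  moreover have "(h_inv has_field_derivative 1 / deriv h x) (at (base 0 p))"
    using h_inv_deriv[OF base_in_range[OF p order_refl]] by (simp add: base0 h_inv_h[OF x])
  ultimately have "((\<lambda>t. first t p) has_vector_derivative (- \<mu> * h x - deriv h x * Q y) * (1 / deriv h x)) (at_right 0)"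
    unfolding first_def using field_vector_diff_chain_within has_field_derivative_at_within unfolding o_def by fast
  moreover have "(- \<mu> * h x - deriv h x * Q y) * (1 / deriv h x) = - (f x + Q y)"
    using h_eq[OF x] hx by (simp add: field_simps)
  ultimately have d1: "((\<lambda>t. first t p) has_vector_derivative - (f x + Q y)) (at_right 0)"
    by simp
  have "(l has_field_derivative deriv l x) (at (first 0 p))"
    unfolding first0 by (rule l_deriv[OF x])
  with d1 have "((\<lambda>t. l (first t p)) has_vector_derivative - (f x + Q y) * deriv l x) (at_right 0)"
    using field_vector_diff_chain_within has_field_derivative_at_within unfolding o_def by fast
  then have "((\<lambda>t. - (\<mu> / of_nat r + lam) * of_real t + (l x - l (first t p)) * (1 / of_nat r)) has_vector_derivative
      - (\<mu> / of_nat r + lam) + (0 - (- (f x + Q y) * deriv l x)) * (1 / of_nat r)) (at_right 0)"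
    by (intro has_vector_derivative_add has_vector_derivative_mult_left has_vector_derivative_diff
        has_vector_derivative_const has_vector_derivative_real_field) (auto intro!: derivative_eq_intros)
  moreover have "(exp has_field_derivative 1) (at (- (\<mu> / of_nat r + lam) * of_real 0 + (l x - l (first 0 p)) * (1 / of_nat r)))"
    unfolding first0 using DERIV_exp[of 0] by simp
  ultimately have "((\<lambda>t. factor t p) has_vector_derivative
      (- (\<mu> / of_nat r + lam) + (0 - (- (f x + Q y) * deriv l x)) * (1 / of_nat r)) * 1) (at_right 0)"
    unfolding factor_eq
    using field_vector_diff_chain_within has_field_derivative_at_within unfolding o_def by fast
  then have d2: "((\<lambda>t. factor t p) has_vector_derivative
      (- (\<mu> / of_nat r + lam) + deriv l x * (f x + Q y) / of_nat r)) (at_right 0)"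
    by (simp add: algebra_simps add_divide_distrib)
  have "bounded_linear (\<lambda>c. c *\<^sub>C y)"
    by (rule bounded_bilinear.bounded_linear_left[OF bounded_bilinear_scaleC])
  from has_vector_derivative_Pair[OF d1 bounded_linear.has_vector_derivative[OF this d2]]
  show ?thesis
    unfolding flow_def by (simp add: xy)
qed

lemma generator_flow:
  assumes g: "\<And>p. p \<in> unit_domain r \<Longrightarrow> g p = (f (fst p) + Q (snd p),
      ((\<mu> / of_nat r + lam) - deriv l (fst p) * (f (fst p) + Q (snd p)) / of_nat r) *\<^sub>C snd p)"
  shows "generator_of_on g flow (unit_domain r)"
  unfolding generator_of_on_def continuous_semigroup_on_def
proof (intro conjI allI impI ballI)
  fix p :: "complex \<times> 'y" assume p: "p \<in> unit_domain r"
  have "((\<lambda>t. (1 / t) *\<^sub>R (flow t p - p)) \<longlongrightarrow> - g p) (at_right 0)"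
  proof -
    have "(- c) *\<^sub>C y = - (c *\<^sub>C y)" for c and y :: 'y
      by (rule bounded_bilinear.minus_left[OF bounded_bilinear_scaleC])
    note * = this[of "(\<mu> / of_nat r + lam) - deriv l (fst p) * (f (fst p) + Q (snd p)) / of_nat r" "snd p"]
    have "- g p = (- (f (fst p) + Q (snd p)),
      (- (\<mu> / of_nat r + lam) + deriv l (fst p) * (f (fst p) + Q (snd p)) / of_nat r) *\<^sub>C snd p)"
    proof -
      have "- (a - b) = - a + b" for a b :: complex
        by simp
      with * show ?thesis
        unfolding g[OF p] uminus_prod_def fst_conv snd_conv by metis
    qed
    then show ?thesis
      using flow_deriv_0[OF p] unfolding has_vector_derivative_at_right_0_iff flow_0[OF p] by simp
  qed
  then have q: "((\<lambda>t. - ((1 / t) *\<^sub>R (flow t p - p))) \<longlongrightarrow> - (- g p)) (at_right 0)"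
    by (rule tendsto_minus)
  then show "((\<lambda>t. (1 / t) *\<^sub>R (p - flow t p)) \<longlongrightarrow> g p) (at_right 0)"
    by (simp add: scaleR_diff_right)
  \<comment> \<open>Continuity at time 0 follows from the existence of the generator:
    \<open>flow t p\<close> is \<open>p\<close> minus \<open>t\<close> times a convergent
    quotient.\<close>
  have "((\<lambda>t. p - t *\<^sub>R (- ((1 / t) *\<^sub>R (flow t p - p)))) \<longlongrightarrow> p - 0 *\<^sub>R (- (- g p))) (at_right 0)"
    by (intro tendsto_intros q)
  moreover have "\<forall>\<^sub>F t in at_right 0. p - t *\<^sub>R (- ((1 / t) *\<^sub>R (flow t p - p))) = flow t p"
    by (rule eventually_mono[OF eventually_at_right_less[of 0]]) simp
  ultimately show "((\<lambda>t. flow t p) \<longlongrightarrow> p) (at_right 0)"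
    by (simp add: filterlim_cong)
qed (use holomorphic_flow flow_in_domain flow_add in auto)

end

subsection \<open>Koenigs functions of semigroups\<close>

text \<open>Otherwise the image would be open, and a point of it with real part at most 0 would have
  image points strictly to its left.\<close>

lemma half_plane_constant:
  fixes P :: "complex \<Rightarrow> complex"
  assumes hol: "P holomorphic_on ball 0 1" and nn: "\<And>z. cmod z < 1 \<Longrightarrow> 0 \<le> Re (P z)"
    and z: "cmod z < 1" "Re (P z) \<le> 0"
  shows "P constant_on ball 0 1"
proof (rule ccontr)
  assume "\<not> ?thesis"
  then have "open (P ` ball 0 1)"
    by (intro open_mapping_thm[OF hol] open_ball connected_ball subset_refl)
  moreover have "P z \<in> P ` ball 0 1"
    using z by simp
  ultimately obtain e where e: "0 < e" "ball (P z) e \<subseteq> P ` ball 0 1"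
    by (rule openE)
  have "P z - of_real (e / 2) \<in> ball (P z) e"
    using e by (simp add: dist_norm)
  then have "P z - of_real (e / 2) \<in> P ` ball 0 1"
    using e(2) by (rule subsetD[rotated])
  then obtain w where w: "cmod w < 1" "P w = P z - of_real (e / 2)"
    by (metis imageE mem_ball_0)
  have "Re (P w) < 0"
    unfolding w(2) using z e by simp
  with nn[OF w(1)] show False
    by linarith
qed

lemma null_point_deriv:
  fixes P :: "complex \<Rightarrow> complex" and \<tau> z :: complex
  assumes P: "(P has_field_derivative P') (at z)"
  shows "((\<lambda>z. (z - \<tau>) * (1 - cnj \<tau> * z) * P z) has_field_derivative
    (1 - cnj \<tau> * z) * P z - cnj \<tau> * (z - \<tau>) * P z + (z - \<tau>) * (1 - cnj \<tau> * z) * P') (at z)"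
proof -
  have "((\<lambda>z. (z - \<tau>) * (1 - cnj \<tau> * z)) has_field_derivative
      1 * (1 - cnj \<tau> * z) + (- cnj \<tau>) * (z - \<tau>)) (at z)"
    by (intro DERIV_mult) (auto intro!: derivative_eq_intros)
  from DERIV_mult[OF this P] show ?thesis
    by (rule DERIV_cong) (simp add: algebra_simps)
qed

text \<open>The defining equation gives \<open>deriv l * f = \<mu> - deriv f\<close> for \<open>l = ln (deriv h)\<close>. At a zero of \<open>f\<close> the
  estimate for \<open>deriv l\<close> follows by continuity.\<close>

lemma koenigs_semigroup_intro:
  fixes f h :: "complex \<Rightarrow> complex" and \<mu> \<tau> :: complex
  assumes "disc_semigroup F f"
    and h_hol: "h holomorphic_on ball 0 1" and h_inj: "inj_on h (ball 0 1)"
    and h_eq: "\<And>z. cmod z < 1 \<Longrightarrow> deriv h z * f z = \<mu> * h z"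
    and f_hol: "f holomorphic_on ball 0 1"
    and zero: "\<And>z. cmod z < 1 \<Longrightarrow> f z = 0 \<Longrightarrow> z = \<tau>"
    and bound: "\<And>z. cmod z < 1 \<Longrightarrow> cmod ((1 - (cmod z)\<^sup>2) * (\<mu> - deriv f z) - 2 * cnj z * f z) \<le> 4 * cmod (f z)"
  obtains l where "koenigs_semigroup F f h l \<mu>"
proof -
  have h'_hol: "deriv h holomorphic_on ball 0 1"
    by (rule holomorphic_deriv[OF h_hol]) simp
  obtain l where l: "l holomorphic_on ball 0 1" "\<And>z. z \<in> ball 0 1 \<Longrightarrow> exp (l z) = deriv h z"
    using holomorphic_logarithm_exists[of "ball 0 1" "deriv h" 0]
      h'_hol holomorphic_injective_imp_regular[OF h_hol _ h_inj] by auto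
  have l': "deriv l z * f z = \<mu> - deriv f z" if z: "cmod z < 1" for z
  proof -
    have d: "(g has_field_derivative deriv g z) (at z)" if "g holomorphic_on ball 0 1" for g :: "complex \<Rightarrow> complex"
      using holomorphic_derivI[OF that] z by simp
    have "((\<lambda>z. exp (l z)) has_field_derivative exp (l z) * deriv l z) (at z)"
      by (intro DERIV_chain2[OF DERIV_exp] d l)
    then have "(deriv h has_field_derivative exp (l z) * deriv l z) (at z)"
      by (rule has_field_derivative_transform_within_open[of _ _ _ "ball 0 1"]) (use z l in auto)
    from DERIV_mult[OF this d[OF f_hol]]
    have "((\<lambda>z. deriv h z * f z) has_field_derivative exp (l z) * deriv l z * f z + deriv f z * deriv h z) (at z)" .
    moreover have "((\<lambda>z. deriv h z * f z) has_field_derivative \<mu> * deriv h z) (at z)"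
      by (rule has_field_derivative_transform_within_open[OF DERIV_cmult[OF d[OF h_hol]], of "ball 0 1"])
         (use z h_eq in auto)
    ultimately have "exp (l z) * deriv l z * f z + deriv f z * deriv h z = \<mu> * deriv h z"
      by (rule DERIV_unique)
    then have "exp (l z) * (deriv l z * f z) = exp (l z) * (\<mu> - deriv f z)"
      using l(2)[of z] z by (simp add: algebra_simps)
    then show ?thesis
      by simp
  qed
  have est: "cmod ((1 - (cmod z)\<^sup>2) * deriv l z - 2 * cnj z) \<le> 4" if z: "cmod z < 1" "z \<noteq> \<tau>" for z
  proof -
    have f0: "0 < cmod (f z)"
      using zero[OF z(1)] z(2) by auto
    have "cmod ((1 - (cmod z)\<^sup>2) * deriv l z - 2 * cnj z) * cmod (f z)
        = cmod ((1 - (cmod z)\<^sup>2) * (deriv l z * f z) - 2 * cnj z * f z)"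
      unfolding norm_mult[symmetric] by (simp add: algebra_simps)
    also have "\<dots> \<le> 4 * cmod (f z)"
      unfolding l'[OF z(1)] by (rule bound[OF z(1)])
    finally show ?thesis
      using f0 by simp
  qed
  have "koenigs_semigroup F f h l \<mu>"
  proof -
    interpret disc_semigroup F f by fact
    show ?thesis
    proof unfold_locales
      fix z :: complex assume z: "cmod z < 1"
      show "exp (l z) = deriv h z"
        using l(2) z by simp
      show "deriv h z * f z = \<mu> * h z"
        by (rule h_eq[OF z])
      show "cmod ((1 - (cmod z)\<^sup>2) * deriv l z - 2 * cnj z) \<le> 4"
      proof (rule tendsto_upperbound)
        have "isCont (deriv l) z"
          using holomorphic_on_imp_continuous_on[OF holomorphic_deriv[OF l(1)]] z
          by (simp add: continuous_on_eq_continuous_at)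
        then have "isCont (\<lambda>z. cmod ((1 - (cmod z)\<^sup>2) * deriv l z - 2 * cnj z)) z"
          by (intro continuous_intros)
        then show "((\<lambda>z. cmod ((1 - (cmod z)\<^sup>2) * deriv l z - 2 * cnj z)) \<longlongrightarrow>
            cmod ((1 - (cmod z)\<^sup>2) * deriv l z - 2 * cnj z)) (at z)"
          by (simp add: isCont_def)
        have "\<forall>\<^sub>F w in at z. w \<in> ball 0 1 - {z}"
          by (rule eventually_at_in_open) (use z in auto)
        moreover have "\<forall>\<^sub>F w in at z. w \<noteq> \<tau>"
          by (rule eventually_neq_at_within)
        ultimately show "\<forall>\<^sub>F w in at z. cmod ((1 - (cmod w)\<^sup>2) * deriv l w - 2 * cnj w) \<le> 4"
          by eventually_elim (use est in auto)
      qed simp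
    qed (use h_hol h_inj l in auto)
  qed
  then show ?thesis
    by (rule that)
qed

text \<open>\<open>P\<close> is a nonzero constant or has positive real part; the factor \<open>e\<close> covers both cases.\<close>

lemma koenigs_dilation:
  fixes \<tau> \<mu> :: complex
  assumes "dw_semigroup F f \<tau>" and \<tau>: "cmod \<tau> < 1" and f': "(f has_field_derivative \<mu>) (at \<tau>)"
  obtains h l where "koenigs_semigroup F f h l \<mu>"
proof -
  interpret dw_semigroup F f \<tau> by fact
  obtain P where P: "P holomorphic_on ball 0 1" "\<And>z. cmod z < 1 \<Longrightarrow> 0 \<le> Re (P z)"
    "\<And>z. cmod z < 1 \<Longrightarrow> f z = (z - \<tau>) * (1 - cnj \<tau> * z) * P z"
    using Berkson_Porta by blast
  have P_deriv: "(P has_field_derivative deriv P z) (at z)" if "cmod z < 1" for z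
    using holomorphic_derivI[OF P(1)] that by simp
  have f_deriv: "(f has_field_derivative
      (1 - cnj \<tau> * z) * P z - cnj \<tau> * (z - \<tau>) * P z + (z - \<tau>) * (1 - cnj \<tau> * z) * deriv P z) (at z)"
    if "cmod z < 1" for z
    by (rule has_field_derivative_transform_within_open[OF null_point_deriv[OF P_deriv[OF that]], of "ball 0 1"])
       (use that P(3) in auto)
  have f_hol: "f holomorphic_on ball 0 1"
    by (rule holomorphic_transform[of "\<lambda>z. (z - \<tau>) * (1 - cnj \<tau> * z) * P z"])
       (use P in \<open>auto intro!: holomorphic_intros\<close>)
  have "\<mu> = (1 - cnj \<tau> * \<tau>) * P \<tau>"
    using DERIV_unique[OF f' f_deriv[OF \<tau>]] by simp
  also have "1 - cnj \<tau> * \<tau> = of_real (1 - (cmod \<tau>)\<^sup>2)"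
    unfolding of_real_diff of_real_1 complex_norm_square by (simp add: mult.commute)
  finally have \<mu>: "\<mu> = of_real (1 - (cmod \<tau>)\<^sup>2) * P \<tau>" .
  obtain e where e: "\<And>z. cmod z < 1 \<Longrightarrow> 0 < Re (e / P z)"
  proof (cases "P constant_on ball 0 1")
    case True
    then obtain c where c: "\<And>z. cmod z < 1 \<Longrightarrow> P z = c"
      unfolding constant_on_def by auto
    obtain w where w: "cmod w < 1" "w \<noteq> \<tau>"
      by (cases "\<tau> = 0") (auto intro: that[of 0] that[of "1/2"])
    have "f w \<noteq> 0"
      using generator_zero_imp_dw[OF w(1)] w(2) by blast
    then have "c \<noteq> 0"
      using P(3)[OF w(1)] c[OF w(1)] by auto
    then show ?thesis
      using c by (intro that[of c]) simp
  next
    case False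
    have "0 < Re (1 / P z)" if z: "cmod z < 1" for z
    proof -
      have "0 < Re (P z)"
        using half_plane_constant[OF P(1,2) z] False by fastforce
      then show ?thesis
        by (simp add: Re_divide add_pos_nonneg)
    qed
    then show ?thesis
      by (rule that)
  qed
  obtain h where h: "h holomorphic_on ball 0 1" "inj_on h (ball 0 1)"
    "\<And>z. cmod z < 1 \<Longrightarrow> deriv h z * ((z - \<tau>) * (1 - cnj \<tau> * z) * P z) = (1 - (cmod \<tau>)\<^sup>2) * P \<tau> * h z"
    using Koenigs_interior[OF P(1) e \<tau>] by blast
  obtain l where "koenigs_semigroup F f h l \<mu>"
  proof (rule koenigs_semigroup_intro[of F f h \<mu> \<tau>])
    show "disc_semigroup F f" ..
    fix z :: complex assume z: "cmod z < 1"
    show "deriv h z * f z = \<mu> * h z"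
      using h(3)[OF z] by (simp only: P(3)[OF z] \<mu>)
    show "f z = 0 \<Longrightarrow> z = \<tau>"
      by (rule generator_zero_imp_dw[OF z])
    show "cmod ((1 - (cmod z)\<^sup>2) * (\<mu> - deriv f z) - 2 * cnj z * f z) \<le> 4 * cmod (f z)"
      using interior_null_bound[OF P(1,2) z \<tau>]
      unfolding \<mu> P(3)[OF z] DERIV_imp_deriv[OF f_deriv[OF z]] .
  qed (use h f_hol in auto)
  then show ?thesis
    by (rule that)
qed

lemma has_angular_derivative_radial:
  assumes "has_angular_derivative f \<tau> \<mu>" and \<tau>: "cmod \<tau> = 1"
  shows "((\<lambda>t. f (of_real t * \<tau>) / (of_real t * \<tau> - \<tau>)) \<longlongrightarrow> \<mu>) (at_left 1)"
proof -
  \<comment> \<open>On the radius \<open>cmod (z - \<tau>) = 1 - cmod z\<close>, so it lies in every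
    Stolz region of aperture above 1; 2 is a convenient value.\<close>
  have lim: "((\<lambda>z. f z / (z - \<tau>)) \<longlongrightarrow> \<mu>) (at \<tau> within stolz_region \<tau> 2)"
    using assms(1) by (simp add: has_angular_derivative_def)
  have "filterlim (\<lambda>t. of_real t * \<tau>) (at \<tau> within stolz_region \<tau> 2) (at_left (1::real))"
    unfolding filterlim_at
  proof (intro conjI)
    have "((\<lambda>t. of_real t * \<tau>) \<longlongrightarrow> of_real 1 * \<tau>) (at_left 1)"
      by (intro tendsto_intros)
    then show "((\<lambda>t. of_real t * \<tau>) \<longlongrightarrow> \<tau>) (at_left 1)"
      by simp
    have "\<forall>\<^sub>F t in at_left (1::real). 0 < t \<and> t < 1"
      by (auto simp: eventually_at_left_field intro!: exI[of _ 0])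
    then show "\<forall>\<^sub>F t in at_left 1. of_real t * \<tau> \<in> stolz_region \<tau> 2 \<and> of_real t * \<tau> \<noteq> \<tau>"
    proof (rule eventually_mono)
      fix t :: real assume t: "0 < t \<and> t < 1"
      have "of_real t * \<tau> - \<tau> = of_real (t - 1) * \<tau>"
        by (simp add: algebra_simps)
      then have "cmod (of_real t * \<tau> - \<tau>) = 1 - t" "cmod (of_real t * \<tau>) = t"
        using t \<tau> by (simp_all add: norm_mult del: of_real_diff)
      then show "of_real t * \<tau> \<in> stolz_region \<tau> 2 \<and> of_real t * \<tau> \<noteq> \<tau>"
        using t by (auto simp: stolz_region_def)
    qed
  qed
  from filterlim_compose[OF lim this] show ?thesis .
qed

lemma koenigs_hyperbolic:
  assumes "dw_semigroup F f \<tau>" and \<tau>: "cmod \<tau> = 1"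
    and ang: "has_angular_derivative f \<tau> (of_real m)" and m: "0 < m"
  obtains h l where "koenigs_semigroup F f h l (of_real m)"
proof -
  interpret dw_semigroup F f \<tau> by fact
  obtain P where P: "P holomorphic_on ball 0 1" "\<And>z. cmod z < 1 \<Longrightarrow> 0 \<le> Re (P z)"
    "\<And>z. cmod z < 1 \<Longrightarrow> f z = (z - \<tau>) * (1 - cnj \<tau> * z) * P z"
    using Berkson_Porta by blast
  have P_deriv: "(P has_field_derivative deriv P z) (at z)" if "cmod z < 1" for z
    using holomorphic_derivI[OF P(1)] that by simp
  have f_deriv: "(f has_field_derivative
      (1 - cnj \<tau> * z) * P z - cnj \<tau> * (z - \<tau>) * P z + (z - \<tau>) * (1 - cnj \<tau> * z) * deriv P z) (at z)"
    if "cmod z < 1" for z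
    by (rule has_field_derivative_transform_within_open[OF null_point_deriv[OF P_deriv[OF that]], of "ball 0 1"])
       (use that P(3) in auto)
  have f_hol: "f holomorphic_on ball 0 1"
    by (rule holomorphic_transform[of "\<lambda>z. (z - \<tau>) * (1 - cnj \<tau> * z) * P z"])
       (use P in \<open>auto intro!: holomorphic_intros\<close>)
  have \<tau>\<tau>: "cnj \<tau> * \<tau> = 1"
    using complex_norm_square[of \<tau>] \<tau> by (simp add: mult.commute)
  have ev: "\<forall>\<^sub>F t in at_left (1::real). 0 < t \<and> t < 1"
    by (auto simp: eventually_at_left_field intro!: exI[of _ 0])
  \<comment> \<open>At \<open>z = t * \<tau>\<close> the factor \<open>1 - cnj \<tau> * z\<close>
    equals \<open>1 - t\<close>; thus the angular derivative is the radial limit of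
    \<open>(1 - t) * P (t * \<tau>)\<close>.\<close>
  have "\<forall>\<^sub>F t in at_left 1. f (of_real t * \<tau>) / (of_real t * \<tau> - \<tau>) = (1 - of_real t) * P (of_real t * \<tau>)"
  proof (rule eventually_mono[OF ev])
    fix t :: real assume t: "0 < t \<and> t < 1"
    have "cmod (of_real t * \<tau>) < 1"
      using t \<tau> by (simp add: norm_mult)
    from P(3)[OF this]
    have "f (of_real t * \<tau>) = (of_real t * \<tau> - \<tau>) * ((1 - of_real t) * P (of_real t * \<tau>))"
      using \<tau>\<tau> by (simp add: mult.left_commute[of "cnj \<tau>"])
    moreover have "of_real t * \<tau> - \<tau> = of_real (t - 1) * \<tau>"
      by (simp add: algebra_simps)
    then have "of_real t * \<tau> - \<tau> \<noteq> 0"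
      using t \<tau> by auto
    ultimately show "f (of_real t * \<tau>) / (of_real t * \<tau> - \<tau>) = (1 - of_real t) * P (of_real t * \<tau>)"
      by simp
  qed
  with has_angular_derivative_radial[OF ang \<tau>]
  have lim: "((\<lambda>t. (1 - of_real t) * P (of_real t * \<tau>)) \<longlongrightarrow> of_real m) (at_left 1)"
    by (rule Lim_transform_eventually)
  \<comment> \<open>A constant \<open>P\<close> would give the limit 0 instead of
    \<open>m > 0\<close>. Hyperbolicity thus yields a strictly positive real part.\<close>
  have nc: "\<not> P constant_on ball 0 1"
  proof
    assume "P constant_on ball 0 1"
    then obtain c where c: "\<And>z. cmod z < 1 \<Longrightarrow> P z = c"
      unfolding constant_on_def by auto
    have "((\<lambda>t. (1 - complex_of_real t) * c) \<longlongrightarrow> (1 - of_real 1) * c) (at_left 1)"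
      by (intro tendsto_intros)
    moreover have "\<forall>\<^sub>F t in at_left 1. (1 - complex_of_real t) * c = (1 - of_real t) * P (of_real t * \<tau>)"
      by (rule eventually_mono[OF ev]) (use c \<tau> in \<open>simp add: norm_mult\<close>)
    ultimately have "((\<lambda>t. (1 - of_real t) * P (of_real t * \<tau>)) \<longlongrightarrow> (1 - of_real 1) * c) (at_left 1)"
      by (rule Lim_transform_eventually)
    from tendsto_unique[OF _ this lim] show False
      using m by simp
  qed
  have pos: "0 < Re (P z)" if "cmod z < 1" for z
    using half_plane_constant[OF P(1,2) that] nc by fastforce
  obtain h where h: "h holomorphic_on ball 0 1" "inj_on h (ball 0 1)"
    "\<And>z. cmod z < 1 \<Longrightarrow> deriv h z * ((z - \<tau>) * (1 - cnj \<tau> * z) * P z) = of_real m * h z"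
    using Koenigs_boundary[OF P(1) pos \<tau> lim m] by blast
  obtain l where "koenigs_semigroup F f h l (of_real m)"
  proof (rule koenigs_semigroup_intro[of F f h "of_real m" \<tau>])
    show "disc_semigroup F f" ..
    fix z :: complex assume z: "cmod z < 1"
    show "deriv h z * f z = of_real m * h z"
      using h(3)[OF z] by (simp only: P(3)[OF z])
    show "f z = 0 \<Longrightarrow> z = \<tau>"
      by (rule generator_zero_imp_dw[OF z])
    show "cmod ((1 - (cmod z)\<^sup>2) * (of_real m - deriv f z) - 2 * cnj z * f z) \<le> 4 * cmod (f z)"
      using boundary_null_bound[OF P(1,2) z \<tau> lim]
      unfolding P(3)[OF z] DERIV_imp_deriv[OF f_deriv[OF z]] .
  qed (use h f_hol in auto)
  then show ?thesis
    by (rule that)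
qed

lemma koenigs_semigroup_exists:
  assumes gen: "generator_of_on f F (ball 0 1)"
    and type: "dilation_type F \<tau> \<or> hyperbolic_type F f \<tau>"
    and deriv: "has_derivative_at_dw f \<tau> \<mu>"
  obtains h l where "koenigs_semigroup F f h l \<mu>"
proof -
  have "dw_semigroup F f \<tau>"
    using gen type by unfold_locales (auto simp: dilation_type_def hyperbolic_type_def)
  note dw = this
  show ?thesis
  proof (cases "\<tau> \<in> ball 0 1")
    case True
    then have "cmod \<tau> < 1" "(f has_field_derivative \<mu>) (at \<tau>)"
      using deriv by (simp_all add: has_derivative_at_dw_def)
    from koenigs_dilation[OF dw this] show ?thesis
      using that by blast
  next
    case False
    then obtain m where m: "cmod \<tau> = 1" "0 < m" "has_angular_derivative f \<tau> (of_real m)"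
      using type by (auto simp: dilation_type_def hyperbolic_type_def)
    moreover have "has_angular_derivative f \<tau> \<mu>"
      using deriv False by (simp add: has_derivative_at_dw_def)
    \<comment> \<open>The hyperbolic type provides some positive angular derivative; uniqueness of
      the radial limit identifies it with \<open>\<mu>\<close>.\<close>
    ultimately have "\<mu> = of_real m"
      using has_angular_derivative_radial tendsto_unique trivial_limit_at_left_real by blast
    then show ?thesis
      using koenigs_hyperbolic[OF dw m(1,3,2)] that by blast
  qed
qed

context koenigs_semigroup
begin

text \<open>The quotient agrees with \<open>deriv l\<close> wherever \<open>f\<close> does not
  vanish, that is, at all points of the disc except possibly \<open>\<tau>\<close>, and
  \<open>deriv l\<close> is continuous. The value filled in is therefore
  \<open>deriv l z\<close>.\<close>

lemma remove_sings_deriv_l: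
  assumes z: "cmod z < 1" and isolated: "\<And>w. cmod w < 1 \<Longrightarrow> f w = 0 \<Longrightarrow> w = \<tau>"
  shows "remove_sings (\<lambda>z. (\<mu> - deriv f z) / f z) z = deriv l z"
proof (rule remove_sings_eqI, rule Lim_transform_eventually)
  have "isCont (deriv l) z"
    using holomorphic_on_imp_continuous_on[OF holomorphic_deriv[OF l_hol]] z
    by (simp add: continuous_on_eq_continuous_at)
  then show "deriv l \<midarrow>z\<rightarrow> deriv l z"
    by (simp add: isCont_def)
  have "\<forall>\<^sub>F w in at z. w \<in> ball 0 1 - {z}"
    by (rule eventually_at_in_open) (use z in auto)
  moreover have "\<forall>\<^sub>F w in at z. w \<noteq> \<tau>"
    by (rule eventually_neq_at_within)
  ultimately show "\<forall>\<^sub>F w in at z. deriv l w = (\<mu> - deriv f w) / f w"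
  proof eventually_elim
    case (elim w)
    then have w: "cmod w < 1" "f w \<noteq> 0"
      using isolated[of w] by auto
    then show ?case
      using DERIV_imp_deriv[OF f_deriv[OF w(1)]] by simp
  qed
qed

end

theorem theorem5:
  fixes F :: "real \<Rightarrow> complex \<Rightarrow> complex"
    and f :: "complex \<Rightarrow> complex"
    and \<tau> \<mu> lam :: complex
    and r :: nat
    and Q :: "'y::complex_banach \<Rightarrow> complex"
  assumes "generator_of_on f F (ball 0 1)"
    and "dilation_type F \<tau> \<or> hyperbolic_type F f \<tau>"
    and "has_derivative_at_dw f \<tau> \<mu>"
    and "r \<ge> 1"
    and "homogeneous_polynomial r Q"
    and "Re lam > 0"
    and "(SUP y\<in>{y. norm y = 1}. ereal (cmod (Q y))) \<le> ereal (real r * Re lam / 4)"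
  shows "semigroup_generator_on (extended_generator f \<mu> r lam Q)
           (unit_domain r :: (complex \<times> 'y) set)"
proof -
  obtain h l where "koenigs_semigroup F f h l \<mu>"
    using koenigs_semigroup_exists[OF assms(1,2,3)] .
  then interpret koenigs_semigroup F f h l \<mu> .
  interpret extended_semigroup F f h l \<mu> r lam Q
    using assms(4-6) homogeneous_polynomial_norm_le[OF assms(5,4,7)] by unfold_locales auto
  interpret dw_semigroup F f \<tau>
    using assms(2) by unfold_locales (auto simp: dilation_type_def hyperbolic_type_def)
  have "generator_of_on (extended_generator f \<mu> r lam Q) flow (unit_domain r)"
  proof (rule generator_flow)
    fix p :: "complex \<times> 'y" assume p: "p \<in> unit_domain r"
    obtain x y where xy: "p = (x, y)" by (cases p)
    have x: "cmod x < 1"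
      using fst_lt[OF p] xy by simp
    have "remove_sings (\<lambda>z. (\<mu> - deriv f z) / f z) x = deriv l x"
      by (rule remove_sings_deriv_l[OF x generator_zero_imp_dw])
    \<comment> \<open>Substituting \<open>deriv f x = \<mu> - deriv l x * f x\<close> collects
      \<open>f x\<close> and \<open>Q y\<close> into the velocity of the first component.\<close>
    moreover have "1 / of_nat r * (deriv f x + of_nat r * lam - deriv l x * Q y)
        = (\<mu> / of_nat r + lam) - deriv l x * (f x + Q y) / of_nat r"
      unfolding DERIV_imp_deriv[OF f_deriv[OF x]] using r_lam(2) by (simp add: field_simps)
    ultimately show "extended_generator f \<mu> r lam Q p = (f (fst p) + Q (snd p),
      ((\<mu> / of_nat r + lam) - deriv l (fst p) * (f (fst p) + Q (snd p)) / of_nat r) *\<^sub>C snd p)"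
      by (simp only: extended_generator_def xy prod.case fst_conv snd_conv)
  qed
  then show ?thesis
    unfolding semigroup_generator_on_def by blast
qed

end
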